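(* Let $d>0$ and let $V_0:\mathbb{R}\to\mathbb{R}$ be an even, $d$-periodic $C^1$-function. For $t\in(0,d)$ let $L=-\partial_x^2+V(x)$ with $V(x)=V_0(x)$ for $x<0$ and $V(x)=V_0(x+t)$ for $x\ge0$. Consider the first finite gap $G_1=(s_2,s_3)$. (a) If $V_0$ is strictly increasing on $[0,\frac d2]$, and hence $G_1=(\nu_2,\mu_1)$, then there is exactly one dislocation eigenvalue in $G_1$ for all $t\in(0,d)$. (b) If $V_0$ is strictly decreasing on $[0,\frac d2]$, and hence $G_1=(\mu_1,\nu_2)$, then one has the following alternative for the second Neumann eigenfunction $u$ on $[0,d]$: (b1) $u$ is strictly monotone on $[0,\frac d2]$. Then there is exactly one dislocation eigenvalue in $G_1$ for all $t\in(0,d)$. (b2) $u$ changes monotonicity on $[0,\frac d2]$ exactly once, at an extremal point $d_0\in(0,\frac d2)$. Then the number of dislocation eigenvalues in $G_1$ is: $2$ for $t\in(0,d_0)$; $1$ for $t\in[d_0,d-d_0)$; $0$ for $t\in[d-d_0,d)$.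
   Context: The operator $L$ (the one-sided dislocation problem with parameter $t$) acts in $L^2(\mathbb{R})$ with domain $H^2(\mathbb{R})$; its eigenvalues are called dislocation eigenvalues. For $k\ge1$, $\mu_k$ and $\nu_k$ denote the $k$-th Dirichlet ($u(0)=u(d)=0$) and $k$-th Neumann ($u'(0)=u'(d)=0$) eigenvalue of $-\partial_x^2+V_0$ on $[0,d]$, in increasing order. The operator $L_0=-\partial_x^2+V_0$ on $\mathbb{R}$ has spectrum $\sigma(L_0)=\bigcup_{n\ge1}[s_{2n-1},s_{2n}]$ with $s_{2n-1}<s_{2n}\le s_{2n+1}$; the $s_j$ are the band edges, i.e. $s_1$ is the lowest $d$-periodic eigenvalue, $s_2\le s_3$ are the two lowest $d$-antiperiodic eigenvalues, and so on alternately. $G_1=(s_2,s_3)$. *)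

theory Defs
  imports "HOL-Analysis.Analysis" "HOL-Library.Function_Algebras"
begin

text \<open>Elements of $L^2(\mathbb{R})$ are represented by functions; equality in $L^2$ is equality
  almost everywhere. As in Brezis, weak derivatives are tested against $C^1$ functions of compact
  support.\<close>

definition L2 :: "(real \<Rightarrow> complex) set" where
  "L2 = {f \<in> borel_measurable lborel. integrable lborel (\<lambda>x. (cmod (f x))\<^sup>2)}"

definition test_function :: "(real \<Rightarrow> real) \<Rightarrow> bool" where
  "test_function \<phi> \<longleftrightarrow> \<phi> C1_differentiable_on UNIV \<and> compact (closure {x. \<phi> x \<noteq> 0})"

definition weak_deriv_L2 :: "(real \<Rightarrow> complex) \<Rightarrow> (real \<Rightarrow> complex) \<Rightarrow> bool" where
  "weak_deriv_L2 u g \<longleftrightarrow> u \<in> L2 \<and> g \<in> L2 \<and>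
     (\<forall>\<phi>. test_function \<phi> \<longrightarrow>
        (LINT x|lborel. deriv \<phi> x *\<^sub>R u x) = - (LINT x|lborel. \<phi> x *\<^sub>R g x))"

definition H2 :: "(real \<Rightarrow> complex) set" where
  "H2 = {u. \<exists>u1 u2. weak_deriv_L2 u u1 \<and> weak_deriv_L2 u1 u2}"

text \<open>The graph of the operator $-\partial_x^2 + V$ with domain $H^2(\mathbb{R})$, for bounded
  \<open>V\<close>: \<open>schroedinger_op V u w\<close> means that \<open>u\<close> lies in the domain and is mapped to \<open>w\<close>.\<close>

definition schroedinger_op :: "(real \<Rightarrow> real) \<Rightarrow> (real \<Rightarrow> complex) \<Rightarrow> (real \<Rightarrow> complex) \<Rightarrow> bool" where
  "schroedinger_op V u w \<longleftrightarrow> u \<in> H2 \<and>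
     (\<exists>u1 u2. weak_deriv_L2 u u1 \<and> weak_deriv_L2 u1 u2 \<and>
        (AE x in lborel. w x = - u2 x + of_real (V x) * u x))"

definition line_eigenvalue :: "(real \<Rightarrow> real) \<Rightarrow> real \<Rightarrow> bool" where
  "line_eigenvalue V E \<longleftrightarrow>
     (\<exists>u. \<not> (AE x in lborel. u x = 0) \<and> schroedinger_op V u (\<lambda>x. of_real E * u x))"

definition dislocation_potential :: "(real \<Rightarrow> real) \<Rightarrow> real \<Rightarrow> real \<Rightarrow> real" where
  "dislocation_potential V\<^sub>0 t x = (if x < 0 then V\<^sub>0 x else V\<^sub>0 (x + t))"

definition dislocation_eigenvalues :: "(real \<Rightarrow> real) \<Rightarrow> real \<Rightarrow> real set" where
  "dislocation_eigenvalues V\<^sub>0 t = {E. line_eigenvalue (dislocation_potential V\<^sub>0 t) E}"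

text \<open>A boundary condition is a predicate of $u(0)$, $u'(0)$, $u(d)$, $u'(d)$. Functions on
  $[0,d]$ are represented by functions vanishing outside $[0,d]$, so that the solutions of
  $-u'' + Vu = Eu$ satisfying the boundary condition form a vector space of the right
  dimension.\<close>

type_synonym boundary_condition = "real \<Rightarrow> real \<Rightarrow> real \<Rightarrow> real \<Rightarrow> bool"

definition eigenspace ::
    "boundary_condition \<Rightarrow> (real \<Rightarrow> real) \<Rightarrow> real \<Rightarrow> real \<Rightarrow> (real \<Rightarrow> real) set" where
  "eigenspace bc V d E = {u. (\<forall>x. x \<notin> {0..d} \<longrightarrow> u x = 0) \<and>
     (\<exists>u1 u2.
        (\<forall>x\<in>{0..d}. (u has_real_derivative u1 x) (at x within {0..d}) \<and>
                   (u1 has_real_derivative u2 x) (at x within {0..d}) \<and>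
                   - u2 x + V x * u x = E * u x) \<and>
        bc (u 0) (u1 0) (u d) (u1 d))}"

definition eigenvalue :: "boundary_condition \<Rightarrow> (real \<Rightarrow> real) \<Rightarrow> real \<Rightarrow> real \<Rightarrow> bool" where
  "eigenvalue bc V d E \<longleftrightarrow> (\<exists>u\<in>eigenspace bc V d E. u \<noteq> (\<lambda>x. 0))"

definition multiplicity_of :: "boundary_condition \<Rightarrow> (real \<Rightarrow> real) \<Rightarrow> real \<Rightarrow> real \<Rightarrow> nat" where
  "multiplicity_of bc V d E = vector_space.dim (\<lambda>(c::real) f x. c * f x) (eigenspace bc V d E)"

text \<open>The \<open>k\<close>-th eigenvalue, $k \ge 1$, in increasing order and repeated according to
  multiplicity, is the least \<open>E\<close> such that at least \<open>k\<close> eigenvalues are at most \<open>E\<close>.\<close>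

definition kth_eigenvalue :: "boundary_condition \<Rightarrow> (real \<Rightarrow> real) \<Rightarrow> real \<Rightarrow> nat \<Rightarrow> real" where
  "kth_eigenvalue bc V d k =
     (LEAST E. k \<le> (\<Sum>E'\<in>{E'. E' \<le> E \<and> eigenvalue bc V d E'}. multiplicity_of bc V d E'))"

definition dirichlet :: boundary_condition where
  "dirichlet u0 u0' ud ud' \<longleftrightarrow> u0 = 0 \<and> ud = 0"

definition neumann :: boundary_condition where
  "neumann u0 u0' ud ud' \<longleftrightarrow> u0' = 0 \<and> ud' = 0"

definition periodic :: boundary_condition where
  "periodic u0 u0' ud ud' \<longleftrightarrow> ud = u0 \<and> ud' = u0'"

definition antiperiodic :: boundary_condition where
  "antiperiodic u0 u0' ud ud' \<longleftrightarrow> ud = - u0 \<and> ud' = - u0'"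

abbreviation dirichlet_ev :: "(real \<Rightarrow> real) \<Rightarrow> real \<Rightarrow> nat \<Rightarrow> real" where
  "dirichlet_ev \<equiv> kth_eigenvalue dirichlet"

abbreviation neumann_ev :: "(real \<Rightarrow> real) \<Rightarrow> real \<Rightarrow> nat \<Rightarrow> real" where
  "neumann_ev \<equiv> kth_eigenvalue neumann"

text \<open>With $p_k$ and $a_k$ the $k$-th periodic and antiperiodic eigenvalues, the band edges
  $s_1, s_2, \dots$ are $p_1, a_1, a_2, p_2, p_3, a_3, a_4, p_4, p_5, \dots$\<close>

definition band_edge :: "(real \<Rightarrow> real) \<Rightarrow> real \<Rightarrow> nat \<Rightarrow> real" where
  "band_edge V d j =
     kth_eigenvalue (if even (j div 2) then periodic else antiperiodic) V d ((j + 1) div 2)"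

definition gap :: "(real \<Rightarrow> real) \<Rightarrow> real \<Rightarrow> nat \<Rightarrow> real set" where
  "gap V d n = {band_edge V d (2 * n) <..< band_edge V d (2 * n + 1)}"

definition neumann_eigenfunction ::
    "(real \<Rightarrow> real) \<Rightarrow> real \<Rightarrow> nat \<Rightarrow> (real \<Rightarrow> real) \<Rightarrow> bool" where
  "neumann_eigenfunction V d k u \<longleftrightarrow>
     u \<in> eigenspace neumann V d (neumann_ev V d k) \<and> u \<noteq> (\<lambda>x. 0)"

definition strictly_monotone_on :: "real set \<Rightarrow> (real \<Rightarrow> real) \<Rightarrow> bool" where
  "strictly_monotone_on A u \<longleftrightarrow> strict_mono_on A u \<or> strict_antimono_on A u"

definition changes_monotonicity_once_at :: "real \<Rightarrow> real \<Rightarrow> (real \<Rightarrow> real) \<Rightarrow> real \<Rightarrow> bool" where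
  "changes_monotonicity_once_at a b u c \<longleftrightarrow> c \<in> {a<..<b} \<and>
     (strict_mono_on {a..c} u \<and> strict_antimono_on {c..b} u \<or>
      strict_antimono_on {a..c} u \<and> strict_mono_on {c..b} u)"

definition has_exactly :: "'a set \<Rightarrow> nat \<Rightarrow> bool" where
  "has_exactly A n \<longleftrightarrow> finite A \<and> card A = n"

end

theory Submission
  imports Defs
begin

text \<open>
  The potential \<open>V\<close> is even and \<open>d\<close>-periodic, hence also symmetric about \<open>d/2\<close>. Let \<open>c\<close> and \<open>s\<close> be
  the solutions of \<open>- u'' + V u = E u\<close> with \<open>c = 1, c' = 0\<close> and \<open>s = 0, s' = 1\<close> at \<open>0\<close>, and let
  \<open>C, C', S, S'\<close> be the values of \<open>c, c', s, s'\<close> at \<open>d/2\<close>. The two reflections give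
  \<open>c(d) = s'(d) = 2 C S' - 1\<close>, \<open>c'(d) = 2 C C'\<close> and \<open>s(d) = 2 S S'\<close> (\<open>period_from_half_period\<close>), so that
  \<open>E\<close> is an antiperiodic eigenvalue exactly if \<open>C S' = 0\<close>. Let \<open>nu\<close> be the lowest zero of \<open>C\<close> and \<open>mu\<close>
  the lowest zero of \<open>S'\<close>, as functions of \<open>E\<close>. Sturm comparison shows that \<open>nu\<close> is the second
  Neumann and \<open>mu\<close> the first Dirichlet eigenvalue, and that \<open>nu\<close> and \<open>mu\<close> are the ends of the first gap
  (\<open>neumann_ev_2\<close>, \<open>dirichlet_ev_1\<close>, \<open>gap_1\<close>).

  Which end is which: let \<open>V\<close> be increasing on \<open>[0, d/2]\<close> and \<open>u = c\<close> at \<open>E = nu\<close>. Then \<open>u' < 0\<close> on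
  \<open>(0, d/2]\<close>, and \<open>q = - u'\<close> vanishes at \<open>0\<close>, has \<open>q' = 0\<close> at \<open>d/2\<close> and satisfies
  \<open>- q'' + V q = nu q + V' u\<close>. Pairing \<open>q\<close> with the positive ground state \<open>w\<close> of the same boundary
  conditions, which belongs to \<open>mu\<close>, makes \<open>(mu - nu)\<close> times the integral of \<open>q w\<close> equal to the
  integral of \<open>V' u w\<close>, which is positive (\<open>nu_less_mu\<close>). Translation of the potential by \<open>d/2\<close>
  exchanges \<open>nu\<close> and \<open>mu\<close> and settles the decreasing case.

  Inside the gap there is a solution \<open>\<phi>\<close> with \<open>\<phi>(x + d) = \<rho> \<phi>(x)\<close> and \<open>\<bar>\<rho>\<bar> < 1\<close>; explicitly,
  \<open>\<phi> = p c + q s\<close> with \<open>p\<^sup>2 = \<bar>S S'\<bar>\<close> and \<open>q\<^sup>2 = \<bar>C C'\<bar>\<close> (\<open>gap_multiplier\<close>). Since \<open>V\<close> is even,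
  \<open>\<phi>(- x)\<close> is the solution that decays at \<open>- \<infinity>\<close>. Hence \<open>E\<close> is a dislocation eigenvalue exactly if
  \<open>\<phi>(- x)\<close> and \<open>\<phi>(x + t)\<close> can be matched at \<open>0\<close>, that is, if \<open>\<phi>(t) \<phi>'(0) + \<phi>'(t) \<phi>(0) = 0\<close>
  (\<open>dislocation_eigenvalue_iff\<close>). The passage from \<open>H\<^sup>2\<close> to classical solutions is the lemma of
  du Bois-Reymond (\<open>weakly_differentiable_imp_primitive\<close>).

  Now write \<open>\<phi> + i \<phi>' = R exp(i \<alpha>)\<close> with a continuous angle \<open>\<alpha>(x, E)\<close>. The matching condition reads
  \<open>sin (\<alpha>(t, E) + \<alpha>(0, E)) = 0\<close>, and \<open>\<alpha>\<close> is strictly increasing in \<open>E\<close> (\<open>angle_strict_mono\<close>). So the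
  number of eigenvalues is the number of multiples of \<open>pi\<close> strictly between the values of
  \<open>\<alpha>(t, E) + \<alpha>(0, E)\<close> at the two ends of the gap. There \<open>\<phi>\<close> is a multiple of \<open>c\<close> (at \<open>nu\<close>) or \<open>s\<close>
  (at \<open>mu\<close>), and the signs of these functions locate the angles. In the increasing case the sum runs
  from \<open>(- pi, 0)\<close> to \<open>(0, pi)\<close> and passes one multiple of \<open>pi\<close>. In the decreasing case it
  starts in \<open>(- 2 pi, - pi)\<close> and ends at \<open>\<alpha>(t, nu)\<close>, the angle of the second Neumann eigenfunction at \<open>t\<close>.
  That angle lies in \<open>(- pi, 0)\<close> if the eigenfunction is monotone. With an extremum at \<open>d\<^sub>0\<close> it is
  in \<open>(0, pi)\<close> before \<open>d\<^sub>0\<close>, in \<open>(- pi, 0]\<close> from \<open>d\<^sub>0\<close> up to \<open>d - d\<^sub>0\<close>, and in \<open>(- 2 pi, - pi]\<close> from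
  \<open>d - d\<^sub>0\<close> on. This gives two, one and no eigenvalues.
\<close>


section \<open>Linear second order equations\<close>

text \<open>The equation \<open>u'' = q u\<close> as a first order system, so that a solution carries its
  derivative \<open>v\<close>. On a set with end points the derivatives are one-sided, as in the eigenvalue
  problems on \<open>[0, d]\<close>.\<close>

definition solves_on :: "real set \<Rightarrow> (real \<Rightarrow> real) \<Rightarrow> (real \<Rightarrow> real) \<Rightarrow> (real \<Rightarrow> real) \<Rightarrow> bool" where
  "solves_on I q u v \<longleftrightarrow> (\<forall>x\<in>I. (u has_real_derivative v x) (at x within I) \<and>
                               (v has_real_derivative q x * u x) (at x within I))"

lemma has_real_derivative_eq_on:
  fixes f g :: "real \<Rightarrow> real"
  assumes "(f has_real_derivative D) (at x within I)" "x \<in> I" "\<And>y. y \<in> I \<Longrightarrow> g y = f y"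
  shows "(g has_real_derivative D) (at x within I)"
  using assms has_derivative_transform[of x I g f] unfolding has_field_derivative_def by blast

lemma solves_onD:
  assumes "solves_on I q u v" "x \<in> I"
  shows "(u has_real_derivative v x) (at x within I)" "(v has_real_derivative q x * u x) (at x within I)"
  using assms by (auto simp: solves_on_def)

lemma solves_on_subset: "solves_on I q u v \<Longrightarrow> J \<subseteq> I \<Longrightarrow> solves_on J q u v"
  unfolding solves_on_def by (meson DERIV_subset subsetD)

lemma solves_on_cong:
  assumes "solves_on I q u v" "\<And>x. x \<in> I \<Longrightarrow> q' x = q x" "\<And>x. x \<in> I \<Longrightarrow> u' x = u x"
    "\<And>x. x \<in> I \<Longrightarrow> v' x = v x"
  shows "solves_on I q' u' v'"
  unfolding solves_on_def
proof (intro ballI conjI)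
  fix x assume x: "x \<in> I"
  show "(u' has_real_derivative v' x) (at x within I)"
    using has_real_derivative_eq_on[OF solves_onD(1)[OF assms(1) x] x] assms(3,4) x by simp
  show "(v' has_real_derivative q' x * u' x) (at x within I)"
    using has_real_derivative_eq_on[OF solves_onD(2)[OF assms(1) x] x] assms(2,3,4) x by simp
qed

lemma solves_on_lincomb:
  assumes "solves_on I q u v" "solves_on I q u' v'"
  shows "solves_on I q (\<lambda>x. a * u x + b * u' x) (\<lambda>x. a * v x + b * v' x)"
  unfolding solves_on_def
proof (intro ballI conjI)
  fix x assume x: "x \<in> I"
  note D = solves_onD[OF assms(1) x] solves_onD[OF assms(2) x]
  show "((\<lambda>x. a * u x + b * u' x) has_real_derivative a * v x + b * v' x) (at x within I)"
    by (intro DERIV_add DERIV_cmult D)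
  have "((\<lambda>x. a * v x + b * v' x) has_real_derivative a * (q x * u x) + b * (q x * u' x)) (at x within I)"
    by (intro DERIV_add DERIV_cmult D)
  then show "((\<lambda>x. a * v x + b * v' x) has_real_derivative q x * (a * u x + b * u' x)) (at x within I)"
    by (simp add: algebra_simps)
qed

lemma solves_on_continuous:
  assumes "solves_on I q u v" shows "continuous_on I u" "continuous_on I v"
  using solves_onD[OF assms] by (auto intro!: DERIV_continuous_on)

text \<open>The comparison arguments below use monotonicity of a Wronskian on a closed interval at whose ends
  only one-sided derivatives are given.\<close>

lemma mono_from_deriv:
  fixes f :: "real \<Rightarrow> real"
  assumes "\<And>x. x \<in> {a..b} \<Longrightarrow> (f has_real_derivative f' x) (at x within {a..b})"
    and "\<And>x. x \<in> {a<..<b} \<Longrightarrow> f' x \<ge> 0" and "a \<le> b"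
  shows "f a \<le> f b"
proof (rule DERIV_nonneg_imp_increasing_open[OF \<open>a \<le> b\<close>])
  fix x assume x: "a < x" "x < b"
  have "(f has_real_derivative f' x) (at x)"
    using assms(1)[of x] x at_within_Icc_at[of a x b] by auto
  then show "\<exists>y. DERIV f x :> y \<and> y \<ge> 0" using assms(2)[of x] x by auto
qed (rule DERIV_continuous_on[OF assms(1)])

lemma strict_mono_from_deriv:
  fixes f :: "real \<Rightarrow> real"
  assumes "\<And>x. x \<in> {a..b} \<Longrightarrow> (f has_real_derivative f' x) (at x within {a..b})"
    and "\<And>x. x \<in> {a<..<b} \<Longrightarrow> f' x > 0" and "a < b"
  shows "f a < f b"
proof (rule DERIV_pos_imp_increasing_open[OF \<open>a < b\<close>])
  fix x assume x: "a < x" "x < b"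
  have "(f has_real_derivative f' x) (at x)"
    using assms(1)[of x] x at_within_Icc_at[of a x b] by auto
  then show "\<exists>y. DERIV f x :> y \<and> y > 0" using assms(2)[of x] x by auto
qed (rule DERIV_continuous_on[OF assms(1)])

lemma continuous_on_Icc_bounded:
  fixes f :: "real \<Rightarrow> real"
  assumes "continuous_on {a..b} f" shows "\<exists>K. \<forall>x\<in>{a..b}. \<bar>f x\<bar> \<le> K"
  using compact_imp_bounded[OF compact_continuous_image[OF assms]] by (simp add: bounded_iff)

text \<open>Picard iteration for the system \<open>u' = v, v' = q u\<close> started at \<open>(a, b)\<close>,
  recording only the increments: the \<open>n\<close>-th pair is the part of the solution of order
  \<open>n\<close>, and the solution is the sum of all of them.\<close>

fun picard :: "(real \<Rightarrow> real) \<Rightarrow> real \<Rightarrow> real \<Rightarrow> nat \<Rightarrow> (real \<Rightarrow> real) \<times> (real \<Rightarrow> real)" where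
  "picard q a b 0 = ((\<lambda>x. a), (\<lambda>x. b))"
| "picard q a b (Suc n) = ((\<lambda>x. integral {0..x} (snd (picard q a b n))),
                           (\<lambda>x. integral {0..x} (\<lambda>y. q y * fst (picard q a b n) y)))"

lemma continuous_on_halfline_integral:
  fixes f :: "real \<Rightarrow> real"
  assumes "continuous_on {0..L} f"
  shows "continuous_on {0..L} (\<lambda>x. integral {0..x} f)"
  by (rule indefinite_integral_continuous_1) (simp add: assms integrable_continuous_interval)

lemma picard_continuous:
  assumes q: "continuous_on {0..L} q"
  shows "continuous_on {0..L} (fst (picard q a b n)) \<and> continuous_on {0..L} (snd (picard q a b n))"
  by (induction n) (auto intro!: continuous_on_halfline_integral continuous_on_mult q)

text \<open>One integration turns the bound \<open>y ^ n / fact n\<close> into the next one; this is why the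
  Picard series converges like an exponential series.\<close>

lemma integral_power_fact_bound:
  fixes f :: "real \<Rightarrow> real"
  assumes f: "continuous_on {0..x} f" and x: "0 \<le> x"
    and bd: "\<And>y. y \<in> {0..x} \<Longrightarrow> \<bar>f y\<bar> \<le> B * (K * y) ^ n / fact n * K" 
  shows "\<bar>integral {0..x} f\<bar> \<le> B * (K * x) ^ Suc n / fact (Suc n)"
proof -
  have D: "((\<lambda>y. B * (K * y) ^ Suc n / fact (Suc n)) has_vector_derivative
      B * (K * y) ^ n / fact n * K) (at y within {0..x})" for y
  proof -
    have "((\<lambda>y. B * (K * y) ^ Suc n / fact (Suc n)) has_real_derivative
        B * (real (Suc n) * (K * y) ^ n * K) / fact (Suc n)) (at y within {0..x})"
      by (rule derivative_eq_intros refl | simp)+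
    moreover have "B * (real (Suc n) * (K * y) ^ n * K) / fact (Suc n) = B * (K * y) ^ n / fact n * K"
      by (simp add: divide_simps)
    ultimately show ?thesis
      unfolding has_real_derivative_iff_has_vector_derivative[symmetric] by (simp only:)
  qed
  have I: "((\<lambda>y. B * (K * y) ^ n / fact n * K) has_integral B * (K * x) ^ Suc n / fact (Suc n)) {0..x}"
    using fundamental_theorem_of_calculus[OF x D] by simp
  have "norm (integral {0..x} f) \<le> integral {0..x} (\<lambda>y. B * (K * y) ^ n / fact n * K)"
    by (rule integral_norm_bound_integral)
       (use f bd I in \<open>auto intro: integrable_continuous_interval simp: has_integral_iff\<close>)
  then show ?thesis using I by (simp add: has_integral_iff)
qed

lemma picard_bound:
  assumes q: "continuous_on {0..L} q" and K: "K \<ge> 1" "\<And>x. x \<in> {0..L} \<Longrightarrow> \<bar>q x\<bar> \<le> K"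
    and x: "x \<in> {0..L}" and B: "B \<ge> \<bar>a\<bar>" "B \<ge> \<bar>b\<bar>"
  shows "\<bar>fst (picard q a b n) x\<bar> \<le> B * (K * x) ^ n / fact n \<and>
         \<bar>snd (picard q a b n) x\<bar> \<le> B * (K * x) ^ n / fact n"
  using x
proof (induction n arbitrary: x)
  case 0 then show ?case using B by simp
next
  case (Suc n)
  have B0: "B \<ge> 0" using B by linarith
  have sub: "{0..x} \<subseteq> {0..L}" using Suc.prems by auto
  have cf: "continuous_on {0..x} (fst (picard q a b n))" "continuous_on {0..x} (snd (picard q a b n))"
      "continuous_on {0..x} q"
    using picard_continuous[OF q] sub q by (meson continuous_on_subset)+
  have IH: "\<bar>fst (picard q a b n) y\<bar> \<le> B * (K * y) ^ n / fact n" 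
           "\<bar>snd (picard q a b n) y\<bar> \<le> B * (K * y) ^ n / fact n" 
           "0 \<le> B * (K * y) ^ n / fact n" if "y \<in> {0..x}" for y
    using Suc.IH[of y] that sub B0 K by auto
  show ?case
  proof
    show "\<bar>fst (picard q a b (Suc n)) x\<bar> \<le> B * (K * x) ^ Suc n / fact (Suc n)"
      unfolding picard.simps fst_conv
    proof (rule integral_power_fact_bound)
      fix y assume y: "y \<in> {0..x}"
      show "\<bar>snd (picard q a b n) y\<bar> \<le> B * (K * y) ^ n / fact n * K"
        using IH(2,3)[OF y] K(1) mult_left_mono[of 1 K "B * (K * y) ^ n / fact n"] by linarith
    qed (use cf Suc.prems in auto)
    show "\<bar>snd (picard q a b (Suc n)) x\<bar> \<le> B * (K * x) ^ Suc n / fact (Suc n)"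
      unfolding picard.simps snd_conv
    proof (rule integral_power_fact_bound)
      fix y assume y: "y \<in> {0..x}"
      have "\<bar>q y * fst (picard q a b n) y\<bar> \<le> K * (B * (K * y) ^ n / fact n)"
        unfolding abs_mult using IH(1,3)[OF y] K(2)[of y] sub y K(1) by (intro mult_mono) auto
      then show "\<bar>q y * fst (picard q a b n) y\<bar> \<le> B * (K * y) ^ n / fact n * K"
        by (simp add: mult.commute)
    qed (use cf Suc.prems in \<open>auto intro!: continuous_on_mult\<close>)
  qed
qed

text \<open>Termwise differentiation of a series whose terms are successive primitives, the first one
  constant.\<close>

lemma suminf_of_primitives_deriv:
  fixes f g :: "nat \<Rightarrow> real \<Rightarrow> real"
  assumes D: "\<And>n x. x \<in> {0..L} \<Longrightarrow> (f (Suc n) has_real_derivative g n x) (at x within {0..L})"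
    and f0: "\<And>x. f 0 x = a" and L: "L > 0"
    and bf: "\<And>n x. x \<in> {0..L} \<Longrightarrow> \<bar>f n x\<bar> \<le> M n" and bg: "\<And>n x. x \<in> {0..L} \<Longrightarrow> \<bar>g n x\<bar> \<le> M n"
    and M: "summable M" and x: "x \<in> {0..L}"
  shows "((\<lambda>x. \<Sum>n. f n x) has_real_derivative (\<Sum>n. g n x)) (at x within {0..L})"
proof -
  define f' where "f' n x = (case n of 0 \<Rightarrow> 0 | Suc m \<Rightarrow> g m x)" for n :: nat and x :: real
  define M' where "M' n = (case n of 0 \<Rightarrow> 0 | Suc m \<Rightarrow> M m)" for n :: nat
  have M': "summable M'"
    using M unfolding M'_def by (subst summable_Suc_iff[symmetric]) simp
  have M0: "M n \<ge> 0" for n using bf[of 0 n] L by (smt (verit) atLeastAtMost_iff)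
  have ul: "uniform_limit {0..L} (\<lambda>n x. \<Sum>i<n. f' i x) (\<lambda>x. \<Sum>i. f' i x) sequentially"
    by (rule Weierstrass_m_test[OF _ M']) (use bg in \<open>auto simp: f'_def M'_def split: nat.splits\<close>)
  have D': "(f n has_real_derivative f' n x) (at x within {0..L})" if "x \<in> {0..L}" for n x
  proof (cases n)
    case 0
    have "f 0 = (\<lambda>x. a)" using f0 by auto
    then show ?thesis using 0 by (simp add: f'_def)
  qed (use D[OF that] in \<open>simp add: f'_def\<close>)
  have sf: "summable (\<lambda>n. f n x)" if "x \<in> {0..L}" for x
    by (rule summable_comparison_test[OF _ M]) (use bf[OF that] in auto)
  obtain G where G: "\<And>x. x \<in> {0..L} \<Longrightarrow> (\<lambda>n. f n x) sums G x \<and>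
        (G has_real_derivative (\<Sum>i. f' i x)) (at x within {0..L})"
    using has_field_derivative_series[OF convex_real_interval(5) D' ul, of 0] sf[of 0] L
    by (simp del: atLeastAtMost_iff) (metis atLeastAtMost_iff order_refl order_less_imp_le)
  have "((\<lambda>x. \<Sum>n. f n x) has_real_derivative (\<Sum>i. f' i x)) (at x within {0..L})"
    by (rule has_real_derivative_eq_on[of G]) (use G x in \<open>auto simp: sums_iff\<close>)
  moreover have "(\<Sum>i. f' i x) = (\<Sum>n. g n x)"
  proof -
    have "summable (\<lambda>n. g n x)" by (rule summable_comparison_test[OF _ M]) (use bg[OF x] in auto)
    then have "summable (\<lambda>n. f' n x)" by (subst summable_Suc_iff[symmetric]) (simp add: f'_def)
    from suminf_split_head[OF this] show ?thesis by (simp add: f'_def)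
  qed
  ultimately show ?thesis by simp
qed

lemma ivp_exists:
  assumes q: "continuous_on {0..} q"
  shows "\<exists>u v. solves_on {0..} q u v \<and> u 0 = a \<and> v 0 = b"
proof -
  define f where "f n = fst (picard q a b n)" for n
  define g where "g n = snd (picard q a b n)" for n
  define U where "U x = (\<Sum>n. f n x)" for x
  define W where "W x = (\<Sum>n. g n x)" for x
  define B where "B = max \<bar>a\<bar> \<bar>b\<bar>"
  have main: "(U has_real_derivative W x) (at x within {0..L}) \<and>
              (W has_real_derivative q x * U x) (at x within {0..L})" if x: "x \<in> {0..L}" and L: "L > 0" for x L
  proof -
    have qL: "continuous_on {0..L} q" by (rule continuous_on_subset[OF q]) auto
    obtain K0 where K0: "\<And>x. x \<in> {0..L} \<Longrightarrow> \<bar>q x\<bar> \<le> K0"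
      using continuous_on_Icc_bounded[OF qL] by blast
    define K where "K = max 1 K0"
    have K: "K \<ge> 1" "\<And>x. x \<in> {0..L} \<Longrightarrow> \<bar>q x\<bar> \<le> K"
      using K0 by (simp_all add: K_def del: atLeastAtMost_iff add: max.coboundedI2)
    define M where "M n = B * (K * L) ^ n / fact n" for n :: nat
    have sM: "summable M" unfolding M_def
      using summable_mult[OF summable_exp[of "K * L"], of B] by (simp add: field_simps)
    have mono: "B * (K * x) ^ n / fact n \<le> M n" if "x \<in> {0..L}" for n x
      unfolding M_def using that K by (intro divide_right_mono mult_left_mono power_mono) (auto simp: B_def)
    have bf: "\<bar>f n x\<bar> \<le> M n" and bg: "\<bar>g n x\<bar> \<le> M n" if "x \<in> {0..L}" for n x
      using picard_bound[OF qL K that, of a B b n] mono[OF that, of n] 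
      by (auto simp: f_def g_def B_def)
    have cf: "continuous_on {0..L} (f n)" "continuous_on {0..L} (g n)" for n
      using picard_continuous[OF qL] by (auto simp: f_def g_def)
    have "(U has_real_derivative W x) (at x within {0..L})"
      unfolding U_def W_def
    proof (rule suminf_of_primitives_deriv[where a = a and M = M])
      show "(f (Suc n) has_real_derivative g n x) (at x within {0..L})" if "x \<in> {0..L}" for n x
        using integral_has_real_derivative[OF cf(2) that] by (simp add: f_def g_def)
    qed (use bf bg sM x L in \<open>auto simp: f_def\<close>)
    moreover have "(W has_real_derivative (\<Sum>n. q x * f n x)) (at x within {0..L})"
      unfolding W_def
    proof (rule suminf_of_primitives_deriv[where a = b and M = "\<lambda>n. K * M n"])
      show "(g (Suc n) has_real_derivative q x * f n x) (at x within {0..L})" if "x \<in> {0..L}" for n x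
        using integral_has_real_derivative[OF continuous_on_mult[OF qL cf(1)] that] by (simp add: f_def g_def)
      have "0 \<le> M n" for n using bf[OF x, of n] by linarith
      then show "\<bar>g n x\<bar> \<le> K * M n" if "x \<in> {0..L}" for n x
        using bg[OF that, of n] K(1) mult_right_mono[of 1 K "M n"] by fastforce
      show "\<bar>q x * f n x\<bar> \<le> K * M n" if "x \<in> {0..L}" for n x
        unfolding abs_mult using K that bf[OF that] by (intro mult_mono) auto
    qed (use sM x L in \<open>auto simp: g_def intro: summable_mult\<close>)
    moreover have "(\<Sum>n. q x * f n x) = q x * U x"
      unfolding U_def by (rule suminf_mult[OF summable_comparison_test[OF _ sM]]) (use bf[OF x] in auto)
    ultimately show ?thesis by simp
  qed
  have "solves_on {0..} q U W"
    unfolding solves_on_def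
  proof
    fix x :: real assume x: "x \<in> {0..}"
    have "at x within {0..} = at x within {0..x+1}"
      by (rule at_within_nhd[of x "{..<x+1}"]) auto
    then show "(U has_real_derivative W x) (at x within {0..}) \<and>
       (W has_real_derivative q x * U x) (at x within {0..})"
      using main[of x "x+1"] x by auto
  qed
  moreover have "U 0 = a" "W 0 = b"
  proof -
    have z: "f (Suc n) 0 = 0" "g (Suc n) 0 = 0" for n by (simp_all add: f_def g_def)
    have "U 0 = (\<Sum>n\<in>{0}. f n 0)" unfolding U_def 
    proof (rule suminf_finite)
      fix n :: nat assume "n \<notin> {0}"
      then obtain m where "n = Suc m" by (cases n) auto
      then show "f n 0 = 0" by (simp only: z)
    qed simp
    then show "U 0 = a" by (simp add: f_def)
    have "W 0 = (\<Sum>n\<in>{0}. g n 0)" unfolding W_def 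
    proof (rule suminf_finite)
      fix n :: nat assume "n \<notin> {0}"
      then obtain m where "n = Suc m" by (cases n) auto
      then show "g n 0 = 0" by (simp only: z)
    qed simp
    then show "W 0 = b" by (simp add: g_def)
  qed
  ultimately show ?thesis by blast
qed


text \<open>Gronwall's argument for the energy \<open>f\<^sup>2 + g\<^sup>2\<close>: the growth rate \<open>K
  + 2\<close> absorbs the cross terms \<open>2 f g\<close>, \<open>2 g q f\<close> and \<open>2 g r\<close>.
  The case \<open>r = 0\<close> yields uniqueness, a small \<open>r\<close> yields continuous dependence on
  the energy.\<close>

lemma energy_estimate:
  assumes f: "\<And>x. x \<in> {0..b} \<Longrightarrow> (f has_real_derivative g x) (at x within {0..b})"
    and g: "\<And>x. x \<in> {0..b} \<Longrightarrow> (g has_real_derivative q x * f x + r x) (at x within {0..b})"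
    and init: "f 0 = 0" "g 0 = 0" and b: "b \<ge> 0"
    and K: "\<And>x. x \<in> {0..b} \<Longrightarrow> \<bar>q x\<bar> \<le> K" and m: "\<And>x. x \<in> {0..b} \<Longrightarrow> \<bar>r x\<bar> \<le> m"
    and x: "x \<in> {0..b}"
  shows "(f x)\<^sup>2 + (g x)\<^sup>2 \<le> m\<^sup>2 * x * exp ((K + 2) * x)"
proof -
  have K0: "K \<ge> 0" and m0: "m \<ge> 0" using K[of 0] m[of 0] b by auto
  \<comment> \<open>\<open>F\<close> is increasing because the exponential factor compensates the growth of
    the energy.\<close>
  define F where "F x = m\<^sup>2 * x - ((f x)\<^sup>2 + (g x)\<^sup>2) * exp (- (K + 2) * x)" for x
  define F' where "F' x = m\<^sup>2 - (2 * f x * g x + 2 * g x * (q x * f x + r x) - (K + 2) * ((f x)\<^sup>2 + (g x)\<^sup>2)) * exp (- (K + 2) * x)" for x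
  have "F 0 \<le> F x"
  proof (rule mono_from_deriv[where f = F and f' = F' and a = 0 and b = x])
    fix y assume y: "y \<in> {0..x}"
    then have y': "y \<in> {0..b}" using x by auto
    have "(F has_real_derivative
        (m\<^sup>2 * 1 - ((2 * f y * g y + 2 * g y * (q y * f y + r y)) * exp (- (K + 2) * y)
          + (exp (- (K + 2) * y) * (- (K + 2) * 1)) * ((f y)\<^sup>2 + (g y)\<^sup>2)))) (at y within {0..b})"
      unfolding F_def
      by (rule derivative_eq_intros f[OF y'] g[OF y'] refl | simp)+
    moreover have "(m\<^sup>2 * 1 - ((2 * f y * g y + 2 * g y * (q y * f y + r y)) * exp (- (K + 2) * y)
          + (exp (- (K + 2) * y) * (- (K + 2) * 1)) * ((f y)\<^sup>2 + (g y)\<^sup>2))) = F' y"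
      unfolding F'_def by algebra
    ultimately have "(F has_real_derivative F' y) (at y within {0..b})" by (simp only:)
    then show "(F has_real_derivative F' y) (at y within {0..x})"
      by (rule DERIV_subset) (use x in auto)
  next
    fix y assume y: "y \<in> {0<..<x}"
    then have y': "y \<in> {0..b}" using x by auto
    have s: "2 * \<bar>f y * g y\<bar> \<le> (f y)\<^sup>2 + (g y)\<^sup>2"
      using sum_squares_bound[of "\<bar>f y\<bar>" "\<bar>g y\<bar>"] by (simp add: abs_mult)
    have s1: "2 * f y * g y \<le> (f y)\<^sup>2 + (g y)\<^sup>2" using s by linarith
    have "2 * g y * (q y * f y) \<le> \<bar>q y\<bar> * (2 * \<bar>f y * g y\<bar>)"
      using abs_ge_self[of "q y * (2 * (f y * g y))"] unfolding abs_mult by (simp add: mult_ac)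
    also have "\<dots> \<le> K * ((f y)\<^sup>2 + (g y)\<^sup>2)"
      using K[OF y'] s K0 by (intro mult_mono) auto
    finally have s2: "2 * g y * (q y * f y) \<le> K * ((f y)\<^sup>2 + (g y)\<^sup>2)" .
    have "2 * g y * r y \<le> (g y)\<^sup>2 + (r y)\<^sup>2" using sum_squares_bound[of "g y" "r y"] by simp
    moreover have "(r y)\<^sup>2 \<le> m\<^sup>2" using m[OF y'] m0 abs_le_square_iff[of "r y" m] by simp
    moreover have "(f y)\<^sup>2 \<ge> 0" by simp
    ultimately have s3: "2 * g y * r y \<le> (f y)\<^sup>2 + (g y)\<^sup>2 + m\<^sup>2" by linarith
    have "2 * f y * g y + 2 * g y * (q y * f y + r y) - (K + 2) * ((f y)\<^sup>2 + (g y)\<^sup>2) \<le> m\<^sup>2"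
      using s1 s2 s3 by (simp add: algebra_simps)
    then have "(2 * f y * g y + 2 * g y * (q y * f y + r y) - (K + 2) * ((f y)\<^sup>2 + (g y)\<^sup>2)) * exp (- (K + 2) * y)
        \<le> m\<^sup>2 * exp (- (K + 2) * y)" by (intro mult_right_mono) auto
    also have "\<dots> \<le> m\<^sup>2 * 1" using y K0 by (intro mult_left_mono) (auto simp: mult_nonpos_nonneg)
    finally show "F' y \<ge> 0" unfolding F'_def by simp
  qed (use x in auto)
  then have "((f x)\<^sup>2 + (g x)\<^sup>2) * exp (- (K + 2) * x) \<le> m\<^sup>2 * x"
    by (simp add: F_def init)
  then have "((f x)\<^sup>2 + (g x)\<^sup>2) * exp (- (K + 2) * x) * exp ((K+2) * x) \<le> m\<^sup>2 * x * exp ((K+2) * x)"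
    by (intro mult_right_mono) auto
  then show ?thesis by (simp add: mult.assoc flip: exp_add) (simp add: algebra_simps)
qed

lemma ivp_unique:
  assumes 1: "solves_on {0..b} q u v" and 2: "solves_on {0..b} q u' v'"
    and q: "continuous_on {0..b} q" and init: "u 0 = u' 0" "v 0 = v' 0" and x: "x \<in> {0..b}"
  shows "u x = u' x" "v x = v' x"
proof -
  obtain K where K: "\<And>x. x \<in> {0..b} \<Longrightarrow> \<bar>q x\<bar> \<le> K"
    using continuous_on_Icc_bounded[OF q] by blast
  have "(u x - u' x)\<^sup>2 + (v x - v' x)\<^sup>2 \<le> 0\<^sup>2 * x * exp ((K + 2) * x)"
    by (rule energy_estimate[where q = q and r = "\<lambda>x. 0" and b = b])
       (use K init x solves_onD[OF 1] solves_onD[OF 2] in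
         \<open>auto intro!: DERIV_diff simp: right_diff_distrib\<close>)
  then show "u x = u' x" "v x = v' x" by (auto simp: sum_power2_le_zero_iff)
qed

definition ivp_solution :: "(real \<Rightarrow> real) \<Rightarrow> real \<Rightarrow> real \<Rightarrow> (real \<Rightarrow> real) \<times> (real \<Rightarrow> real)" where
  "ivp_solution q a b = (SOME uv. solves_on {0..} q (fst uv) (snd uv) \<and> fst uv 0 = a \<and> snd uv 0 = b)"

lemma ivp_solution:
  assumes "continuous_on {0..} q"
  shows "solves_on {0..} q (fst (ivp_solution q a b)) (snd (ivp_solution q a b))"
    "fst (ivp_solution q a b) 0 = a" "snd (ivp_solution q a b) 0 = b"
proof -
  have "\<exists>uv. solves_on {0..} q (fst uv) (snd uv) \<and> fst uv 0 = a \<and> snd uv 0 = b"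
    using ivp_exists[OF assms, of a b] by auto
  from someI_ex[OF this] show "solves_on {0..} q (fst (ivp_solution q a b)) (snd (ivp_solution q a b))"
    "fst (ivp_solution q a b) 0 = a" "snd (ivp_solution q a b) 0 = b"
    unfolding ivp_solution_def by auto
qed

section \<open>Canonical solutions and their dependence on the energy\<close>

text \<open>Lagrange's identity. It carries every comparison below: the Wronskian of two solutions is monotone
  where their product and the difference of their potentials have a fixed sign.\<close>

lemma wronskian_derivative:
  assumes "solves_on I q u v" "solves_on I p f g" "x \<in> I"
  shows "((\<lambda>x. v x * f x - u x * g x) has_real_derivative (q x - p x) * (u x * f x)) (at x within I)"
proof -
  note D = solves_onD[OF assms(1,3)] solves_onD[OF assms(2,3)]
  have "((\<lambda>x. v x * f x - u x * g x) has_real_derivative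
      (q x * u x * f x + g x * v x) - (v x * g x + p x * f x * u x)) (at x within I)"
    by (intro DERIV_diff DERIV_mult D)
  then show ?thesis by (simp add: algebra_simps)
qed

lemma wronskian_constant:
  assumes "solves_on I q u v" "solves_on I q f g" "convex I" "x \<in> I" "y \<in> I"
  shows "v x * f x - u x * g x = v y * f y - u y * g y"
proof -
  have "((\<lambda>x. v x * f x - u x * g x) has_real_derivative 0) (at x within I)" if "x \<in> I" for x
    using wronskian_derivative[OF assms(1,2) that] by simp
  from has_field_derivative_zero_constant[OF assms(3) this] obtain c
    where "\<And>x. x \<in> I \<Longrightarrow> v x * f x - u x * g x = c" by blast
  then show ?thesis using assms by metis
qed

text \<open>For \<open>\<sigma> = 1\<close> this is a translation, for \<open>\<sigma> = - 1\<close> a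
  reflection.\<close>

lemma solves_on_affine:
  assumes S: "solves_on I q u v" and \<sigma>: "\<sigma> * \<sigma> = 1" and J: "\<And>x. x \<in> J \<Longrightarrow> a + \<sigma> * x \<in> I"
  shows "solves_on J (\<lambda>x. q (a + \<sigma> * x)) (\<lambda>x. u (a + \<sigma> * x)) (\<lambda>x. \<sigma> * v (a + \<sigma> * x))"
  unfolding solves_on_def
proof (intro ballI conjI)
  fix x assume x: "x \<in> J"
  have sub: "(\<lambda>x. a + \<sigma> * x) ` J \<subseteq> I" using J by auto
  have lin: "((\<lambda>x. a + \<sigma> * x) has_real_derivative \<sigma>) (at x within J)"
    by (auto intro!: derivative_eq_intros)
  note D = solves_onD[OF S J[OF x], THEN DERIV_subset[OF _ sub]]
  have "((\<lambda>x. u (a + \<sigma> * x)) has_real_derivative v (a + \<sigma> * x) * \<sigma>) (at x within J)"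
    using DERIV_image_chain[OF D(1) lin] by (simp add: o_def)
  then show "((\<lambda>x. u (a + \<sigma> * x)) has_real_derivative \<sigma> * v (a + \<sigma> * x)) (at x within J)"
    by (simp add: mult.commute)
  have "((\<lambda>x. v (a + \<sigma> * x)) has_real_derivative (q (a + \<sigma> * x) * u (a + \<sigma> * x)) * \<sigma>) (at x within J)"
    using DERIV_image_chain[OF D(2) lin] by (simp add: o_def)
  from DERIV_cmult[OF this, of \<sigma>] \<sigma>
  show "((\<lambda>x. \<sigma> * v (a + \<sigma> * x)) has_real_derivative q (a + \<sigma> * x) * u (a + \<sigma> * x)) (at x within J)"
    by (simp add: mult.left_commute[of \<sigma>])
qed

lemma solves_on_reflect:
  "solves_on {0..b} q u v \<Longrightarrow> solves_on {0..b} (\<lambda>x. q (b - x)) (\<lambda>x. u (b - x)) (\<lambda>x. - v (b - x))"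
  using solves_on_affine[of "{0..b}" q u v "-1" "{0..b}" b] by simp

lemma solves_on_shift:
  "solves_on {0..} q u v \<Longrightarrow> t \<ge> 0 \<Longrightarrow> solves_on {0..} (\<lambda>x. q (x + t)) (\<lambda>x. u (x + t)) (\<lambda>x. v (x + t))"
  using solves_on_affine[of "{0..}" q u v 1 "{0..}" t] by (simp add: add.commute)

lemma solves_on_neg:
  "solves_on {-b..0} q u v \<Longrightarrow> solves_on {0..b} (\<lambda>x. q (- x)) (\<lambda>x. u (- x)) (\<lambda>x. - v (- x))"
  using solves_on_affine[of "{-b..0}" q u v "-1" "{0..b}" 0] by simp

text \<open>The canonical solutions at energy \<open>E\<close>: for \<open>V = 0\<close> and \<open>E =
  1\<close> they are cosine and sine.\<close>

definition cs :: "(real \<Rightarrow> real) \<Rightarrow> real \<Rightarrow> real \<Rightarrow> real" where "cs V E = fst (ivp_solution (\<lambda>x. V x - E) 1 0)"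
definition cs' :: "(real \<Rightarrow> real) \<Rightarrow> real \<Rightarrow> real \<Rightarrow> real" where "cs' V E = snd (ivp_solution (\<lambda>x. V x - E) 1 0)"
definition sn :: "(real \<Rightarrow> real) \<Rightarrow> real \<Rightarrow> real \<Rightarrow> real" where "sn V E = fst (ivp_solution (\<lambda>x. V x - E) 0 1)"
definition sn' :: "(real \<Rightarrow> real) \<Rightarrow> real \<Rightarrow> real \<Rightarrow> real" where "sn' V E = snd (ivp_solution (\<lambda>x. V x - E) 0 1)"

locale continuous_potential =
  fixes V :: "real \<Rightarrow> real"
  assumes V_cont: "continuous_on {0..} V"
begin

lemma q_cont: "continuous_on {0..} (\<lambda>x. V x - E)"
  by (intro continuous_intros V_cont)

lemma cs_solves: "solves_on {0..} (\<lambda>x. V x - E) (cs V E) (cs' V E)"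
  unfolding cs_def cs'_def by (rule ivp_solution[OF q_cont])

lemma sn_solves: "solves_on {0..} (\<lambda>x. V x - E) (sn V E) (sn' V E)"
  unfolding sn_def sn'_def by (rule ivp_solution[OF q_cont])

lemma cs_sn_0 [simp]: "cs V E 0 = 1" "cs' V E 0 = 0" "sn V E 0 = 0" "sn' V E 0 = 1"
  unfolding cs_def cs'_def sn_def sn'_def by (rule ivp_solution[OF q_cont])+

lemma cs_solves_Icc: "solves_on {0..b} (\<lambda>x. V x - E) (cs V E) (cs' V E)"
  by (rule solves_on_subset[OF cs_solves]) auto

lemma sn_solves_Icc: "solves_on {0..b} (\<lambda>x. V x - E) (sn V E) (sn' V E)"
  by (rule solves_on_subset[OF sn_solves]) auto

lemma cs_sn_wronskian: "x \<ge> 0 \<Longrightarrow> cs V E x * sn' V E x - cs' V E x * sn V E x = 1"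
  using wronskian_constant[OF cs_solves sn_solves, of x 0 E] by simp

lemma continuous_cs_sn:
  "continuous_on {0..b} (cs V E)" "continuous_on {0..b} (cs' V E)"
  "continuous_on {0..b} (sn V E)" "continuous_on {0..b} (sn' V E)"
  using solves_on_continuous[OF cs_solves_Icc] solves_on_continuous[OF sn_solves_Icc] by auto

lemma solution_representation:
  assumes "solves_on {0..b} (\<lambda>x. V x - E) u v" "x \<in> {0..b}"
  shows "u x = u 0 * cs V E x + v 0 * sn V E x" "v x = u 0 * cs' V E x + v 0 * sn' V E x"
proof -
  have q: "continuous_on {0..b} (\<lambda>x. V x - E)" by (rule continuous_on_subset[OF q_cont]) auto
  note * = ivp_unique[OF assms(1) solves_on_lincomb[OF cs_solves_Icc[of b E] sn_solves_Icc, of "u 0" "v 0"] q _ _ assms(2)]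
  show "u x = u 0 * cs V E x + v 0 * sn V E x" by (rule *(1)) auto
  show "v x = u 0 * cs' V E x + v 0 * sn' V E x" by (rule *(2)) auto
qed

text \<open>The difference of the solutions at two energies solves the equation with an inhomogeneity of the
  size of the energy difference and has zero initial values, so the energy estimate applies.\<close>

lemma lipschitz_in_energy:
  assumes u: "\<And>E. solves_on {0..} (\<lambda>x. V x - E) (u E) (v E)"
    and init: "\<And>E. u E 0 = a" "\<And>E. v E 0 = a'" and b: "b \<ge> 0"
  obtains \<Lambda> where "\<Lambda> \<ge> 0" "\<And>E x. \<bar>E - E0\<bar> \<le> 1 \<Longrightarrow> x \<in> {0..b} \<Longrightarrow>
      \<bar>u E x - u E0 x\<bar> \<le> \<Lambda> * \<bar>E - E0\<bar> \<and> \<bar>v E x - v E0 x\<bar> \<le> \<Lambda> * \<bar>E - E0\<bar>"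
proof -
  have sub: "{0..b} \<subseteq> {0..}" by auto
  have uI: "solves_on {0..b} (\<lambda>x. V x - E) (u E) (v E)" for E
    by (rule solves_on_subset[OF u sub])
  obtain K where K: "\<forall>x\<in>{0..b}. \<bar>V x\<bar> \<le> K"
    using continuous_on_Icc_bounded[OF continuous_on_subset[OF V_cont sub]] by blast
  obtain M where M: "\<forall>x\<in>{0..b}. \<bar>u E0 x\<bar> \<le> M"
    using continuous_on_Icc_bounded[OF solves_on_continuous(1)[OF uI]] by blast
  have M0: "M \<ge> 0" using bspec[OF M, of 0] b by auto
  define Q where "Q = K + \<bar>E0\<bar> + 1"
  define \<Lambda> where "\<Lambda> = sqrt (M\<^sup>2 * b * exp ((Q + 2) * b))"
  have Q0: "Q \<ge> 0" using bspec[OF K, of 0] b unfolding Q_def by auto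
  show thesis
  proof (rule that[of \<Lambda>])
    show "\<Lambda> \<ge> 0" unfolding \<Lambda>_def using b by simp
    fix E x assume E: "\<bar>E - E0\<bar> \<le> 1" and x: "x \<in> {0..b}"
    have "(u E x - u E0 x)\<^sup>2 + (v E x - v E0 x)\<^sup>2 \<le> (\<bar>E - E0\<bar> * M)\<^sup>2 * x * exp ((Q + 2) * x)"
    proof (rule energy_estimate[where q = "\<lambda>x. V x - E" and r = "\<lambda>x. (E0 - E) * u E0 x"])
      fix y assume y: "y \<in> {0..b}"
      note D = solves_onD[OF uI y]
      show "((\<lambda>x. u E x - u E0 x) has_real_derivative v E y - v E0 y) (at y within {0..b})"
        by (intro DERIV_diff D)
      have "((\<lambda>x. v E x - v E0 x) has_real_derivative (V y - E) * u E y - (V y - E0) * u E0 y) (at y within {0..b})"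
        by (intro DERIV_diff D)
      then show "((\<lambda>x. v E x - v E0 x) has_real_derivative (V y - E) * (u E y - u E0 y) + (E0 - E) * u E0 y) (at y within {0..b})"
        by (simp add: algebra_simps)
      have "\<bar>V y\<bar> \<le> K" using K y by blast
      then show "\<bar>V y - E\<bar> \<le> Q" using E unfolding Q_def by linarith
      show "\<bar>(E0 - E) * u E0 y\<bar> \<le> \<bar>E - E0\<bar> * M"
        unfolding abs_mult abs_minus_commute[of E0] using M y by (intro mult_left_mono) auto
    qed (use x b init in auto)
    also have "\<dots> \<le> (\<bar>E - E0\<bar> * M)\<^sup>2 * b * exp ((Q + 2) * b)"
      using x Q0 b by (intro mult_mono) auto
    also have "\<dots> = (\<Lambda> * \<bar>E - E0\<bar>)\<^sup>2"
      unfolding \<Lambda>_def using b by (simp add: power_mult_distrib)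
    finally have *: "(u E x - u E0 x)\<^sup>2 + (v E x - v E0 x)\<^sup>2 \<le> (\<Lambda> * \<bar>E - E0\<bar>)\<^sup>2" .
    have L: "\<Lambda> * \<bar>E - E0\<bar> \<ge> 0" using \<open>\<Lambda> \<ge> 0\<close> by simp
    have "(u E x - u E0 x)\<^sup>2 \<le> (\<Lambda> * \<bar>E - E0\<bar>)\<^sup>2" "(v E x - v E0 x)\<^sup>2 \<le> (\<Lambda> * \<bar>E - E0\<bar>)\<^sup>2"
      using * zero_le_power2[of "u E x - u E0 x"] zero_le_power2[of "v E x - v E0 x"] by linarith+
    then show "\<bar>u E x - u E0 x\<bar> \<le> \<Lambda> * \<bar>E - E0\<bar> \<and> \<bar>v E x - v E0 x\<bar> \<le> \<Lambda> * \<bar>E - E0\<bar>"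
      using L abs_le_square_iff[of _ "\<Lambda> * \<bar>E - E0\<bar>"] by (metis abs_of_nonneg)
  qed
qed

text \<open>The Lipschitz constant in the energy is uniform in \<open>x\<close>, so continuity in each
  variable gives joint continuity.\<close>

lemma jointly_continuous:
  assumes u: "\<And>E. solves_on {0..} (\<lambda>x. V x - E) (u E) (v E)"
    and init: "\<And>E. u E 0 = a" "\<And>E. v E 0 = a'" and b: "b \<ge> 0"
  shows "continuous_on ({0..b} \<times> UNIV) (\<lambda>z. u (snd z) (fst z))"
    "continuous_on ({0..b} \<times> UNIV) (\<lambda>z. v (snd z) (fst z))"
proof -
  have uI: "solves_on {0..b} (\<lambda>x. V x - E) (u E) (v E)" for E
    by (rule solves_on_subset[OF u]) auto
  have *: "continuous_on ({0..b} \<times> UNIV) (\<lambda>z. w (snd z) (fst z))"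
    if c: "\<And>E. continuous_on {0..b} (w E)"
      and L: "\<And>E0. \<exists>\<Lambda>. \<forall>E x. \<bar>E - E0\<bar> \<le> 1 \<longrightarrow> x \<in> {0..b} \<longrightarrow> \<bar>w E x - w E0 x\<bar> \<le> \<Lambda> * \<bar>E - E0\<bar>" 
    for w :: "real \<Rightarrow> real \<Rightarrow> real"
    unfolding continuous_on_def
  proof
    fix z0 :: "real \<times> real" assume z0: "z0 \<in> {0..b} \<times> UNIV"
    obtain x0 E0 where z0_eq: "z0 = (x0, E0)" by (cases z0)
    obtain \<Lambda> where \<Lambda>: "\<And>E x. \<bar>E - E0\<bar> \<le> 1 \<Longrightarrow> x \<in> {0..b} \<Longrightarrow> \<bar>w E x - w E0 x\<bar> \<le> \<Lambda> * \<bar>E - E0\<bar>"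
      using L[of E0] by blast
    let ?F = "at z0 within {0..b} \<times> UNIV"
    have f: "(fst \<longlongrightarrow> x0) ?F" "(snd \<longlongrightarrow> E0) ?F" 
      using tendsto_fst[OF tendsto_ident_at, of z0 "{0..b} \<times> UNIV"] tendsto_snd[OF tendsto_ident_at, of z0 "{0..b} \<times> UNIV"]
      by (auto simp: z0_eq)
    have inS: "\<forall>\<^sub>F z in ?F. z \<in> {0..b} \<times> UNIV" by (auto simp: eventually_at_filter)
    have "continuous_on ({0..b} \<times> (UNIV :: real set)) (\<lambda>z. w E0 (fst z))"
      by (rule continuous_on_compose2[OF c]) (auto intro!: continuous_intros)
    then have 1: "((\<lambda>z. w E0 (fst z)) \<longlongrightarrow> w E0 x0) ?F"
      using z0 by (auto simp: continuous_on_def z0_eq)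
    have near: "\<forall>\<^sub>F z in ?F. \<bar>snd z - E0\<bar> < 1"
      using tendstoD[OF f(2), of 1] by (auto simp: dist_real_def)
    have "((\<lambda>z. \<Lambda> * \<bar>snd z - E0\<bar>) \<longlongrightarrow> \<Lambda> * \<bar>E0 - E0\<bar>) ?F"
      by (intro tendsto_intros f)
    then have 2: "((\<lambda>z. \<Lambda> * \<bar>snd z - E0\<bar>) \<longlongrightarrow> 0) ?F" by simp
    have "((\<lambda>z. w (snd z) (fst z) - w E0 (fst z)) \<longlongrightarrow> 0) ?F"
    proof (rule Lim_null_comparison[OF _ 2])
      show "\<forall>\<^sub>F z in ?F. norm (w (snd z) (fst z) - w E0 (fst z)) \<le> \<Lambda> * \<bar>snd z - E0\<bar>"
        using inS near by eventually_elim (auto intro!: \<Lambda>)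
    qed
    from tendsto_add[OF this 1] show "((\<lambda>z. w (snd z) (fst z)) \<longlongrightarrow> w (snd z0) (fst z0)) ?F"
      by (simp add: z0_eq)
  qed
  have "\<exists>\<Lambda>. \<forall>E x. \<bar>E - E0\<bar> \<le> 1 \<longrightarrow> x \<in> {0..b} \<longrightarrow> \<bar>u E x - u E0 x\<bar> \<le> \<Lambda> * \<bar>E - E0\<bar> 
     \<and> \<bar>v E x - v E0 x\<bar> \<le> \<Lambda> * \<bar>E - E0\<bar>" for E0
    using lipschitz_in_energy[of u v, OF u init b] by metis
  then show "continuous_on ({0..b} \<times> UNIV) (\<lambda>z. u (snd z) (fst z))"
    "continuous_on ({0..b} \<times> UNIV) (\<lambda>z. v (snd z) (fst z))"
    by (intro * solves_on_continuous[OF uI]; blast)+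
qed

lemma jointly_continuous_cs_sn:
  assumes "b \<ge> 0"
  shows "continuous_on ({0..b} \<times> UNIV) (\<lambda>z. cs V (snd z) (fst z))"
    "continuous_on ({0..b} \<times> UNIV) (\<lambda>z. cs' V (snd z) (fst z))"
    "continuous_on ({0..b} \<times> UNIV) (\<lambda>z. sn V (snd z) (fst z))"
    "continuous_on ({0..b} \<times> UNIV) (\<lambda>z. sn' V (snd z) (fst z))"
  using jointly_continuous[of "cs V" "cs' V", OF cs_solves _ _ assms] 
    jointly_continuous[of "sn V" "sn' V", OF sn_solves _ _ assms] by auto

lemma continuous_in_energy:
  assumes "x \<ge> 0"
  shows "continuous_on A (\<lambda>E. cs V E x)" "continuous_on A (\<lambda>E. cs' V E x)"
    "continuous_on A (\<lambda>E. sn V E x)" "continuous_on A (\<lambda>E. sn' V E x)"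
proof -
  have *: "continuous_on A (\<lambda>E. f (x, E))" if "continuous_on ({0..x} \<times> UNIV) f" for f :: "real \<times> real \<Rightarrow> real"
    by (rule continuous_on_compose2[OF that]) (use assms in \<open>auto intro!: continuous_intros\<close>)
  show "continuous_on A (\<lambda>E. cs V E x)" "continuous_on A (\<lambda>E. cs' V E x)"
    "continuous_on A (\<lambda>E. sn V E x)" "continuous_on A (\<lambda>E. sn' V E x)"
    using jointly_continuous_cs_sn[OF assms, THEN *] by auto
qed

end

section \<open>Sturm comparison and the lowest mixed eigenvalue\<close>

text \<open>The zero is the infimum of the closed set where \<open>f\<close> is not positive.\<close>

lemma first_nonpositive_point:
  fixes f :: "real \<Rightarrow> real"
  assumes f: "continuous_on {a..b} f" and fa: "f a > 0" and x: "x \<in> {a..b}" "f x \<le> 0"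
  obtains x0 where "a < x0" "x0 \<le> x" "f x0 = 0" "\<And>y. y \<in> {a..<x0} \<Longrightarrow> f y > 0"
proof -
  define Z where "Z = {y \<in> {a..x}. f y \<le> 0}"
  have fx: "continuous_on {a..x} f" by (rule continuous_on_subset[OF f]) (use x in auto)
  have "closed Z"
    unfolding Z_def by (rule continuous_on_closed_Collect_le[OF fx continuous_on_const]) simp
  moreover have "x \<in> Z" "bdd_below Z" using x by (auto simp: Z_def)
  ultimately have inf: "Inf Z \<in> Z" using closed_contains_Inf[of Z] by blast
  have below: "f y > 0" if "y \<in> {a..<Inf Z}" for y
  proof (rule ccontr)
    assume "\<not> f y > 0"
    then have "y \<in> Z" using that inf by (auto simp: Z_def)
    then have "Inf Z \<le> y" by (rule cInf_lower) (use \<open>bdd_below Z\<close> in auto)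
    then show False using that by simp
  qed
  have ge: "a \<le> Inf Z" "Inf Z \<le> x" "f (Inf Z) \<le> 0" using inf by (auto simp: Z_def)
  have ne: "a \<noteq> Inf Z" using fa ge by auto
  have "f (Inf Z) = 0"
  proof (rule ccontr)
    assume "f (Inf Z) \<noteq> 0"
    then have neg: "f (Inf Z) < 0" using ge by simp
    have "continuous_on {a..Inf Z} f" by (rule continuous_on_subset[OF fx]) (use ge in auto)
    from IVT2'[of f "Inf Z" 0 a, OF _ _ _ this] neg fa ge obtain c where "a \<le> c" "c \<le> Inf Z" "f c = 0" by auto
    moreover have "c \<noteq> Inf Z" using \<open>f c = 0\<close> neg by auto
    ultimately show False using below[of c] by auto
  qed
  then show thesis using that[of "Inf Z"] ge ne below by auto
qed

lemma deriv_nonpos_at_first_zero: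
  fixes f :: "real \<Rightarrow> real"
  assumes "(f has_real_derivative D) (at x within I)" "{a..x} \<subseteq> I" "a < x" "f x = 0"
    "\<And>y. y \<in> {a..<x} \<Longrightarrow> f y > 0"
  shows "D \<le> 0"
proof (rule ccontr)
  assume "\<not> D \<le> 0"
  then obtain e where e: "e > 0" "\<And>h. 0 < h \<Longrightarrow> x - h \<in> I \<Longrightarrow> h < e \<Longrightarrow> f (x - h) < f x"
    using has_real_derivative_pos_inc_left[OF assms(1)] by auto
  define h where "h = min (e/2) (x - a)"
  have h: "0 < h" "h < e" "h \<le> x - a" using e assms by (auto simp: h_def min_def)
  then have "x - h \<in> {a..<x}" by auto
  moreover from this have "x - h \<in> I" using assms(2) by auto
  ultimately show False using e(2)[of h] h assms(4) assms(5)[of "x - h"] by auto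
qed

context continuous_potential begin

text \<open>A zero with vanishing derivative would contradict the constant Wronskian.\<close>

lemma cs_first_zero:
  assumes "x0 > 0" "cs V E x0 = 0" "\<And>y. y \<in> {0..<x0} \<Longrightarrow> cs V E y > 0"
  shows "cs' V E x0 < 0"
proof -
  have "cs' V E x0 \<le> 0"
    by (rule deriv_nonpos_at_first_zero[OF solves_onD(1)[OF cs_solves], of x0 0 E]) (use assms in auto)
  moreover have "cs' V E x0 \<noteq> 0" using cs_sn_wronskian[of x0 E] assms by auto
  ultimately show ?thesis by simp
qed

text \<open>Sturm's comparison: at the lower energy a solution turns more slowly towards zero.\<close>

lemma sturm_wronskian_pos:
  assumes E: "E1 < E2" and x: "x > 0"
    and u: "solves_on {0..x} (\<lambda>x. V x - E1) u v" and f: "solves_on {0..x} (\<lambda>x. V x - E2) f g"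
    and pos: "\<And>y. y \<in> {0<..<x} \<Longrightarrow> u y * f y > 0"
  shows "v 0 * f 0 - u 0 * g 0 < v x * f x - u x * g x"
proof (rule strict_mono_from_deriv[where f = "\<lambda>x. v x * f x - u x * g x" and a = 0 and b = x])
  fix y assume "y \<in> {0<..<x}"
  then show "((V y - E1) - (V y - E2)) * (u y * f y) > 0" using pos[of y] E by (intro mult_pos_pos[of _ "u y * f y"]) auto
qed (use wronskian_derivative[OF u f] x in auto)

definition cs_positive :: "real \<Rightarrow> real \<Rightarrow> bool" where
  "cs_positive h E \<longleftrightarrow> (\<forall>x\<in>{0..h}. cs V E x > 0)"

lemma not_cs_positiveE:
  assumes "\<not> cs_positive h E"
  obtains x0 where "0 < x0" "x0 \<le> h" "cs V E x0 = 0" "\<And>y. y \<in> {0..<x0} \<Longrightarrow> cs V E y > 0" "cs' V E x0 < 0"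
proof -
  obtain x where x: "x \<in> {0..h}" "cs V E x \<le> 0" using assms by (force simp: cs_positive_def)
  obtain x0 where "0 < x0" "x0 \<le> x" "cs V E x0 = 0" "\<And>y. y \<in> {0..<x0} \<Longrightarrow> cs V E y > 0"
    using first_nonpositive_point[OF continuous_cs_sn(1) _ x] by auto
  then show thesis using that[of x0] x cs_first_zero[of x0 E] by auto
qed

text \<open>Below the potential the solution is convex as long as it is positive, so it cannot come
  down.\<close>

lemma cs_positive_low_energy:
  assumes h: "h > 0" and E: "\<And>x. x \<in> {0..h} \<Longrightarrow> E \<le> V x"
  shows "cs_positive h E" "cs' V E h \<ge> 0"
proof -
  have deriv: "cs' V E x \<ge> 0" if x: "x \<in> {0<..h}" and pos: "\<And>y. y \<in> {0..<x} \<Longrightarrow> cs V E y > 0" for x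
  proof -
    have "cs' V E 0 \<le> cs' V E x"
    proof (rule mono_from_deriv[where f = "cs' V E" and a = 0 and b = x])
      show "(cs' V E has_real_derivative (V y - E) * cs V E y) (at y within {0..x})" if "y \<in> {0..x}" for y
        by (rule solves_onD(2)[OF cs_solves_Icc that])
      show "(V y - E) * cs V E y \<ge> 0" if "y \<in> {0<..<x}" for y
        using E[of y] pos[of y] that x by (intro mult_nonneg_nonneg) (auto simp: less_imp_le)
    qed (use x in auto)
    then show ?thesis by simp
  qed
  show P: "cs_positive h E"
  proof (rule ccontr)
    assume "\<not> cs_positive h E"
    then obtain x0 where "0 < x0" "x0 \<le> h" "\<And>y. y \<in> {0..<x0} \<Longrightarrow> cs V E y > 0" "cs' V E x0 < 0"
      by (rule not_cs_positiveE) blast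
    then show False using deriv[of x0] by auto
  qed
  show "cs' V E h \<ge> 0" by (rule deriv) (use P h in \<open>auto simp: cs_positive_def\<close>)
qed

text \<open>At the first zero for the lower energy \<open>E1\<close> the Wronskian with the solution at
  \<open>E2\<close> would be positive by comparison, yet it is a negative slope times a positive
  value.\<close>

lemma cs_positive_antimono:
  assumes "cs_positive h E2" "E1 < E2" shows "cs_positive h E1"
proof (rule ccontr)
  assume "\<not> cs_positive h E1"
  then obtain x0 where x0: "0 < x0" "x0 \<le> h" "cs V E1 x0 = 0" "\<And>y. y \<in> {0..<x0} \<Longrightarrow> cs V E1 y > 0" "cs' V E1 x0 < 0"
    by (rule not_cs_positiveE) blast
  have p2: "cs V E2 y > 0" if "y \<in> {0..x0}" for y using assms(1) that x0 by (auto simp: cs_positive_def)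
  have "0 < cs' V E1 x0 * cs V E2 x0 - cs V E1 x0 * cs' V E2 x0"
    using sturm_wronskian_pos[OF assms(2) x0(1) cs_solves_Icc cs_solves_Icc] x0(4) p2 by force
  then have "0 < cs' V E1 x0 * cs V E2 x0" using x0 by simp
  moreover have "cs V E2 x0 > 0" using p2 x0 by auto
  ultimately show False using x0(5) by (simp add: zero_less_mult_iff)
qed

lemma V_bounded_on: "\<exists>K. \<forall>x\<in>{0..h}. \<bar>V x\<bar> \<le> K"
  by (rule continuous_on_Icc_bounded[OF continuous_on_subset[OF V_cont]]) auto

text \<open>Comparison with \<open>cos (k x)\<close>, \<open>k = pi / (2 h)\<close>, which satisfies the same
  boundary conditions as the mixed problem: above \<open>K + k\<^sup>2\<close> the solution oscillates
  faster.\<close>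

lemma cs_positive_energy_bound:
  assumes h: "h > 0" and K: "\<And>x. x \<in> {0..h} \<Longrightarrow> V x \<le> K" and P: "cs_positive h E"
  shows "E \<le> K + (pi / (2 * h))\<^sup>2"
proof (rule ccontr)
  assume E: "\<not> E \<le> K + (pi / (2 * h))\<^sup>2"
  define k where "k = pi / (2 * h)"
  have k: "k > 0" "k * h = pi / 2" using h by (auto simp: k_def)
  have cosS: "solves_on {0..h} (\<lambda>x. - k\<^sup>2) (\<lambda>x. cos (k * x)) (\<lambda>x. - k * sin (k * x))"
    unfolding solves_on_def by (auto intro!: derivative_eq_intros simp: power2_eq_square)
  have "- (cs' V E 0 * cos (k * 0) - cs V E 0 * (- k * sin (k * 0)))
      < - (cs' V E h * cos (k * h) - cs V E h * (- k * sin (k * h)))"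
  proof (rule strict_mono_from_deriv[where f = "\<lambda>x. - (cs' V E x * cos (k * x) - cs V E x * (- k * sin (k * x)))" and a = 0 and b = h])
    show "((\<lambda>x. - (cs' V E x * cos (k * x) - cs V E x * (- k * sin (k * x)))) has_real_derivative
        - (((V y - E) - (- k\<^sup>2)) * (cs V E y * cos (k * y)))) (at y within {0..h})" if "y \<in> {0..h}" for y
      by (rule DERIV_minus[OF wronskian_derivative[OF cs_solves_Icc cosS that]])
    fix y assume y: "y \<in> {0<..<h}"
    have "k * y < k * h" using y k by auto
    then have "cos (k * y) > 0" using y k by (intro cos_gt_zero) auto
    moreover have "cs V E y > 0" using P y by (auto simp: cs_positive_def)
    moreover have "(V y - E) - (- k\<^sup>2) < 0" using E K[of y] y by (auto simp: k_def)
    ultimately show "- (((V y - E) - (- k\<^sup>2)) * (cs V E y * cos (k * y))) > 0"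
      by (simp add: mult_neg_pos)
  qed (use h in auto)
  then have "cs V E h * k < 0" using k(2) by simp
  moreover have "cs V E h > 0" using P h by (auto simp: cs_positive_def)
  ultimately show False using k by (simp add: mult_less_0_iff)
qed

text \<open>The ground state energy of the mixed problem \<open>u'(0) = u(h) = 0\<close>, encoded by the Sturm
  property that the solution started with \<open>u'(0) = 0\<close> stays positive exactly for smaller
  energies.\<close>

definition nd_ground :: "real \<Rightarrow> real" where "nd_ground h = Sup {E. cs_positive h E}"

lemma nd_ground:
  assumes h: "h > 0"
  shows "\<And>E. E < nd_ground h \<Longrightarrow> cs_positive h E"
    "\<And>E. nd_ground h \<le> E \<Longrightarrow> \<not> cs_positive h E"
    "cs V (nd_ground h) h = 0"
    "\<And>x. x \<in> {0..<h} \<Longrightarrow> cs V (nd_ground h) x > 0"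
    "cs' V (nd_ground h) h < 0"
proof -
  define \<nu> where "\<nu> = nd_ground h"
  obtain K where K: "\<And>x. x \<in> {0..h} \<Longrightarrow> \<bar>V x\<bar> \<le> K" using V_bounded_on[of h] by blast
  have ne: "- K \<in> {E. cs_positive h E}" 
  proof -
    have "- K \<le> V x" if "x \<in> {0..h}" for x using K[OF that] by linarith
    then show ?thesis using cs_positive_low_energy(1)[OF h, of "-K"] by blast
  qed
  have bdd: "bdd_above {E. cs_positive h E}"
  proof (rule bdd_aboveI)
    fix E assume "E \<in> {E. cs_positive h E}"
    moreover have "V x \<le> K" if "x \<in> {0..h}" for x using K[OF that] by linarith
    ultimately show "E \<le> K + (pi / (2 * h))\<^sup>2"
      using cs_positive_energy_bound[OF h, of K E] by blast
  qed
  show below: "cs_positive h E" if "E < nd_ground h" for E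
  proof -
    have "{E. cs_positive h E} \<noteq> {}" using ne by blast
    from less_cSup_iff[OF this bdd, of E] that obtain E2 where "cs_positive h E2" "E < E2"
      unfolding nd_ground_def by auto
    then show ?thesis by (rule cs_positive_antimono)
  qed
  have notin: "\<not> cs_positive h \<nu>"
  proof
    assume P: "cs_positive h \<nu>"
    have "\<exists>x\<in>{0..h}. \<forall>y\<in>{0..h}. cs V \<nu> x \<le> cs V \<nu> y"
      by (rule continuous_attains_inf) (use h continuous_cs_sn in auto)
    then obtain x where x: "x \<in> {0..h}" "\<And>y. y \<in> {0..h} \<Longrightarrow> cs V \<nu> x \<le> cs V \<nu> y" by blast
    define m where "m = cs V \<nu> x"
    have m: "m > 0" using P x by (auto simp: m_def cs_positive_def)
    obtain \<Lambda> where L: "\<Lambda> \<ge> 0" "\<And>E x. \<bar>E - \<nu>\<bar> \<le> 1 \<Longrightarrow> x \<in> {0..h} \<Longrightarrow>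
      \<bar>cs V E x - cs V \<nu> x\<bar> \<le> \<Lambda> * \<bar>E - \<nu>\<bar> \<and> \<bar>cs' V E x - cs' V \<nu> x\<bar> \<le> \<Lambda> * \<bar>E - \<nu>\<bar>"
      using lipschitz_in_energy[of "cs V" "cs' V" 1 0 h \<nu>] cs_solves h by (metis cs_sn_0(1,2) less_imp_le)
    \<comment> \<open>A step in the energy so small that the solution changes by less than its minimum
      \<open>m\<close>.\<close>
    define e where "e = min 1 (m / (2 * (\<Lambda> + 1)))"
    have e: "e > 0" "e \<le> 1" using m L by (auto simp: e_def)
    have "\<Lambda> * e \<le> \<Lambda> * (m / (2 * (\<Lambda> + 1)))" by (rule mult_left_mono) (use L in \<open>auto simp: e_def\<close>)
    also have "\<dots> < m" using m L by (simp add: field_simps) (smt (verit) mult_nonneg_nonneg)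
    finally have Le: "\<Lambda> * e < m" .
    have "cs_positive h (\<nu> + e)"
      unfolding cs_positive_def
    proof
      fix y assume y: "y \<in> {0..h}"
      have "\<bar>cs V (\<nu> + e) y - cs V \<nu> y\<bar> \<le> \<Lambda> * e" using L(2)[of "\<nu> + e" y] e y by auto
      moreover have "m \<le> cs V \<nu> y" using x(2)[OF y] by (simp add: m_def)
      ultimately show "cs V (\<nu> + e) y > 0" using Le by linarith
    qed
    then have "\<nu> + e \<le> \<nu>" unfolding \<nu>_def nd_ground_def by (intro cSup_upper) (use bdd in auto)
    then show False using e by simp
  qed
  then show above: "\<not> cs_positive h E" if "nd_ground h \<le> E" for E
    using that cs_positive_antimono[of h E \<nu>] by (auto simp: \<nu>_def le_less)
  obtain x0 where x0: "0 < x0" "x0 \<le> h" "cs V \<nu> x0 = 0" "\<And>y. y \<in> {0..<x0} \<Longrightarrow> cs V \<nu> y > 0" "cs' V \<nu> x0 < 0"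
    using not_cs_positiveE[OF notin] by metis
  have nonneg: "cs V \<nu> x \<ge> 0" if x: "x \<in> {0..h}" for x
  proof (rule ccontr)
    assume neg: "\<not> cs V \<nu> x \<ge> 0"
    have "continuous_on UNIV (\<lambda>E. cs V E x)" using continuous_in_energy x by auto
    then have "((\<lambda>E. cs V E x) \<longlongrightarrow> cs V \<nu> x) (at_left \<nu>)"
      by (meson UNIV_I at_within_open continuous_on_def filterlim_at_split open_UNIV)
    moreover have "\<forall>\<^sub>F E in at_left \<nu>. cs V E x \<ge> 0"
      using below x unfolding eventually_at_left_field \<nu>_def cs_positive_def
      by (intro exI[of _ "nd_ground h - 1"]) (auto intro: less_imp_le)
    ultimately have "cs V \<nu> x \<ge> 0" by (rule tendsto_lowerbound) simp
    then show False using neg by simp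
  qed
  \<comment> \<open>A zero before \<open>h\<close> is crossed with negative slope, but the limit of positive
    functions is nonnegative.\<close>
  have "x0 = h"
  proof (rule ccontr)
    assume "x0 \<noteq> h"
    then have "x0 < h" using x0 by simp
    obtain e where e: "e > 0" "\<And>k. 0 < k \<Longrightarrow> x0 + k \<in> {0..} \<Longrightarrow> k < e \<Longrightarrow> cs V \<nu> (x0 + k) < cs V \<nu> x0"
      using has_real_derivative_neg_dec_right[OF solves_onD(1)[OF cs_solves], of x0 \<nu>] x0 by auto
    define k where "k = min (e/2) (h - x0)"
    have k: "0 < k" "k < e" "k \<le> h - x0" using e \<open>x0 < h\<close> by (auto simp: k_def min_def)
    show False using e(2)[of k] k x0 nonneg[of "x0 + k"] by auto
  qed
  then show "cs V (nd_ground h) h = 0" "\<And>x. x \<in> {0..<h} \<Longrightarrow> cs V (nd_ground h) x > 0" "cs' V (nd_ground h) h < 0"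
    using x0 by (auto simp: \<nu>_def)
qed

text \<open>The first zero of \<open>sn\<close> after the one at \<open>0\<close>; the slope \<open>1\<close>
  at \<open>0\<close> keeps it away from \<open>0\<close>.\<close>

lemma not_sn_positiveE:
  assumes "x > 0" "\<not> sn V E x > 0"
  obtains x0 where "0 < x0" "x0 \<le> x" "sn V E x0 = 0" "\<And>y. y \<in> {0<..<x0} \<Longrightarrow> sn V E y > 0" "sn' V E x0 \<le> 0"
proof -
  obtain e where e: "e > 0" "\<And>k. 0 < k \<Longrightarrow> 0 + k \<in> {0..} \<Longrightarrow> k < e \<Longrightarrow> sn V E 0 < sn V E (0 + k)"
    using has_real_derivative_pos_inc_right[OF solves_onD(1)[OF sn_solves], of 0 E] by auto
  define a where "a = min (e/2) (x/2)"
  have a: "0 < a" "a < e" "a < x" using e assms by (auto simp: a_def min_def)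
  have pos: "sn V E y > 0" if "y \<in> {0<..a}" for y using e(2)[of y] that a by auto
  have "continuous_on {a..x} (sn V E)" by (rule continuous_on_subset[OF continuous_cs_sn(3)[of x]]) (use a in auto)
  from first_nonpositive_point[OF this pos, of x] assms(2) a
  obtain x0 where x0: "a < x0" "x0 \<le> x" "sn V E x0 = 0" "\<And>y. y \<in> {a..<x0} \<Longrightarrow> sn V E y > 0" by auto
  have "sn' V E x0 \<le> 0"
    by (rule deriv_nonpos_at_first_zero[OF solves_onD(1)[OF sn_solves], of x0 a E]) (use x0 a in auto)
  moreover have "sn V E y > 0" if "y \<in> {0<..<x0}" for y
    using pos[of y] x0(4)[of y] that by (cases "y \<le> a") auto
  ultimately show thesis using that[of x0] x0 a by auto
qed

text \<open>At a first zero of \<open>sn\<close> the constant Wronskian is \<open>cs * sn'\<close> with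
  \<open>sn' \<le> 0\<close>; it equals \<open>1\<close>, which forces \<open>cs < 0\<close>.\<close>

lemma sn_pos:
  assumes h: "h > 0" and E: "E \<le> nd_ground h" and x: "x \<in> {0<..h}" shows "sn V E x > 0"
proof (rule ccontr)
  assume "\<not> sn V E x > 0"
  then obtain x0 where x0: "0 < x0" "x0 \<le> x" "sn V E x0 = 0" "sn' V E x0 \<le> 0"
    using not_sn_positiveE[of x E] x by auto
  have "cs V E x0 \<ge> 0"
    using nd_ground(1)[OF h, of E] nd_ground(3,4)[OF h] x0 x E
    by (cases "E = nd_ground h"; cases "x0 = h") (auto simp: cs_positive_def less_imp_le)
  then have "cs V E x0 * sn' V E x0 \<le> 0" using x0 by (simp add: mult_nonneg_nonpos)
  then show False using cs_sn_wronskian[of x0 E] x0 by simp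
qed

text \<open>Where \<open>sn > 0\<close>, the quotient \<open>cs / sn\<close> has derivative \<open>- 1 /
  sn\<^sup>2\<close>. Hence \<open>cs\<close> changes sign only once, and above the ground state energy it has
  done so before \<open>h\<close>.\<close>

lemma cs_neg_above_ground:
  assumes h: "h > 0" and E: "nd_ground h < E" and sn: "\<And>x. x \<in> {0<..h} \<Longrightarrow> sn V E x > 0"
  shows "cs V E h < 0"
proof -
  obtain x0 where x0: "0 < x0" "x0 \<le> h" "cs V E x0 = 0" "\<And>y. y \<in> {0..<x0} \<Longrightarrow> cs V E y > 0" "cs' V E x0 < 0"
    using not_cs_positiveE[OF nd_ground(2)[OF h less_imp_le[OF E]]] by metis
  show ?thesis
  proof (cases "x0 = h")
    case True
    have "0 < cs' V (nd_ground h) h * cs V E h - cs V (nd_ground h) h * cs' V E h"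
      using sturm_wronskian_pos[OF E h cs_solves_Icc cs_solves_Icc] nd_ground(4)[OF h] x0(4) True by force
    then show ?thesis using x0 True nd_ground(3)[OF h] by simp
  next
    case False
    have "- (cs V E x0 / sn V E x0) < - (cs V E h / sn V E h)"
    proof (rule strict_mono_from_deriv[where f = "\<lambda>y. - (cs V E y / sn V E y)" and a = x0 and b = h])
      fix y assume y: "y \<in> {x0..h}"
      then have y': "y \<in> {0..h}" using x0 by auto
      have s: "sn V E y \<noteq> 0" using sn[of y] y x0 by auto
      have "((\<lambda>y. - (cs V E y / sn V E y)) has_real_derivative 
         - ((cs' V E y * sn V E y - cs V E y * sn' V E y) / (sn V E y * sn V E y))) (at y within {0..h})"
        by (intro DERIV_minus DERIV_divide solves_onD[OF cs_solves_Icc y'] solves_onD[OF sn_solves_Icc y'] s)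
      moreover have "- (cs' V E y * sn V E y - cs V E y * sn' V E y) = 1"
        using cs_sn_wronskian[of y E] y' by simp
      ultimately have "((\<lambda>y. - (cs V E y / sn V E y)) has_real_derivative 1 / (sn V E y * sn V E y)) (at y within {0..h})"
        by (metis minus_divide_left)
      then show "((\<lambda>y. - (cs V E y / sn V E y)) has_real_derivative 1 / (sn V E y * sn V E y)) (at y within {x0..h})"
        by (rule DERIV_subset) (use x0 in auto)
    next
      fix y assume "y \<in> {x0<..<h}"
      then have "sn V E y > 0" using sn x0 by auto
      then show "1 / (sn V E y * sn V E y) > 0" by simp
    qed (use False x0 in auto)
    then have "cs V E h / sn V E h < 0" using x0 by simp
    moreover have "sn V E h > 0" using sn h by auto
    ultimately show ?thesis by (simp add: divide_less_0_iff)
  qed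
qed

text \<open>Below the ground state energy of the mixed problem \<open>cs\<close> is positive up to
  \<open>h\<close>, and two positive solutions of the Neumann problem at different energies contradict Sturm
  comparison. Existence is the intermediate value theorem, between low energies, where the solution is convex,
  and the mixed ground state, which arrives at \<open>h\<close> with negative slope.\<close>

lemma neumann_first:
  assumes h: "h > 0"
  obtains \<nu>1 where "\<nu>1 < nd_ground h" "cs' V \<nu>1 h = 0" 
    "\<And>E. E < nd_ground h \<Longrightarrow> cs' V E h = 0 \<Longrightarrow> E = \<nu>1"
proof -
  obtain K where K: "\<And>x. x \<in> {0..h} \<Longrightarrow> \<bar>V x\<bar> \<le> K" using V_bounded_on[of h] by blast
  have low: "E \<le> V x" if "E \<le> - K" "x \<in> {0..h}" for E x using K[OF that(2)] that(1) by linarith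
  define m where "m = min (- K) (nd_ground h)"
  have m: "cs' V m h \<ge> 0" by (rule cs_positive_low_energy(2)[OF h low]) (auto simp: m_def)
  have "m \<le> nd_ground h" by (simp add: m_def)
  then obtain \<nu>1 where n: "m \<le> \<nu>1" "\<nu>1 \<le> nd_ground h" "cs' V \<nu>1 h = 0"
    using IVT2'[of "\<lambda>E. cs' V E h" "nd_ground h" 0 m] m nd_ground(5)[OF h] continuous_in_energy(2)[of h] h
    by auto
  have n1: "\<nu>1 < nd_ground h" using n nd_ground(5)[OF h] by (cases "\<nu>1 = nd_ground h") auto
  have uniq: False if "E1 < E2" "E2 < nd_ground h" "cs' V E1 h = 0" "cs' V E2 h = 0" for E1 E2
  proof -
    have "cs_positive h E1" "cs_positive h E2" using nd_ground(1)[OF h] that by auto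
    then have "cs' V E1 0 * cs V E2 0 - cs V E1 0 * cs' V E2 0 < cs' V E1 h * cs V E2 h - cs V E1 h * cs' V E2 h"
      by (intro sturm_wronskian_pos[OF that(1) h cs_solves_Icc cs_solves_Icc]) (auto simp: cs_positive_def)
    then show False using that by simp
  qed
  show thesis
    by (rule that[OF n1 n(3)]) (metis uniq n n1 linorder_neqE_linordered_idom)
qed

end

section \<open>Even periodic potentials and the half period\<close>

locale even_periodic_potential =
  fixes V :: "real \<Rightarrow> real" and d :: real
  assumes d_pos: "d > 0" and V_even: "V (- x) = V x" and V_periodic: "V (x + d) = V x"
    and V_cont_UNIV: "continuous_on UNIV V"
begin

sublocale continuous_potential V
  by unfold_locales (rule continuous_on_subset[OF V_cont_UNIV], simp)

sublocale shifted: continuous_potential "\<lambda>x. V (x + d/2)"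
  by unfold_locales (intro continuous_on_compose2[OF V_cont_UNIV] continuous_intros, simp)

lemma shifted_even_periodic: "even_periodic_potential (\<lambda>x. V (x + d/2)) d"
proof
  show "0 < d" by (rule d_pos)
  show "V (- x + d/2) = V (x + d/2)" for x
    using V_even[of "x - d/2"] V_periodic[of "x - d/2"] by (simp add: add.commute)
  show "V (x + d + d/2) = V (x + d/2)" for x using V_periodic[of "x + d/2"] by (simp add: add_ac)
  show "continuous_on UNIV (\<lambda>x. V (x + d/2))"
    by (intro continuous_on_compose2[OF V_cont_UNIV] continuous_intros) simp
qed

lemma half_pos: "d/2 > 0" using d_pos by simp

lemma V_reflect: "V (d - x) = V x"
  using V_periodic[of "- x"] V_even[of x] by simp

text \<open>The reflected solution solves the same equation, so its values at \<open>0\<close> determine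
  it.\<close>

lemma cell_reflection:
  assumes "solves_on {0..d} (\<lambda>x. V x - E) u v" "x \<in> {0..d}"
  shows "u (d - x) = u d * cs V E x - v d * sn V E x" "v (d - x) = - u d * cs' V E x + v d * sn' V E x"
proof -
  have "solves_on {0..d} (\<lambda>x. V x - E) (\<lambda>x. u (d - x)) (\<lambda>x. - v (d - x))"
    using solves_on_reflect[OF assms(1)] by (simp add: V_reflect)
  from solution_representation[OF this assms(2)]
  show "u (d - x) = u d * cs V E x - v d * sn V E x" "v (d - x) = - u d * cs' V E x + v d * sn' V E x"
    by simp_all
qed

lemmas cs_reflect = cell_reflection[OF cs_solves_Icc]
lemmas sn_reflect = cell_reflection[OF sn_solves_Icc]

lemma half_wronskian:
  "cs V E (d/2) * sn' V E (d/2) - cs' V E (d/2) * sn V E (d/2) = 1"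
  by (rule cs_sn_wronskian) (use d_pos in simp)

text \<open>The reflection formulas evaluated at \<open>x = d/2\<close> are linear equations for the values at
  \<open>d\<close>, with the Wronskian \<open>1\<close> as determinant.\<close>

lemma period_from_half_period:
  "cs V E d = 2 * cs V E (d/2) * sn' V E (d/2) - 1"
  "cs' V E d = 2 * cs V E (d/2) * cs' V E (d/2)"
  "sn V E d = 2 * sn V E (d/2) * sn' V E (d/2)"
  "sn' V E d = 2 * cs V E (d/2) * sn' V E (d/2) - 1"
proof -
  define C C' S S' where "C = cs V E (d/2)" and "C' = cs' V E (d/2)" and "S = sn V E (d/2)" and "S' = sn' V E (d/2)"
  have W: "C * S' - C' * S = 1" using half_wronskian by (simp add: C_def C'_def S_def S'_def)
  have h: "d/2 \<in> {0..d}" "d - d/2 = d/2" using d_pos by auto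
  have c: "C = cs V E d * C - cs' V E d * S" "C' = - cs V E d * C' + cs' V E d * S'"
    using cs_reflect[OF h(1), of E] unfolding h(2) by (simp_all add: C_def C'_def S_def S'_def)
  have s: "S = sn V E d * C - sn' V E d * S" "S' = - sn V E d * C' + sn' V E d * S'"
    using sn_reflect[OF h(1), of E] unfolding h(2) by (simp_all add: C_def C'_def S_def S'_def)
  have "cs V E d = 2 * C * S' - 1" using W c by algebra
  moreover have "cs' V E d = 2 * C * C'" using W c by algebra
  moreover have "sn V E d = 2 * S * S'" using W s by algebra
  moreover have "sn' V E d = 2 * C * S' - 1" using W s by algebra
  ultimately show "cs V E d = 2 * cs V E (d/2) * sn' V E (d/2) - 1"
    "cs' V E d = 2 * cs V E (d/2) * cs' V E (d/2)"
    "sn V E d = 2 * sn V E (d/2) * sn' V E (d/2)"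
    "sn' V E d = 2 * cs V E (d/2) * sn' V E (d/2) - 1"
    by (simp_all add: C_def C'_def S_def S'_def)
qed

text \<open>Reflecting the half cell maps the equation to the one with potential \<open>V (x + d/2)\<close>.
  This duality exchanges \<open>cs\<close> and \<open>sn'\<close> at \<open>d/2\<close> and carries every
  statement about \<open>nu\<close> to one about \<open>mu\<close>.\<close>

lemma shifted_reflect:
  assumes "x \<in> {0..d/2}"
  shows "cs (\<lambda>x. V (x + d/2)) E (d/2 - x) = sn' V E (d/2) * cs V E x - cs' V E (d/2) * sn V E x"
    "cs' (\<lambda>x. V (x + d/2)) E (d/2 - x) = - sn' V E (d/2) * cs' V E x + cs' V E (d/2) * sn' V E x"
    "sn (\<lambda>x. V (x + d/2)) E (d/2 - x) = sn V E (d/2) * cs V E x - cs V E (d/2) * sn V E x"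
    "sn' (\<lambda>x. V (x + d/2)) E (d/2 - x) = - sn V E (d/2) * cs' V E x + cs V E (d/2) * sn' V E x"
proof -
  let ?W = "\<lambda>x. V (x + d/2)"
  have W: "?W (d/2 - x) = V x" for x using V_reflect[of x] by simp
  have c: "solves_on {0..d/2} (\<lambda>x. V x - E) (\<lambda>x. cs ?W E (d/2 - x)) (\<lambda>x. - cs' ?W E (d/2 - x))"
    using solves_on_reflect[OF shifted.cs_solves_Icc[of "d/2" E]] by (simp add: W V_reflect)
  have s: "solves_on {0..d/2} (\<lambda>x. V x - E) (\<lambda>x. sn ?W E (d/2 - x)) (\<lambda>x. - sn' ?W E (d/2 - x))"
    using solves_on_reflect[OF shifted.sn_solves_Icc[of "d/2" E]] by (simp add: W V_reflect)
  note rc = solution_representation[OF c] and rs = solution_representation[OF s]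
  have h: "d/2 \<in> {0..d/2}" using d_pos by auto
  define C C' S S' where "C = cs V E (d/2)" and "C' = cs' V E (d/2)" and "S = sn V E (d/2)" and "S' = sn' V E (d/2)"
  define C1 C1' S1 S1' where "C1 = cs ?W E (d/2)" and "C1' = cs' ?W E (d/2)" and "S1 = sn ?W E (d/2)" and "S1' = sn' ?W E (d/2)"
  have W1: "C * S' - C' * S = 1" using half_wronskian by (simp add: C_def C'_def S_def S'_def)
  have "1 = C1 * C - C1' * S" "0 = C1 * C' - C1' * S'" "0 = S1 * C - S1' * S" "-1 = S1 * C' - S1' * S'"
    using rc[OF h] rs[OF h] by (simp_all add: C_def C'_def S_def S'_def C1_def C1'_def S1_def S1'_def)
  then have "C1 = S' \<and> C1' = C' \<and> S1 = S \<and> S1' = C" using W1 by algebra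
  then show "cs (\<lambda>x. V (x + d/2)) E (d/2 - x) = sn' V E (d/2) * cs V E x - cs' V E (d/2) * sn V E x"
    "cs' (\<lambda>x. V (x + d/2)) E (d/2 - x) = - sn' V E (d/2) * cs' V E x + cs' V E (d/2) * sn' V E x"
    "sn (\<lambda>x. V (x + d/2)) E (d/2 - x) = sn V E (d/2) * cs V E x - cs V E (d/2) * sn V E x"
    "sn' (\<lambda>x. V (x + d/2)) E (d/2 - x) = - sn V E (d/2) * cs' V E x + cs V E (d/2) * sn' V E x"
    using rc[OF assms] rs[OF assms]
    by (simp_all add: C_def C'_def S_def S'_def C1_def C1'_def S1_def S1'_def)
qed

lemma shifted_half_period:
  "cs (\<lambda>x. V (x + d/2)) E (d/2) = sn' V E (d/2)" "cs' (\<lambda>x. V (x + d/2)) E (d/2) = cs' V E (d/2)"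
  "sn (\<lambda>x. V (x + d/2)) E (d/2) = sn V E (d/2)" "sn' (\<lambda>x. V (x + d/2)) E (d/2) = cs V E (d/2)"
  using shifted_reflect[of 0 E] d_pos by simp_all

text \<open>The lowest zeros of \<open>cs V E (d/2)\<close> and of \<open>sn' V E (d/2)\<close> as functions
  of \<open>E\<close>. In the second case the mixed problem with \<open>u(0) = u'(d/2) = 0\<close> is viewed
  from \<open>d/2\<close>, where it is the one of \<open>nd_ground\<close> for the translated
  potential.\<close>

definition nu :: real where "nu = nd_ground (d/2)"
definition mu :: real where "mu = shifted.nd_ground (d/2)"

lemma shifted_nu: "even_periodic_potential.nu (\<lambda>x. V (x + d/2)) d = mu"
  using even_periodic_potential.nu_def[OF shifted_even_periodic] by (simp add: mu_def)

lemma shifted_mu: "even_periodic_potential.mu (\<lambda>x. V (x + d/2)) d = nu"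
proof -
  have "(\<lambda>x. V (x + d/2 + d/2)) = V" using V_periodic by (simp add: add.assoc)
  then show ?thesis using even_periodic_potential.mu_def[OF shifted_even_periodic] by (simp add: nu_def)
qed

lemma at_nu: "cs V nu (d/2) = 0" "\<And>x. x \<in> {0..<d/2} \<Longrightarrow> cs V nu x > 0" "cs' V nu (d/2) < 0"
  unfolding nu_def by (rule nd_ground[OF half_pos]; assumption)+

lemma below_nu: "E < nu \<Longrightarrow> cs V E (d/2) > 0"
  using nd_ground(1)[OF half_pos, of E] half_pos by (auto simp: nu_def cs_positive_def)

lemma sn_pos_le_nu: "E \<le> nu \<Longrightarrow> x \<in> {0<..d/2} \<Longrightarrow> sn V E x > 0"
  using sn_pos[OF half_pos] by (simp add: nu_def)

lemma at_mu: "sn' V mu (d/2) = 0" "cs' V mu (d/2) < 0"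
  using shifted.nd_ground(3,5)[OF half_pos] shifted_half_period[of mu] by (simp_all add: mu_def)

lemma below_mu: "E < mu \<Longrightarrow> sn' V E (d/2) > 0"
  using even_periodic_potential.below_nu[OF shifted_even_periodic, of E] shifted_nu shifted_half_period by simp

lemma sn_half_pos_le_mu: "E \<le> mu \<Longrightarrow> sn V E (d/2) > 0"
  using even_periodic_potential.sn_pos_le_nu[OF shifted_even_periodic, of E "d/2"] shifted_nu shifted_half_period(3) 
    half_pos by simp

lemma sn_mu_pos: assumes "x \<in> {0<..d/2}" shows "sn V mu x > 0"
proof -
  have "cs (\<lambda>x. V (x + d/2)) mu (d/2 - x) > 0"
    using even_periodic_potential.at_nu(2)[OF shifted_even_periodic, of "d/2 - x"] shifted_nu assms by simp
  then have "- cs' V mu (d/2) * sn V mu x > 0"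
    using shifted_reflect(1)[of x mu] assms at_mu by simp
  then show ?thesis using at_mu(2) by (simp add: mult_less_0_iff)
qed

lemma sn_pos_le_mu: assumes "E \<le> mu" "x \<in> {0<..d/2}" shows "sn V E x > 0"
proof (cases "E = mu")
  case False
  then have E: "E < mu" using assms by simp
  show ?thesis
  proof (rule ccontr)
    assume "\<not> sn V E x > 0"
    then obtain x0 where x0: "0 < x0" "x0 \<le> x" "sn V E x0 = 0" "sn' V E x0 \<le> 0"
      and pos: "\<And>y. y \<in> {0<..<x0} \<Longrightarrow> sn V E y > 0"
      using not_sn_positiveE[of x E] assms(2) by auto
    have "sn' V E 0 * sn V mu 0 - sn V E 0 * sn' V mu 0 < sn' V E x0 * sn V mu x0 - sn V E x0 * sn' V mu x0"
      by (rule sturm_wronskian_pos[OF E x0(1) sn_solves_Icc sn_solves_Icc]) (use pos sn_mu_pos x0 assms in auto)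
    then have "0 < sn' V E x0 * sn V mu x0" using x0 by simp
    moreover have "sn V mu x0 > 0" using sn_mu_pos x0 assms by auto
    ultimately show False using x0(4) by (simp add: zero_less_mult_iff)
  qed
qed (use sn_mu_pos assms in simp)

lemma between_nu_mu: assumes "nu < E" "E \<le> mu" shows "cs V E (d/2) < 0"
  by (rule cs_neg_above_ground[OF half_pos]) (use assms sn_pos_le_mu in \<open>auto simp: nu_def\<close>)

lemma between_mu_nu: assumes "mu < E" "E \<le> nu" shows "sn' V E (d/2) < 0"
  using even_periodic_potential.between_nu_mu[OF shifted_even_periodic, of E] assms
  by (simp add: shifted_nu shifted_mu shifted_half_period)

lemma cs_nu_antiperiodic: 
  assumes "x \<in> {0..d}" shows "cs V nu (d - x) = - cs V nu x" "cs' V nu (d - x) = cs' V nu x"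
  using cs_reflect[OF assms, of nu] period_from_half_period[of nu] at_nu(1) by simp_all

lemma sn_mu_antiperiodic: 
  assumes "x \<in> {0..d}" shows "sn V mu (d - x) = sn V mu x"
  using sn_reflect[OF assms, of mu] period_from_half_period[of mu] at_mu(1) by simp_all

lemma sn_mu_pos_cell: assumes "x \<in> {0<..<d}" shows "sn V mu x > 0"
  using sn_mu_pos[of x] sn_mu_pos[of "d - x"] sn_mu_antiperiodic[of x] assms by (cases "x \<le> d/2") auto

text \<open>The ratio \<open>u'' / u = V - nu\<close> changes sign at most once, from negative to positive. If
  \<open>u'\<close> were nonnegative somewhere, then \<open>V \<ge> nu\<close> would have occurred before, and
  \<open>u'\<close> would increase from there on and could not be negative at \<open>d/2\<close>.\<close>

lemma cs'_nu_neg_increasing: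
  assumes inc: "strict_mono_on {0..d/2} V" and x: "x \<in> {0<..d/2}"
  shows "cs' V nu x < 0"
proof (rule ccontr)
  assume neg: "\<not> cs' V nu x < 0"
  then have xh: "x < d/2" using at_nu(3) x by (cases "x = d/2") auto
  have "\<exists>z\<in>{0<..<x}. V z \<ge> nu"
  proof (rule ccontr)
    assume n: "\<not> (\<exists>z\<in>{0<..<x}. V z \<ge> nu)"
    have "- cs' V nu 0 < - cs' V nu x"
    proof (rule strict_mono_from_deriv[where f = "\<lambda>x. - cs' V nu x" and a = 0 and b = x])
      show "((\<lambda>x. - cs' V nu x) has_real_derivative - ((V y - nu) * cs V nu y)) (at y within {0..x})"
        if "y \<in> {0..x}" for y by (intro DERIV_minus solves_onD(2)[OF cs_solves_Icc that])
      show "- ((V y - nu) * cs V nu y) > 0" if "y \<in> {0<..<x}" for y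
        using n that at_nu(2)[of y] xh by (auto simp: not_le mult_less_0_iff)
    qed (use x in auto)
    then show False using neg by simp
  qed
  then obtain z where z: "0 < z" "z < x" "V z \<ge> nu" by auto
  have "cs' V nu x < cs' V nu (d/2)"
  proof (rule strict_mono_from_deriv[where f = "\<lambda>x. cs' V nu x" and a = x and b = "d/2"])
    show "(cs' V nu has_real_derivative (V y - nu) * cs V nu y) (at y within {x..d/2})"
      if "y \<in> {x..d/2}" for y
      by (rule DERIV_subset[OF solves_onD(2)[OF cs_solves_Icc[of "d/2"]]]) (use that x in auto)
    show "(V y - nu) * cs V nu y > 0" if "y \<in> {x<..<d/2}" for y
    proof -
      have "V z < V y" by (rule strict_mono_onD[OF inc]) (use that z x in auto)
      then show ?thesis using z at_nu(2)[of y] that x by simp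
    qed
  qed (use xh in auto)
  then show False using neg at_nu(3) by simp
qed

text \<open>The derivative of the Neumann solution \<open>u\<close> satisfies the boundary conditions of
  \<open>w\<close>, the ground state that belongs to \<open>mu\<close>. The function \<open>G\<close> is the
  Wronskian of \<open>w\<close> with \<open>u'\<close>; it vanishes at both ends, and if \<open>mu \<le>
  nu\<close>, its derivative \<open>V' u w + (mu - nu) u' w\<close> would be nonnegative and somewhere
  positive.\<close>

lemma nu_less_mu:
  assumes inc: "strict_mono_on {0..d/2} V" and V': "\<And>x. (V has_real_derivative V' x) (at x)"
  shows "nu < mu"
proof (rule ccontr)
  assume "\<not> nu < mu"
  then have le: "mu \<le> nu" by simp
  let ?I = "{0..d/2}"
  define w w' where "w x = cs (\<lambda>x. V (x + d/2)) mu (d/2 - x)" and "w' x = - cs' (\<lambda>x. V (x + d/2)) mu (d/2 - x)" for x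
  have wS: "solves_on ?I (\<lambda>x. V x - mu) w w'"
    using solves_on_reflect[OF shifted.cs_solves_Icc[of "d/2" mu]] unfolding w_def w'_def by (simp add: V_reflect)
  have w0: "w 0 = 0" "w' (d/2) = 0" 
    using at_mu(1) shifted_half_period(1)[of mu] by (simp_all add: w_def w'_def)
  have wpos: "w x > 0" if "x \<in> {0<..d/2}" for x
    using even_periodic_potential.at_nu(2)[OF shifted_even_periodic, of "d/2 - x"] shifted_nu that by (simp add: w_def)
  note uS = cs_solves_Icc[of "d/2" nu]
  define G where "G x = (V x - nu) * cs V nu x * w x - cs' V nu x * w' x" for x
  define G' where "G' x = V' x * cs V nu x * w x + (mu - nu) * cs' V nu x * w x" for x
  have DG: "(G has_real_derivative G' x) (at x within ?I)" if x: "x \<in> ?I" for x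
  proof -
    note D = solves_onD[OF uS x] solves_onD[OF wS x] has_field_derivative_at_within[OF V'[of x], of ?I]
    have "(G has_real_derivative ((V' x - 0) * cs V nu x + cs' V nu x * (V x - nu)) * w x + w' x * ((V x - nu) * cs V nu x)
       - (((V x - nu) * cs V nu x) * w' x + ((V x - mu) * w x) * cs' V nu x)) (at x within ?I)"
      unfolding G_def by (intro DERIV_diff DERIV_mult DERIV_const D)
    then show ?thesis unfolding G'_def by (simp add: algebra_simps)
  qed
  have V'nn: "V' x \<ge> 0" if "x \<in> {0<..<d/2}" for x
    by (rule mono_on_imp_deriv_nonneg[OF strict_mono_on_imp_mono_on[OF inc] V']) (use that in auto)
  \<comment> \<open>Under the assumption \<open>mu \<le> nu\<close> both terms of \<open>G'\<close> are
    nonnegative; hence \<open>G\<close>, vanishing at both ends, is identically zero.\<close>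
  have G'nn: "G' x \<ge> 0" if x: "x \<in> {0<..<d/2}" for x
  proof -
    have 1: "V' x * cs V nu x * w x \<ge> 0"
      using V'nn[OF x] at_nu(2)[of x] wpos[of x] x by (simp add: less_imp_le)
    have "(mu - nu) * cs' V nu x \<ge> 0"
      using cs'_nu_neg_increasing[OF inc, of x] le x by (intro mult_nonpos_nonpos) auto
    then have "(mu - nu) * cs' V nu x * w x \<ge> 0" using wpos[of x] x by simp
    then show ?thesis using 1 by (simp add: G'_def)
  qed
  have ends: "G 0 = 0" "G (d/2) = 0" using w0 at_nu by (simp_all add: G_def)
  have Gz: "G x = 0" if x: "x \<in> ?I" for x
  proof -
    have "G 0 \<le> G x"
      by (rule mono_from_deriv[where f = G and f' = G' and a = 0 and b = x])
         (use x G'nn in \<open>auto intro: DERIV_subset[OF DG]\<close>)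
    moreover have "G x \<le> G (d/2)"
      by (rule mono_from_deriv[where f = G and f' = G' and a = x and b = "d/2"])
         (use x G'nn in \<open>auto intro: DERIV_subset[OF DG]\<close>)
    ultimately show ?thesis using ends by simp
  qed
  \<comment> \<open>A point where \<open>V'\<close> is positive, and with it \<open>G'\<close>.\<close>
  obtain z where z: "0 < z" "z < d/2" "V (d/2) - V 0 = (d/2 - 0) * V' z"
    using MVT2[of 0 "d/2" V V'] V' half_pos by auto
  have "V 0 < V (d/2)" by (rule strict_mono_onD[OF inc]) (use half_pos in auto)
  then have "(d/2) * V' z > 0" using z by simp
  then have V'z: "V' z > 0" using half_pos by (rule zero_less_mult_pos)
  have "(G has_real_derivative G' z) (at z)" 
    using DG[of z] z at_within_Icc_at[of 0 z "d/2"] by auto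
  moreover have "(G has_real_derivative 0) (at z)"
    by (rule has_field_derivative_transform_within_open[where f = "\<lambda>_. 0" and S = "{0<..<d/2}"]) (use z Gz in auto)
  ultimately have "G' z = 0" by (rule DERIV_unique)
  moreover have "V' z * cs V nu z * w z > 0" using V'z at_nu(2)[of z] wpos[of z] z by simp
  moreover have "(mu - nu) * cs' V nu z * w z \<ge> 0"
    using cs'_nu_neg_increasing[OF inc, of z] le z wpos[of z] by (intro mult_nonneg_nonneg mult_nonpos_nonpos) auto
  ultimately show False by (simp add: G'_def)
qed

lemma strict_mono_shifted:
  assumes "strict_antimono_on {0..d/2} V"
  shows "strict_mono_on {0..d/2} (\<lambda>x. V (x + d/2))"
proof (rule strict_mono_onI)
  fix r s assume rs: "r \<in> {0..d/2}" "s \<in> {0..d/2}" "r < s"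
  have "V (d/2 - r) < V (d/2 - s)"
    using monotone_onD[OF assms, of "d/2 - s" "d/2 - r"] rs by auto
  then show "V (r + d/2) < V (s + d/2)" using V_reflect[of "r + d/2"] V_reflect[of "s + d/2"] by simp
qed

text \<open>The translated potential is increasing, and the translation exchanges \<open>nu\<close> and
  \<open>mu\<close>.\<close>

lemma mu_less_nu:
  assumes dec: "strict_antimono_on {0..d/2} V" and V': "\<And>x. (V has_real_derivative V' x) (at x)"
  shows "mu < nu"
proof -
  have "((\<lambda>x. V (x + d/2)) has_real_derivative V' (x + d/2)) (at x)" for x
    using DERIV_shift[of V "V' (x + d/2)" x "d/2"] V' by blast
  from even_periodic_potential.nu_less_mu[OF shifted_even_periodic strict_mono_shifted[OF dec] this]
  show ?thesis by (simp add: shifted_nu shifted_mu)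
qed

text \<open>Now \<open>u''\<close> changes sign at most once, from positive to negative. So \<open>u'\<close>
  starts at \<open>0\<close>, possibly rises first, and then decreases to its negative value at
  \<open>d/2\<close>.\<close>

lemma cs'_nu_decreasing:
  assumes dec: "strict_antimono_on {0..d/2} V"
  shows "(\<forall>x\<in>{0<..d/2}. cs' V nu x < 0) \<or>
    (\<exists>d0. 0 < d0 \<and> d0 < d/2 \<and> (\<forall>x\<in>{0<..<d0}. cs' V nu x > 0) \<and> cs' V nu d0 = 0 \<and> (\<forall>x\<in>{d0<..d/2}. cs' V nu x < 0))"
proof -
  have decr: "cs' V nu x < cs' V nu a" if a: "0 \<le> a" "a < x" "x \<le> d/2" and Va: "V a \<le> nu" for a x
  proof -
    have "- cs' V nu a < - cs' V nu x"
    proof (rule strict_mono_from_deriv[where f = "\<lambda>x. - cs' V nu x" and a = a and b = x])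
      show "((\<lambda>x. - cs' V nu x) has_real_derivative - ((V y - nu) * cs V nu y)) (at y within {a..x})"
        if "y \<in> {a..x}" for y
        by (intro DERIV_minus DERIV_subset[OF solves_onD(2)[OF cs_solves]]) (use that a in auto)
      show "- ((V y - nu) * cs V nu y) > 0" if y: "y \<in> {a<..<x}" for y
      proof -
        have "V y < V a" using monotone_onD[OF dec, of a y] a y by auto
        then show ?thesis using Va at_nu(2)[of y] a y by (simp add: mult_less_0_iff)
      qed
    qed (use a in auto)
    then show ?thesis by simp
  qed
  show ?thesis
  proof (cases "V 0 \<le> nu")
    case True
    then have "\<forall>x\<in>{0<..d/2}. cs' V nu x < 0" using decr[of 0] by auto
    then show ?thesis ..
  next
    case False
    have "((\<lambda>x. cs' V nu x) has_real_derivative (V 0 - nu) * cs V nu 0) (at 0 within {0..})"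
      by (rule solves_onD(2)[OF cs_solves]) simp
    then obtain e where e: "e > 0" "\<And>k. 0 < k \<Longrightarrow> 0 + k \<in> {0..} \<Longrightarrow> k < e \<Longrightarrow> cs' V nu 0 < cs' V nu (0 + k)"
      using has_real_derivative_pos_inc_right[of "cs' V nu" "(V 0 - nu) * cs V nu 0" 0 "{0..}"] False by auto
    define a where "a = min (e/2) (d/4)"
    have a: "0 < a" "a < e" "a < d/2" using e d_pos by (auto simp: a_def min_def)
    have pos: "cs' V nu y > 0" if "y \<in> {0<..a}" for y using e(2)[of y] that a by auto
    have "continuous_on {a..d/2} (cs' V nu)" by (rule continuous_on_subset[OF continuous_cs_sn(2)[of "d/2"]]) (use a in auto)
    from first_nonpositive_point[OF this pos, of "d/2"] at_nu(3) a
    obtain x0 where x0: "a < x0" "x0 \<le> d/2" "cs' V nu x0 = 0" "\<And>y. y \<in> {a..<x0} \<Longrightarrow> cs' V nu y > 0" by auto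
    have xh: "x0 < d/2" using x0 at_nu(3) by (cases "x0 = d/2") auto
    have "(V x0 - nu) * cs V nu x0 \<le> 0"
      by (rule deriv_nonpos_at_first_zero[OF solves_onD(2)[OF cs_solves], of x0 a]) (use x0 a in auto)
    then have "V x0 \<le> nu" using at_nu(2)[of x0] xh x0 a by (simp add: mult_le_0_iff)
    then have "\<forall>x\<in>{x0<..d/2}. cs' V nu x < 0" using decr[of x0] x0 a by auto
    moreover have "\<forall>x\<in>{0<..<x0}. cs' V nu x > 0" 
    proof
      fix x assume "x \<in> {0<..<x0}"
      then show "cs' V nu x > 0" using pos[of x] x0(4)[of x] by (cases "x \<le> a") auto
    qed
    ultimately show ?thesis using x0 xh a by (intro disjI2 exI[of _ x0]) auto
  qed
qed

end

section \<open>Eigenvalues on the period cell and the first gap\<close>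

text \<open>Both lemmas on \<open>kth_eigenvalue\<close> require knowledge of the spectrum only up to the
  eigenvalue in question: at lower energies the set of eigenvalues is finite, and the least energy with the
  required count is decided there.\<close>

lemma kth_eigenvalue_1:
  assumes "eigenvalue bc V d E0" "multiplicity_of bc V d E0 = 1" "\<And>E. E < E0 \<Longrightarrow> \<not> eigenvalue bc V d E"
  shows "kth_eigenvalue bc V d 1 = E0"
  unfolding kth_eigenvalue_def
proof (rule Least_equality)
  have "{E'. E' \<le> E0 \<and> eigenvalue bc V d E'} = {E0}" using assms(1,3) by force
  then show "1 \<le> (\<Sum>E' | E' \<le> E0 \<and> eigenvalue bc V d E'. multiplicity_of bc V d E')"
    using assms(2) by simp
next
  fix E assume E: "1 \<le> (\<Sum>E' | E' \<le> E \<and> eigenvalue bc V d E'. multiplicity_of bc V d E')"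
  show "E0 \<le> E"
  proof (rule ccontr)
    assume "\<not> E0 \<le> E"
    then have "{E'. E' \<le> E \<and> eigenvalue bc V d E'} = {}" using assms(3) by force
    from E[unfolded this] show False by simp
  qed
qed

lemma kth_eigenvalue_2:
  assumes ev: "\<And>E. E \<le> e2 \<Longrightarrow> eigenvalue bc V d E \<longleftrightarrow> E = e1 \<or> E = e2" and less: "e1 < e2"
    and m: "multiplicity_of bc V d e1 = 1" "multiplicity_of bc V d e2 = 1"
  shows "kth_eigenvalue bc V d 2 = e2"
  unfolding kth_eigenvalue_def
proof (rule Least_equality)
  have "{E'. E' \<le> e2 \<and> eigenvalue bc V d E'} = {e1, e2}" using ev less by force
  then show "2 \<le> (\<Sum>E' | E' \<le> e2 \<and> eigenvalue bc V d E'. multiplicity_of bc V d E')"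
    using m less by simp
next
  fix E assume E: "2 \<le> (\<Sum>E' | E' \<le> E \<and> eigenvalue bc V d E'. multiplicity_of bc V d E')"
  show "e2 \<le> E"
  proof (rule ccontr)
    assume "\<not> e2 \<le> E"
    then have "{E'. E' \<le> E \<and> eigenvalue bc V d E'} \<subseteq> {e1}" using ev by force
    then have "(\<Sum>E' | E' \<le> E \<and> eigenvalue bc V d E'. multiplicity_of bc V d E') \<le> (\<Sum>E'\<in>{e1}. multiplicity_of bc V d E')"
      by (intro sum_mono2) auto
    then show False using E m by simp
  qed
qed

lemma multiplicity_one:
  assumes "eigenspace bc V d E = range (\<lambda>k x. k * e x)" "e \<noteq> (\<lambda>x. 0)"
  shows "multiplicity_of bc V d E = 1"
proof -
  interpret vs: vector_space "\<lambda>(c::real) (f::real \<Rightarrow> real) x. c * f x"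
    by unfold_locales (auto simp: fun_eq_iff algebra_simps)
  have "vs.dim (eigenspace bc V d E) = card {e}"
  proof (rule vs.dim_eq_card)
    show "vs.independent {e}" using assms(2) vs.dependent_single[of e] by (simp add: zero_fun_def)
    show "vs.span {e} = vs.span (eigenspace bc V d E)"
      unfolding assms(1) vs.span_singleton[symmetric] by (simp add: vs.span_span)
  qed
  then show ?thesis by (simp add: multiplicity_of_def)
qed

context even_periodic_potential begin

text \<open>The general solution on the period cell, extended by zero as the definition of
  \<open>eigenspace\<close> prescribes.\<close>

definition cell_solution :: "real \<Rightarrow> real \<Rightarrow> real \<Rightarrow> real \<Rightarrow> real" where
  "cell_solution E a b x = (if x \<in> {0..d} then a * cs V E x + b * sn V E x else 0)"

lemma eigenspace_iff:
  "u \<in> eigenspace bc V d E \<longleftrightarrow> (\<exists>a b. u = cell_solution E a b \<and>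
     bc a b (a * cs V E d + b * sn V E d) (a * cs' V E d + b * sn' V E d))"
proof
  assume "u \<in> eigenspace bc V d E"
  note mem = CollectD[OF this[unfolded eigenspace_def]]
  note out = conjunct1[OF mem]
  from conjunct2[OF mem] obtain u1 where "\<exists>u2. (\<forall>x\<in>{0..d}. (u has_real_derivative u1 x) (at x within {0..d}) \<and>
       (u1 has_real_derivative u2 x) (at x within {0..d}) \<and> - u2 x + V x * u x = E * u x) \<and>
       bc (u 0) (u1 0) (u d) (u1 d)" by (rule exE)
  then obtain u2 where u12: "(\<forall>x\<in>{0..d}. (u has_real_derivative u1 x) (at x within {0..d}) \<and>
       (u1 has_real_derivative u2 x) (at x within {0..d}) \<and> - u2 x + V x * u x = E * u x) \<and>
       bc (u 0) (u1 0) (u d) (u1 d)" by (rule exE)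
  note u = conjunct1[OF u12] and bc = conjunct2[OF u12]
  have S: "solves_on {0..d} (\<lambda>x. V x - E) u u1"
    unfolding solves_on_def
  proof (intro ballI conjI)
    fix x assume x: "x \<in> {0..d}"
    show "(u has_real_derivative u1 x) (at x within {0..d})" using bspec[OF u x] by simp
    have "u2 x = (V x - E) * u x" using bspec[OF u x] by (simp add: algebra_simps)
    then show "(u1 has_real_derivative (V x - E) * u x) (at x within {0..d})" using bspec[OF u x] by simp
  qed
  note rep = solution_representation[OF S]
  have "u = cell_solution E (u 0) (u1 0)"
  proof
    fix x show "u x = cell_solution E (u 0) (u1 0) x"
    proof (cases "x \<in> {0..d}")
      case True
      then have "cell_solution E (u 0) (u1 0) x = u 0 * cs V E x + u1 0 * sn V E x"
        by (simp only: cell_solution_def if_True)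
      then show ?thesis using rep(1)[OF True] by (rule trans[OF _ sym, rotated])
    next
      case False
      then have "cell_solution E (u 0) (u1 0) x = 0" by (simp only: cell_solution_def if_False)
      moreover have "u x = 0" using out False by blast
      ultimately show ?thesis by simp
    qed
  qed
  moreover have "bc (u 0) (u1 0) (u 0 * cs V E d + u1 0 * sn V E d) (u 0 * cs' V E d + u1 0 * sn' V E d)"
  proof -
    have dd: "d \<in> {0..d}" using d_pos by simp
    show ?thesis using bc unfolding rep(1)[OF dd] rep(2)[OF dd] .
  qed
  ultimately show "\<exists>a b. u = cell_solution E a b \<and>
     bc a b (a * cs V E d + b * sn V E d) (a * cs' V E d + b * sn' V E d)" by blast
next
  assume "\<exists>a b. u = cell_solution E a b \<and>
     bc a b (a * cs V E d + b * sn V E d) (a * cs' V E d + b * sn' V E d)"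
  then obtain a b where u: "u = cell_solution E a b"
    and bc: "bc a b (a * cs V E d + b * sn V E d) (a * cs' V E d + b * sn' V E d)" by blast
  have S: "solves_on {0..d} (\<lambda>x. V x - E) u (\<lambda>x. a * cs' V E x + b * sn' V E x)"
    by (rule solves_on_cong[OF solves_on_lincomb[OF cs_solves_Icc sn_solves_Icc]])
       (auto simp: u cell_solution_def)
  show "u \<in> eigenspace bc V d E"
    unfolding eigenspace_def
  proof (intro CollectI conjI exI ballI)
    show "\<forall>x. x \<notin> {0..d} \<longrightarrow> u x = 0" by (auto simp: u cell_solution_def)
    show "bc (u 0) (a * cs' V E 0 + b * sn' V E 0) (u d) (a * cs' V E d + b * sn' V E d)"
      using bc d_pos by (simp add: u cell_solution_def)
    fix x assume x: "x \<in> {0..d}"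
    show "(u has_real_derivative a * cs' V E x + b * sn' V E x) (at x within {0..d})"
      by (rule solves_onD(1)[OF S x])
    show "((\<lambda>x. a * cs' V E x + b * sn' V E x) has_real_derivative (V x - E) * u x) (at x within {0..d})"
      by (rule solves_onD(2)[OF S x])
    show "- ((V x - E) * u x) + V x * u x = E * u x" by (simp add: algebra_simps)
  qed
qed

lemma cell_solution_nonzero:
  assumes "a \<noteq> 0 \<or> b \<noteq> 0" shows "cell_solution E a b \<noteq> (\<lambda>x. 0)"
proof
  assume z: "cell_solution E a b = (\<lambda>x. 0)"
  have S: "solves_on {0..d} (\<lambda>x. V x - E) (\<lambda>x. a * cs V E x + b * sn V E x) (\<lambda>x. a * cs' V E x + b * sn' V E x)"
    by (rule solves_on_lincomb[OF cs_solves_Icc sn_solves_Icc])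
  have Z: "a * cs V E x + b * sn V E x = 0" if "x \<in> {0..d}" for x
    using fun_cong[OF z, of x] that by (simp add: cell_solution_def)
  have h: "d/2 \<in> {0..d}" and nhd: "at (d/2) within {0..d} = at (d/2)"
    using d_pos at_within_Icc_at[of 0 "d/2" d] by auto
  have "((\<lambda>x. a * cs V E x + b * sn V E x) has_real_derivative 0) (at (d/2))"
    by (rule has_field_derivative_transform_within_open[where f = "\<lambda>_. 0" and S = "{0<..<d}"])
       (use Z d_pos in auto)
  then have "a * cs' V E (d/2) + b * sn' V E (d/2) = 0"
    using DERIV_unique[OF solves_onD(1)[OF S h, unfolded nhd]] by simp
  then have "a = 0 \<and> b = 0" using Z[OF h] half_wronskian[of E] by algebra
  then show False using assms by simp
qed

lemma one_dimensional_eigenspace: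
  assumes bc: "\<And>a b. bc a b (a * cs V E d + b * sn V E d) (a * cs' V E d + b * sn' V E d) \<longleftrightarrow>
      (\<exists>k. a = k * v \<and> b = k * w)" and nz: "v \<noteq> 0 \<or> w \<noteq> 0"
  shows "eigenspace bc V d E = range (\<lambda>k x. k * cell_solution E v w x)"
    "eigenvalue bc V d E" "multiplicity_of bc V d E = 1"
proof -
  have "(\<lambda>k x. k * cell_solution E v w x) = (\<lambda>k. cell_solution E (k * v) (k * w))"
    by (auto simp: cell_solution_def fun_eq_iff algebra_simps)
  moreover have "eigenspace bc V d E = range (\<lambda>k. cell_solution E (k * v) (k * w))"
    by (rule set_eqI) (simp only: eigenspace_iff bc image_iff, blast)
  ultimately show 1: "eigenspace bc V d E = range (\<lambda>k x. k * cell_solution E v w x)"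
    by (simp only:)
  have nz': "cell_solution E v w \<noteq> (\<lambda>x. 0)" by (rule cell_solution_nonzero[OF nz])
  show "multiplicity_of bc V d E = 1" by (rule multiplicity_one[OF 1 nz'])
  have "\<exists>k. v = k * v \<and> w = k * w" by (rule exI[of _ 1]) simp
  then have "cell_solution E v w \<in> eigenspace bc V d E" unfolding eigenspace_iff using bc by blast
  then show "eigenvalue bc V d E" unfolding eigenvalue_def using nz' by blast
qed

lemma eigenspace_cs:
  assumes "\<And>a b. bc a b (a * cs V E d + b * sn V E d) (a * cs' V E d + b * sn' V E d) \<longleftrightarrow> b = 0"
  shows "eigenspace bc V d E = range (\<lambda>k x. k * cell_solution E 1 0 x)"
    "eigenvalue bc V d E" "multiplicity_of bc V d E = 1"
  by (rule one_dimensional_eigenspace[where v = 1 and w = 0]; simp add: assms)+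

lemma eigenspace_sn:
  assumes "\<And>a b. bc a b (a * cs V E d + b * sn V E d) (a * cs' V E d + b * sn' V E d) \<longleftrightarrow> a = 0"
  shows "eigenvalue bc V d E" "multiplicity_of bc V d E = 1"
  by (rule one_dimensional_eigenspace[where v = 0 and w = 1]; simp add: assms)+

lemma not_eigenvalue:
  assumes "\<And>a b. bc a b (a * cs V E d + b * sn V E d) (a * cs' V E d + b * sn' V E d) \<Longrightarrow> a = 0 \<and> b = 0"
  shows "\<not> eigenvalue bc V d E"
proof
  assume "eigenvalue bc V d E"
  then obtain u where "u \<in> eigenspace bc V d E" "u \<noteq> (\<lambda>x. 0)" unfolding eigenvalue_def by blast
  then obtain a b where "u = cell_solution E a b" "a = 0 \<and> b = 0" "u \<noteq> (\<lambda>x. 0)"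
    using assms unfolding eigenspace_iff by blast
  then show False by (auto simp: cell_solution_def fun_eq_iff split: if_splits)
qed

text \<open>The condition is \<open>2 S S' = 0\<close>, and \<open>S > 0\<close> up to
  \<open>mu\<close>.\<close>

lemma dirichlet_ev_1: "dirichlet_ev V d 1 = mu"
proof (rule kth_eigenvalue_1)
  have *: "dirichlet a b (a * cs V mu d + b * sn V mu d) (a * cs' V mu d + b * sn' V mu d) \<longleftrightarrow> a = 0" for a b
    using at_mu(1) by (auto simp: dirichlet_def period_from_half_period)
  show "eigenvalue dirichlet V d mu" "multiplicity_of dirichlet V d mu = 1"
    by (rule eigenspace_sn[of dirichlet mu, OF *])+
  show "\<not> eigenvalue dirichlet V d E" if "E < mu" for E
    by (rule not_eigenvalue)
       (use below_mu[OF that] sn_half_pos_le_mu[of E] that in \<open>auto simp: dirichlet_def period_from_half_period\<close>)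
qed

lemma neumann_eigenspace:
  assumes "cs V E (d/2) = 0 \<or> cs' V E (d/2) = 0"
  shows "eigenspace neumann V d E = range (\<lambda>k x. k * cell_solution E 1 0 x)"
    "eigenvalue neumann V d E" "multiplicity_of neumann V d E = 1"
proof -
  have *: "neumann a b (a * cs V E d + b * sn V E d) (a * cs' V E d + b * sn' V E d) \<longleftrightarrow> b = 0" for a b
    using assms by (auto simp: neumann_def period_from_half_period)
  show "eigenspace neumann V d E = range (\<lambda>k x. k * cell_solution E 1 0 x)"
    "eigenvalue neumann V d E" "multiplicity_of neumann V d E = 1"
    by (rule eigenspace_cs[of neumann E, OF *])+
qed

text \<open>The condition is \<open>2 C C' = 0\<close>. Below \<open>nu\<close> only \<open>C'\<close>
  vanishes, at one energy.\<close>

lemma neumann_ev_2: "neumann_ev V d 2 = nu"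
proof -
  obtain \<nu>1 where n: "\<nu>1 < nu" "cs' V \<nu>1 (d/2) = 0" "\<And>E. E < nu \<Longrightarrow> cs' V E (d/2) = 0 \<Longrightarrow> E = \<nu>1"
    using neumann_first[OF half_pos] unfolding nu_def by metis
  show ?thesis
  proof (rule kth_eigenvalue_2)
    show "\<nu>1 < nu" by (rule n)
    show "multiplicity_of neumann V d \<nu>1 = 1" "multiplicity_of neumann V d nu = 1"
      by (rule neumann_eigenspace(3)[OF disjI2[OF n(2)]], rule neumann_eigenspace(3)[OF disjI1[OF at_nu(1)]])
    show "eigenvalue neumann V d E \<longleftrightarrow> E = \<nu>1 \<or> E = nu" if "E \<le> nu" for E
    proof
      assume ev: "eigenvalue neumann V d E"
      have "cs V E (d/2) = 0 \<or> cs' V E (d/2) = 0"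
      proof (rule ccontr)
        assume "\<not> ?thesis"
        then have "\<not> eigenvalue neumann V d E"
          by (intro not_eigenvalue) (auto simp: neumann_def period_from_half_period)
        then show False using ev by simp
      qed
      then show "E = \<nu>1 \<or> E = nu"
        using n(3)[of E] below_nu[of E] that by (cases "E = nu") auto
    next
      assume "E = \<nu>1 \<or> E = nu"
      then show "eigenvalue neumann V d E" using neumann_eigenspace(2)[of E] n(2) at_nu(1) by auto
    qed
  qed
qed

lemma neumann_eigenfunctionE:
  assumes "neumann_eigenfunction V d 2 u"
  obtains k where "k \<noteq> 0" "\<And>x. x \<in> {0..d} \<Longrightarrow> u x = k * cs V nu x"
proof -
  have "u \<in> eigenspace neumann V d nu" "u \<noteq> (\<lambda>x. 0)"
    using assms by (simp_all add: neumann_eigenfunction_def neumann_ev_2)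
  then obtain k where "u = (\<lambda>x. k * cell_solution nu 1 0 x)" "u \<noteq> (\<lambda>x. 0)"
    using neumann_eigenspace(1)[of nu] at_nu(1) by auto
  then show thesis using that[of k] by (cases "k = 0") (auto simp: cell_solution_def)
qed

lemma antiperiodic_bc:
  "antiperiodic a b (a * cs V E d + b * sn V E d) (a * cs' V E d + b * sn' V E d) \<longleftrightarrow>
    sn' V E (d/2) * (a * cs V E (d/2) + b * sn V E (d/2)) = 0 \<and>
    cs V E (d/2) * (a * cs' V E (d/2) + b * sn' V E (d/2)) = 0"
proof -
  define C C' S S' where "C = cs V E (d/2)" and "C' = cs' V E (d/2)" and "S = sn V E (d/2)" and "S' = sn' V E (d/2)"
  have "a * (2 * C * S' - 1) + b * (2 * S * S') = - a \<longleftrightarrow> 2 * (S' * (a * C + b * S)) = 0"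
    by (rule iffI; algebra)
  moreover have "a * (2 * C * C') + b * (2 * C * S' - 1) = - b \<longleftrightarrow> 2 * (C * (a * C' + b * S')) = 0"
    by (rule iffI; algebra)
  ultimately show ?thesis
    unfolding antiperiodic_def period_from_half_period by (simp add: C_def C'_def S_def S'_def)
qed

lemma antiperiodic_cs:
  assumes "cs V E (d/2) = 0" "sn' V E (d/2) \<noteq> 0"
  shows "eigenvalue antiperiodic V d E" "multiplicity_of antiperiodic V d E = 1"
proof -
  have "sn V E (d/2) \<noteq> 0" using half_wronskian[of E] assms by auto
  then have *: "antiperiodic a b (a * cs V E d + b * sn V E d) (a * cs' V E d + b * sn' V E d) \<longleftrightarrow> b = 0" for a b
    using assms by (simp add: antiperiodic_bc)
  show "eigenvalue antiperiodic V d E" "multiplicity_of antiperiodic V d E = 1"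
    by (rule eigenspace_cs(2,3)[of antiperiodic E, OF *])+
qed

lemma antiperiodic_sn:
  assumes "sn' V E (d/2) = 0" "cs V E (d/2) \<noteq> 0"
  shows "eigenvalue antiperiodic V d E" "multiplicity_of antiperiodic V d E = 1"
proof -
  have "cs' V E (d/2) \<noteq> 0" using half_wronskian[of E] assms by auto
  then have *: "antiperiodic a b (a * cs V E d + b * sn V E d) (a * cs' V E d + b * sn' V E d) \<longleftrightarrow> a = 0" for a b
    using assms by (simp add: antiperiodic_bc)
  show "eigenvalue antiperiodic V d E" "multiplicity_of antiperiodic V d E = 1"
    by (rule eigenspace_sn[of antiperiodic E, OF *])+
qed

lemma antiperiodic_not:
  assumes "sn' V E (d/2) \<noteq> 0" "cs V E (d/2) \<noteq> 0"
  shows "\<not> eigenvalue antiperiodic V d E"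
proof (rule not_eigenvalue)
  fix a b assume "antiperiodic a b (a * cs V E d + b * sn V E d) (a * cs' V E d + b * sn' V E d)"
  then have "a * cs V E (d/2) + b * sn V E (d/2) = 0" "a * cs' V E (d/2) + b * sn' V E (d/2) = 0"
    using assms by (simp_all add: antiperiodic_bc)
  then show "a = 0 \<and> b = 0" using half_wronskian[of E] by algebra
qed

lemma half_period_zeros:
  assumes "E \<le> max nu mu"
  shows "cs V E (d/2) = 0 \<longleftrightarrow> E = nu" "sn' V E (d/2) = 0 \<longleftrightarrow> E = mu"
proof -
  have "cs V E (d/2) \<noteq> 0" if "E \<noteq> nu"
  proof (cases "E < nu")
    case False
    then show ?thesis using between_nu_mu[of E] assms that by (auto simp: max_def split: if_splits)
  qed (use below_nu[of E] in auto)
  then show "cs V E (d/2) = 0 \<longleftrightarrow> E = nu" using at_nu(1) by auto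
  have "sn' V E (d/2) \<noteq> 0" if "E \<noteq> mu"
  proof (cases "E < mu")
    case False
    then show ?thesis using between_mu_nu[of E] assms that by (auto simp: max_def split: if_splits)
  qed (use below_mu[of E] in auto)
  then show "sn' V E (d/2) = 0 \<longleftrightarrow> E = mu" using at_mu(1) by auto
qed

text \<open>Both \<open>nu\<close> and \<open>mu\<close> are simple antiperiodic eigenvalues, and there is no
  other one below the larger of them.\<close>

lemma gap_1:
  assumes ne: "nu \<noteq> mu" shows "gap V d 1 = {min nu mu<..<max nu mu}"
proof -
  have ev: "eigenvalue antiperiodic V d E \<longleftrightarrow> E = min nu mu \<or> E = max nu mu" if "E \<le> max nu mu" for E
    using half_period_zeros[OF that] antiperiodic_not[of E] antiperiodic_cs(1)[of E] antiperiodic_sn(1)[of E] ne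
    by (auto simp: min_def max_def)
  have m: "multiplicity_of antiperiodic V d E = 1" if "E = min nu mu \<or> E = max nu mu" for E
    using half_period_zeros[of E] antiperiodic_cs(2)[of E] antiperiodic_sn(2)[of E] ne that
    by (auto simp: min_def max_def split: if_splits)
  have less: "min nu mu < max nu mu" using ne by (auto simp: min_def max_def)
  have "kth_eigenvalue antiperiodic V d 1 = min nu mu"
    by (rule kth_eigenvalue_1) (use ev m less in auto)
  moreover have "kth_eigenvalue antiperiodic V d 2 = max nu mu"
    by (rule kth_eigenvalue_2[OF ev less]) (use m in auto)
  ultimately show ?thesis by (simp add: gap_def band_edge_def)
qed

end

section \<open>Functions with vanishing weak derivative\<close>

definition locally_integrable :: "(real \<Rightarrow> real) \<Rightarrow> bool" where
  "locally_integrable f \<longleftrightarrow> f \<in> borel_measurable borel \<and>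
     (\<forall>a b. integrable lborel (\<lambda>x. indicator {a..b} x * f x))"

lemma locally_integrable_measurable [measurable_dest]: "locally_integrable f \<Longrightarrow> f \<in> borel_measurable borel"
  by (simp add: locally_integrable_def)

lemma locally_integrable_Icc: "locally_integrable f \<Longrightarrow> integrable lborel (\<lambda>x. indicator {a..b} x * f x)"
  by (simp add: locally_integrable_def)

lemma locally_integrable_mult_bounded:
  assumes f: "locally_integrable f" and b: "b \<in> borel_measurable borel"
    and B: "\<And>x. \<bar>b x\<bar> \<le> B" and R: "\<And>x. R < \<bar>x\<bar> \<Longrightarrow> b x = 0"
  shows "integrable lborel (\<lambda>x. b x * f x)"
proof (rule Bochner_Integration.integrable_bound)
  show "integrable lborel (\<lambda>x. B * (indicator {-R..R} x * f x))"
    using locally_integrable_Icc[OF f] by (rule integrable_mult_right)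
  show "(\<lambda>x. b x * f x) \<in> borel_measurable lborel" using f b by measurable
  have B0: "B \<ge> 0" using B[of 0] by linarith
  have "norm (b x * f x) \<le> norm (B * (indicator {-R..R} x * f x))" for x
  proof (cases "R < \<bar>x\<bar>")
    case True then show ?thesis using R by simp
  next
    case False
    then have "indicator {-R..R} x = (1::real)" by (simp add: not_less abs_le_iff indicator_def)
    then show ?thesis using B[of x] B0 by (simp add: abs_mult mult_right_mono)
  qed
  then show "AE x in lborel. norm (b x * f x) \<le> norm (B * (indicator {-R..R} x * f x))" by simp
qed

lemma locally_integrable_diff:
  "locally_integrable f \<Longrightarrow> locally_integrable g \<Longrightarrow> locally_integrable (\<lambda>x. f x - g x)"
  unfolding locally_integrable_def by (auto simp: right_diff_distrib)

lemma locally_integrable_continuous: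
  assumes "continuous_on UNIV f" shows "locally_integrable f"
  unfolding locally_integrable_def
proof (intro conjI allI)
  show "f \<in> borel_measurable borel" using assms by (rule borel_measurable_continuous_onI)
  fix a b show "integrable lborel (\<lambda>x. indicator {a..b} x * f x)"
    using borel_integrable_compact[OF compact_Icc continuous_on_subset[OF assms], of a b] by simp
qed

text \<open>On a bounded interval the positive and the negative part of \<open>f\<close> are densities of two
  finite measures, which agree on half-lines and therefore coincide.\<close>

lemma AE_zero_from_intervals:
  assumes f: "locally_integrable f" and z: "\<And>a b. a \<le> b \<Longrightarrow> (LINT x|lborel. indicator {a..b} x * f x) = 0"
  shows "AE x in lborel. f x = 0"
proof -
  have fm [measurable]: "f \<in> borel_measurable borel" using f by (simp add: locally_integrable_def)
  have z': "(LINT x|lborel. indicator {a..b} x * f x) = 0" for a b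
    using z[of a b] by (cases "a \<le> b") auto
  have step: "AE x in lborel. indicator {- real n..real n} x * f x = 0" for n
  proof -
    define g where "g x = indicator {- real n..real n} x * f x" for x
    have g: "integrable lborel g" unfolding g_def by (rule locally_integrable_Icc[OF f])
    have [measurable]: "g \<in> borel_measurable borel" unfolding g_def by measurable
    define p m where "p x = max 0 (g x)" and "m x = max 0 (- g x)" for x
    have [measurable]: "p \<in> borel_measurable borel" "m \<in> borel_measurable borel"
      unfolding p_def m_def by measurable
    have pm: "integrable lborel p" "integrable lborel m" "\<And>x. p x \<ge> 0" "\<And>x. m x \<ge> 0"
      unfolding p_def m_def using g by (auto intro!: integrable_max)
    have eq: "emeasure (density lborel (\<lambda>x. ennreal (w x))) {a<..} = ennreal (LINT x|lborel. w x * indicator {a<..} x)"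
      if "integrable lborel w" "\<And>x. w x \<ge> 0" for w and a :: real
    proof -
      have "w \<in> borel_measurable lborel" using that by auto
      then have "emeasure (density lborel (\<lambda>x. ennreal (w x))) {a<..} = (\<integral>\<^sup>+x. ennreal (w x) * indicator {a<..} x \<partial>lborel)"
        by (intro emeasure_density) auto
      also have "\<dots> = (\<integral>\<^sup>+x. ennreal (w x * indicator {a<..} x) \<partial>lborel)"
        by (intro nn_integral_cong) (auto simp: indicator_def)
      also have "\<dots> = ennreal (LINT x|lborel. w x * indicator {a<..} x)"
        by (rule nn_integral_eq_integral) (use that integrable_mult_indicator[of "{a<..}" lborel w] in \<open>auto simp: mult.commute\<close>)
      finally show ?thesis .
    qed
    have "density lborel (\<lambda>x. ennreal (p x)) = density lborel (\<lambda>x. ennreal (m x))"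
    proof (rule measure_eqI_lessThan)
      fix a :: real
      show "emeasure (density lborel (\<lambda>x. ennreal (p x))) {a<..} < \<infinity>"
        unfolding eq[OF pm(1,3)] by simp
      have I: "integrable lborel (\<lambda>x. p x * indicator {a<..} x)" "integrable lborel (\<lambda>x. m x * indicator {a<..} x)"
        using integrable_mult_indicator[of "{a<..}" lborel p] integrable_mult_indicator[of "{a<..}" lborel m] pm
        by (auto simp: mult.commute)
      have "(LINT x|lborel. p x * indicator {a<..} x) - (LINT x|lborel. m x * indicator {a<..} x)
          = (LINT x|lborel. p x * indicator {a<..} x - m x * indicator {a<..} x)"
        using I by simp
      also have "\<dots> = (LINT x|lborel. indicator {max a (- real n)..real n} x * f x)"
      proof (rule integral_cong_AE)
        show "AE x in lborel. p x * indicator {a<..} x - m x * indicator {a<..} x = indicator {max a (- real n)..real n} x * f x"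
          using AE_lborel_singleton[of a] by eventually_elim (auto simp: p_def m_def g_def indicator_def max_def)
      qed measurable
      also have "\<dots> = 0" by (rule z')
      finally show "emeasure (density lborel (\<lambda>x. ennreal (p x))) {a<..} = emeasure (density lborel (\<lambda>x. ennreal (m x))) {a<..}"
        unfolding eq[OF pm(1,3)] eq[OF pm(2,4)] by simp
    qed auto
    moreover have "(\<integral>\<^sup>+x. ennreal (p x) \<partial>lborel) \<noteq> \<infinity>"
      using pm by (simp add: nn_integral_eq_integral)
    ultimately have "AE x in lborel. ennreal (p x) = ennreal (m x)"
      by (subst (asm) finite_density_unique) auto
    then show ?thesis
    proof eventually_elim
      case (elim x)
      then have "p x = m x" using pm(3,4) by simp
      then show ?case by (auto simp: p_def m_def max_def g_def[symmetric] split: if_splits)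
    qed
  qed
  have "AE x in lborel. \<forall>n. indicator {- real n..real n} x * f x = 0"
    unfolding AE_all_countable using step by blast
  then show ?thesis
  proof eventually_elim
    case (elim x)
    obtain n :: nat where "\<bar>x\<bar> \<le> real n" using real_arch_simple by blast
    then have "indicator {- real n..real n} x = (1::real)" by (simp add: abs_le_iff indicator_def)
    then show ?case using elim[rule_format, of n] by simp
  qed
qed

lemma test_functionI:
  assumes D: "\<And>x. (\<phi> has_real_derivative \<phi>' x) (at x)" and c: "continuous_on UNIV \<phi>'"
    and R: "\<And>x. R < \<bar>x\<bar> \<Longrightarrow> \<phi> x = 0"
  shows "test_function \<phi>" "deriv \<phi> = \<phi>'"
proof -
  have "\<phi> C1_differentiable_on UNIV"
    unfolding C1_differentiable_on_def using D c by (auto simp: has_real_derivative_iff_has_vector_derivative)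
  moreover have "{x. \<phi> x \<noteq> 0} \<subseteq> {-R..R}" using R by (force simp: not_less)
  then have "compact (closure {x. \<phi> x \<noteq> 0})"
    by (meson bounded_subset bounded_closed_interval bounded_closure compact_eq_bounded_closed closed_closure compact_Icc compact_imp_bounded)
  ultimately show "test_function \<phi>" by (simp add: test_function_def)
  show "deriv \<phi> = \<phi>'" using DERIV_imp_deriv[OF D] by auto
qed

lemma test_functionE:
  assumes "test_function \<phi>"
  obtains R where "R > 0" "\<And>x. R \<le> \<bar>x\<bar> \<Longrightarrow> \<phi> x = 0" "\<And>x. R \<le> \<bar>x\<bar> \<Longrightarrow> deriv \<phi> x = 0"
    "\<And>x. (\<phi> has_real_derivative deriv \<phi> x) (at x)" "continuous_on UNIV (deriv \<phi>)" "continuous_on UNIV \<phi>"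
proof -
  obtain D where D: "\<And>x. (\<phi> has_real_derivative D x) (at x)" "continuous_on UNIV D"
    using assms unfolding test_function_def C1_differentiable_on_def
    by (auto simp: has_real_derivative_iff_has_vector_derivative)
  have dD: "deriv \<phi> = D" using DERIV_imp_deriv[OF D(1)] by auto
  have "bounded {x. \<phi> x \<noteq> 0}"
    using assms unfolding test_function_def by (meson bounded_subset closure_subset compact_imp_bounded)
  then obtain R0 where R0: "\<And>x. \<phi> x \<noteq> 0 \<Longrightarrow> \<bar>x\<bar> \<le> R0" by (auto simp: bounded_iff)
  define R where "R = \<bar>R0\<bar> + 1"
  have z: "\<phi> x = 0" if "\<bar>R0\<bar> < \<bar>x\<bar>" for x using R0[of x] that by fastforce
  have "D x = 0" if x: "R \<le> \<bar>x\<bar>" for x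
  proof -
    have "(\<phi> has_real_derivative 0) (at x)"
      by (rule has_field_derivative_transform_within_open[where f = "\<lambda>_. 0" and S = "{y. \<bar>R0\<bar> < \<bar>y\<bar>}"])
         (use x z in \<open>auto simp: R_def intro!: open_Collect_less continuous_intros\<close>)
    then show ?thesis using DERIV_unique D(1) by blast
  qed
  moreover have "continuous_on UNIV \<phi>" using D(1) DERIV_continuous_on by blast
  ultimately show thesis
    using that[of R] z D unfolding dD by (force simp: R_def)
qed

lemma continuous_compact_support_bounded:
  fixes f :: "real \<Rightarrow> real"
  assumes c: "continuous_on UNIV f" and R: "\<And>x. R \<le> \<bar>x\<bar> \<Longrightarrow> f x = 0"
  obtains B where "\<And>x. \<bar>f x\<bar> \<le> B"
proof -
  obtain B where B: "\<forall>x\<in>{-R..R}. \<bar>f x\<bar> \<le> B"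
    using continuous_on_Icc_bounded[OF continuous_on_subset[OF c]] by blast
  have "\<bar>f x\<bar> \<le> max 0 B" for x
    using bspec[OF B, of x] R[of x] by (cases "R \<le> \<bar>x\<bar>") (auto simp: not_le abs_less_iff max_def)
  then show thesis by (rule that)
qed

text \<open>Subtract from a continuous \<open>\<psi>\<close> with compact support the multiple of a fixed bump
  \<open>\<psi>0\<close> of integral one that has the same integral. The difference is the derivative of a
  test function, so integrating \<open>\<psi>\<close> against \<open>h\<close> gives the integral of
  \<open>\<psi>\<close> times a constant \<open>\<kappa>\<close>. Letting \<open>\<psi>\<close> tend to the
  indicator of an interval shows that \<open>h - \<kappa>\<close> has integral zero over every
  interval.\<close>

lemma constant_if_zero_weak_derivative:
  assumes h: "locally_integrable h"
    and weak: "\<And>\<phi>. test_function \<phi> \<Longrightarrow> (LINT x|lborel. deriv \<phi> x * h x) = 0"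
  obtains \<kappa> where "AE x in lborel. h x = \<kappa>"
proof -
  define \<psi>0 where "\<psi>0 x = max 0 (1 - \<bar>x\<bar>)" for x :: real
  have c0: "continuous_on A \<psi>0" for A unfolding \<psi>0_def by (intro continuous_intros)
  have b0: "\<bar>\<psi>0 x\<bar> \<le> 1" "1 \<le> \<bar>x\<bar> \<Longrightarrow> \<psi>0 x = 0" for x by (auto simp: \<psi>0_def)
  have int0: "(\<psi>0 has_integral 1) {-R..R}" if R: "R \<ge> 1" for R
  proof -
    have "((\<lambda>x. x + x\<^sup>2/2) has_vector_derivative \<psi>0 x) (at x within {-1..0})" if "x \<in> {-1..0}" for x
      unfolding has_real_derivative_iff_has_vector_derivative[symmetric]
      by (rule has_field_derivative_at_within) (use that in \<open>auto intro!: derivative_eq_intros simp: \<psi>0_def\<close>)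
    from fundamental_theorem_of_calculus[OF _ this] have 1: "(\<psi>0 has_integral 1/2) {-1..0}" by simp
    have "((\<lambda>x. x - x\<^sup>2/2) has_vector_derivative \<psi>0 x) (at x within {0..1})" if "x \<in> {0..1}" for x
      unfolding has_real_derivative_iff_has_vector_derivative[symmetric]
      by (rule has_field_derivative_at_within) (use that in \<open>auto intro!: derivative_eq_intros simp: \<psi>0_def\<close>)
    from fundamental_theorem_of_calculus[OF _ this] have 2: "(\<psi>0 has_integral 1/2) {0..1}" by simp
    have "(\<psi>0 has_integral 1/2 + 1/2) {-1..1}" by (rule has_integral_combine[OF _ _ 1 2]) auto
    then have "(\<psi>0 has_integral 1) {-1..1}" by simp
    then show ?thesis by (rule has_integral_on_superset) (use R b0 in auto)
  qed
  define \<kappa> where "\<kappa> = (LINT x|lborel. \<psi>0 x * h x)"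
  have I0: "integrable lborel (\<lambda>x. \<psi>0 x * h x)"
    by (rule locally_integrable_mult_bounded[OF h borel_measurable_continuous_onI[OF c0] b0(1), of 1]) (use b0 in auto)
  have key: "(LINT x|lborel. \<psi> x * h x) = integral {-R..R} \<psi> * \<kappa>"
    if c: "continuous_on UNIV \<psi>" and R: "R \<ge> 1" "\<And>x. R \<le> \<bar>x\<bar> \<Longrightarrow> \<psi> x = 0" for \<psi> R
  proof -
    define J where "J = integral {-R..R} \<psi>"
    define \<eta> where "\<eta> x = \<psi> x - J * \<psi>0 x" for x
    have c\<eta>: "continuous_on A \<eta>" for A
      unfolding \<eta>_def by (intro continuous_intros c0 continuous_on_subset[OF c]) auto
    have \<eta>0: "\<eta> x = 0" if "R \<le> \<bar>x\<bar>" for x using R(2)[OF that] b0(2)[of x] R(1) that by (simp add: \<eta>_def)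
    have "(\<psi> has_integral J) {-R..R}" unfolding J_def
      by (intro integrable_integral integrable_continuous_interval continuous_on_subset[OF c]) auto
    from has_integral_diff[OF this has_integral_mult_right[OF int0[OF R(1)], of J]]
    have int\<eta>: "(\<eta> has_integral 0) {-R..R}" by (simp add: \<eta>_def[abs_def])
    define \<phi> where "\<phi> x = integral {-R..x} \<eta>" for x
    have neg: "\<phi> x = 0" if "x \<le> -R" for x
    proof -
      have "{-R..x} = {} \<or> {-R..x} = {-R}" using that by (cases "x = -R") auto
      then show ?thesis unfolding \<phi>_def by auto
    qed
    have big: "\<phi> x = 0" if "x \<ge> R" for x
    proof -
      have "(\<eta> has_integral 0) {-R..x}"
        by (rule has_integral_on_superset[OF int\<eta>]) (use \<eta>0 that in auto)
      then show ?thesis unfolding \<phi>_def by (rule integral_unique)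
    qed
    have D: "(\<phi> has_real_derivative \<eta> x) (at x)" for x
    proof (cases "x < -R")
      case True
      have "(\<phi> has_real_derivative 0) (at x)"
        by (rule has_field_derivative_transform_within_open[where f = "\<lambda>_. 0" and S = "{..<-R}"]) (use True neg in auto)
      then show ?thesis using \<eta>0[of x] True R(1) by simp
    next
      case False
      \<comment> \<open>Starting the integral to the left of \<open>- R\<close> does not change it and makes
        \<open>- R\<close> an interior point.\<close>
      define \<phi>2 where "\<phi>2 y = integral {-R-1..y} \<eta>" for y
      have "(\<phi>2 has_real_derivative \<eta> x) (at x within {-R-1..x+1})"
        unfolding \<phi>2_def by (rule integral_has_real_derivative[OF c\<eta>]) (use False in auto)
      then have "(\<phi>2 has_real_derivative \<eta> x) (at x)"
        using at_within_Icc_at[of "-R-1" x "x+1"] False by simp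
      moreover have "\<phi>2 y = \<phi> y" for y
      proof (cases "y < -R")
        case True
        have "integral {-R-1..y} \<eta> = integral {-R-1..y} (\<lambda>x. 0)"
          by (rule Henstock_Kurzweil_Integration.integral_cong) (use True \<eta>0 R(1) in auto)
        then show ?thesis using neg[of y] True by (simp add: \<phi>2_def)
      next
        case False
        have "integral {-R-1..-R} \<eta> + integral {-R..y} \<eta> = integral {-R-1..y} \<eta>"
          by (rule Henstock_Kurzweil_Integration.integral_combine) (use False c\<eta> in \<open>auto intro: integrable_continuous_interval\<close>)
        moreover have "integral {-R-1..-R} \<eta> = integral {-R-1..-R} (\<lambda>x. 0)"
          by (rule Henstock_Kurzweil_Integration.integral_cong) (use \<eta>0 R(1) in auto)
        ultimately show ?thesis by (simp add: \<phi>2_def \<phi>_def)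
      qed
      then have "\<phi>2 = \<phi>" by (rule ext)
      ultimately show ?thesis by (simp only:)
    qed
    have "\<phi> x = 0" if "R < \<bar>x\<bar>" for x using neg[of x] big[of x] that by linarith
    note tf = test_functionI[OF D c\<eta> this]
    from weak[OF tf(1)] tf(2) have "(LINT x|lborel. \<eta> x * h x) = 0" by simp
    moreover have I\<psi>: "integrable lborel (\<lambda>x. \<psi> x * h x)"
    proof -
      obtain B where B: "\<And>x. \<bar>\<psi> x\<bar> \<le> B" using continuous_compact_support_bounded[OF c R(2)] by metis
      show ?thesis
        by (rule locally_integrable_mult_bounded[OF h borel_measurable_continuous_onI[OF c] B, of R]) (use R in auto)
    qed
    have "(LINT x|lborel. \<eta> x * h x) = (LINT x|lborel. \<psi> x * h x - J * (\<psi>0 x * h x))"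
      by (simp add: \<eta>_def left_diff_distrib mult.assoc)
    also have "\<dots> = (LINT x|lborel. \<psi> x * h x) - J * \<kappa>"
      using I\<psi> I0 by (simp add: \<kappa>_def)
    ultimately show ?thesis by (simp add: J_def)
  qed
  have "AE x in lborel. h x - \<kappa> = 0"
  proof (rule AE_zero_from_intervals)
    show hk: "locally_integrable (\<lambda>x. h x - \<kappa>)"
      by (rule locally_integrable_diff[OF h locally_integrable_continuous]) simp
    fix a b :: real assume ab: "a \<le> b"
    define R where "R = \<bar>a\<bar> + \<bar>b\<bar> + 1"
    define \<psi> where "\<psi> n x = max 0 (min 1 (real n * min (x - a) (b - x)))" for n :: nat and x
    have c: "continuous_on A (\<psi> n)" for n A unfolding \<psi>_def by (intro continuous_intros)
    have z: "\<psi> n x = 0" if "x \<notin> {a..b}" for n x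
    proof -
      have "min (x - a) (b - x) \<le> 0" using that by auto
      then have "real n * min (x - a) (b - x) \<le> 0" by (rule mult_nonneg_nonpos[rotated]) simp
      then show ?thesis by (simp add: \<psi>_def)
    qed
    have zR: "\<psi> n x = 0" if "R \<le> \<bar>x\<bar>" for n x by (rule z) (use that in \<open>auto simp: R_def\<close>)
    have b1: "\<bar>\<psi> n x\<bar> \<le> indicator {a..b} x" for n x
      using z[of x n] by (cases "x \<in> {a..b}") (auto simp: \<psi>_def)
    have lim: "(\<lambda>n. \<psi> n x) \<longlonglongrightarrow> indicator {a..b} x" if "x \<noteq> a" "x \<noteq> b" for x
    proof (cases "x \<in> {a..b}")
      case False then show ?thesis using z by simp
    next
      case True
      define m where "m = min (x - a) (b - x)"
      have m: "m > 0" using True that by (auto simp: m_def)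
      obtain N :: nat where N: "1 / m \<le> real N" using real_arch_simple by blast
      have "\<psi> n x = 1" if "n \<ge> N" for n
      proof -
        have "1 / m \<le> real n" using N that by simp
        then have "1 \<le> real n * m" using m by (simp add: field_simps)
        then show ?thesis by (simp add: \<psi>_def m_def)
      qed
      then have "\<forall>\<^sub>F n in sequentially. \<psi> n x = indicator {a..b} x"
        using True by (auto simp: eventually_sequentially)
      then show ?thesis by (rule tendsto_eventually)
    qed
    have ae: "AE x in lborel. x \<noteq> a \<and> x \<noteq> b"
      using AE_lborel_singleton[of a] AE_lborel_singleton[of b] by eventually_elim auto
    have key0: "(LINT x|lborel. \<psi> n x * (h x - \<kappa>)) = 0" for n
    proof -
      have i1: "integrable lborel (\<lambda>x. \<psi> n x * h x)" 
        by (rule locally_integrable_mult_bounded[OF h borel_measurable_continuous_onI[OF c[of UNIV n]], where B = 1 and R = R])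
           (use zR in \<open>auto simp: \<psi>_def\<close>)
      have loc1: "locally_integrable (\<lambda>x::real. 1)" by (rule locally_integrable_continuous) simp
      have i2: "integrable lborel (\<lambda>x. \<psi> n x * 1)" 
        by (rule locally_integrable_mult_bounded[OF loc1 borel_measurable_continuous_onI[OF c[of UNIV n]], where B = 1 and R = R])
           (use zR in \<open>auto simp: \<psi>_def\<close>)
      have "(\<psi> n has_integral (LINT x|lborel. \<psi> n x)) UNIV"
        using has_integral_integral_lborel i2 by simp
      moreover have "(\<psi> n has_integral integral {-R..R} (\<psi> n)) UNIV"
        by (rule has_integral_on_superset[of _ _ "{-R..R}"])
           (use zR c in \<open>auto intro!: integrable_integral integrable_continuous_interval\<close>)
      ultimately have "(LINT x|lborel. \<psi> n x) = integral {-R..R} (\<psi> n)" by (rule has_integral_unique)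
      moreover have "(LINT x|lborel. \<psi> n x * h x) = integral {-R..R} (\<psi> n) * \<kappa>"
        by (rule key[OF c]) (use zR in \<open>auto simp: R_def\<close>)
      ultimately show ?thesis using i1 i2 by (simp add: right_diff_distrib)
    qed
    have "(\<lambda>n. LINT x|lborel. \<psi> n x * (h x - \<kappa>)) \<longlonglongrightarrow> (LINT x|lborel. indicator {a..b} x * (h x - \<kappa>))"
    proof (rule integral_dominated_convergence)
      have [measurable]: "h \<in> borel_measurable borel" "\<psi> n \<in> borel_measurable borel" for n
        using h borel_measurable_continuous_onI[OF c] by (auto simp: locally_integrable_def)
      show "(\<lambda>x. indicator {a..b} x * (h x - \<kappa>)) \<in> borel_measurable lborel" by measurable
      show "(\<lambda>x. \<psi> n x * (h x - \<kappa>)) \<in> borel_measurable lborel" for n by measurable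
      show "integrable lborel (\<lambda>x. \<bar>indicator {a..b} x * (h x - \<kappa>)\<bar>)"
        using locally_integrable_Icc[OF hk] by (rule integrable_abs)
      show "AE x in lborel. (\<lambda>n. \<psi> n x * (h x - \<kappa>)) \<longlonglongrightarrow> indicator {a..b} x * (h x - \<kappa>)"
        using ae by eventually_elim (intro tendsto_intros lim; simp)
      show "AE x in lborel. norm (\<psi> n x * (h x - \<kappa>)) \<le> \<bar>indicator {a..b} x * (h x - \<kappa>)\<bar>" for n
        using b1 by (auto simp: abs_mult intro!: mult_right_mono)
    qed
    then show "(LINT x|lborel. indicator {a..b} x * (h x - \<kappa>)) = 0"
      unfolding key0 by (simp only: LIMSEQ_const_iff)
  qed
  then show thesis using that[of \<kappa>] by simp
qed

section \<open>Weak derivatives and primitives\<close>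

text \<open>Primitive of a locally integrable function.\<close>

text \<open>The indicator of \<open>[x, 0)\<close> enters with a minus sign, so that negative \<open>x\<close>
  are covered by the same formula; the convention at the end points affects a null set only.\<close>

definition primitive :: "(real \<Rightarrow> real) \<Rightarrow> real \<Rightarrow> real" where
  "primitive g x = (LINT y|lborel. (indicator {0..x} y - indicator {x..<0} y) * g y)"

lemma primitive_integrable:
  assumes "locally_integrable g"
  shows "integrable lborel (\<lambda>y. (indicator {0..x} y - indicator {x..<0} y) * g y)"
  by (rule locally_integrable_mult_bounded[OF assms, of _ 1 "\<bar>x\<bar>"])
     (auto simp: indicator_def)

lemma primitive_diff:
  assumes g: "locally_integrable g" and "a \<le> b"
  shows "primitive g b - primitive g a = (LINT y|lborel. indicator {a..b} y * g y)"
proof -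
  have [measurable]: "g \<in> borel_measurable borel" using g by (simp add: locally_integrable_def)
  have "primitive g b - primitive g a =
      (LINT y|lborel. (indicator {0..b} y - indicator {b..<0} y) * g y - (indicator {0..a} y - indicator {a..<0} y) * g y)"
    unfolding primitive_def by (rule Bochner_Integration.integral_diff[symmetric]) (rule primitive_integrable[OF g])+
  also have "\<dots> = (LINT y|lborel. indicator {a..b} y * g y)"
  proof (rule integral_cong_AE)
    show "AE y in lborel. (indicator {0..b} y - indicator {b..<0} y) * g y - (indicator {0..a} y - indicator {a..<0} y) * g y
        = indicator {a..b} y * g y"
      using AE_lborel_singleton[of a] AE_lborel_singleton[of b] AE_lborel_singleton[of 0]
      by eventually_elim (use \<open>a \<le> b\<close> in \<open>auto simp: indicator_def\<close>)
  qed measurable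
  finally show ?thesis .
qed

lemma primitive_continuous:
  assumes g: "locally_integrable g" shows "continuous_on UNIV (primitive g)"
proof -
  have "isCont (primitive g) x" for x
  proof -
    define c where "c = x - 1"
    have I: "set_integrable lborel {c..x+1} g"
      using locally_integrable_Icc[OF g, of c "x+1"] by (simp add: set_integrable_def)
    have "continuous_on {c..x+1} (\<lambda>y. integral {c..y} g)"
      by (rule indefinite_integral_continuous_1) (rule set_borel_integral_eq_integral(1)[OF I])
    then have 1: "continuous_on {c..x+1} (\<lambda>y. primitive g c + integral {c..y} g)"
      by (intro continuous_intros)
    have "primitive g c + integral {c..y} g = primitive g y" if "y \<in> {c..x+1}" for y
    proof -
      have "set_integrable lborel {c..y} g"
        using locally_integrable_Icc[OF g, of c y] by (simp add: set_integrable_def)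
      from set_borel_integral_eq_integral(2)[OF this]
      show ?thesis using primitive_diff[OF g, of c y] that by (simp add: set_lebesgue_integral_def)
    qed
    then have "continuous_on {c..x+1} (primitive g)" by (rule continuous_on_eq[OF 1])
    then have "continuous_on {c<..<x+1} (primitive g)" by (rule continuous_on_subset) auto
    then show ?thesis by (simp add: continuous_on_eq_continuous_at c_def)
  qed
  then show ?thesis by (simp add: continuous_on_eq_continuous_at)
qed

lemma integral_deriv_test:
  assumes D: "\<And>x. (\<phi> has_real_derivative \<phi>' x) (at x)" and c: "continuous_on UNIV \<phi>'" and "a \<le> b"
  shows "(LINT x|lborel. indicator {a..b} x * \<phi>' x) = \<phi> b - \<phi> a"
proof -
  have "(LINT x|lborel. \<phi>' x * indicator {a..b} x) = \<phi> b - \<phi> a"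
    by (rule integral_FTC_Icc_real[OF \<open>a \<le> b\<close> D]) 
       (use c in \<open>auto simp: continuous_on_eq_continuous_at\<close>)
  then show ?thesis by (simp add: mult.commute)
qed

text \<open>A primitive of an integrable function need not be differentiable at a given point, so the product
  rule is replaced by Fubini's theorem on the triangle \<open>y \<le> x\<close> inside the square \<open>[- R,
  R]\<^sup>2\<close>.\<close>

lemma primitive_by_parts:
  assumes g: "locally_integrable g" and \<phi>: "test_function \<phi>"
  shows "(LINT x|lborel. deriv \<phi> x * primitive g x) = - (LINT x|lborel. \<phi> x * g x)"
proof -
  obtain R where R: "R > 0" "\<And>x. R \<le> \<bar>x\<bar> \<Longrightarrow> \<phi> x = 0" "\<And>x. R \<le> \<bar>x\<bar> \<Longrightarrow> deriv \<phi> x = 0"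
    "\<And>x. (\<phi> has_real_derivative deriv \<phi> x) (at x)" "continuous_on UNIV (deriv \<phi>)" "continuous_on UNIV \<phi>"
    using test_functionE[OF \<phi>] by metis
  have [measurable]: "g \<in> borel_measurable borel" "deriv \<phi> \<in> borel_measurable borel" "\<phi> \<in> borel_measurable borel"
    using g R(5,6) by (auto simp: locally_integrable_def intro: borel_measurable_continuous_onI)
  define a where "a x = indicator {-R..R} x * deriv \<phi> x" for x
  define b where "b y = indicator {-R..R} y * g y" for y
  have ai: "integrable lborel a" unfolding a_def
    by (rule locally_integrable_Icc[OF locally_integrable_continuous[OF R(5)]])
  have bi: "integrable lborel b" unfolding b_def by (rule locally_integrable_Icc[OF g])
  have [measurable]: "a \<in> borel_measurable borel" "b \<in> borel_measurable borel"
    unfolding a_def b_def by measurable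
  have prod: "integrable (lborel \<Otimes>\<^sub>M lborel) (\<lambda>p. a (fst p) * b (snd p))"
  proof (rule lborel_pair.Fubini_integrable)
    show "(\<lambda>p. a (fst p) * b (snd p)) \<in> borel_measurable (lborel \<Otimes>\<^sub>M lborel)" by measurable
    show "integrable lborel (\<lambda>x. LINT y|lborel. norm (a (fst (x, y)) * b (snd (x, y))))"
      using ai by (simp add: abs_mult)
    show "AE x in lborel. integrable lborel (\<lambda>y. a (fst (x, y)) * b (snd (x, y)))"
      using bi by simp
  qed
  have tri: "integrable (lborel \<Otimes>\<^sub>M lborel) (\<lambda>(x, y). (if y \<le> x then 1 else 0) * (a x * b y))"
    by (rule Bochner_Integration.integrable_bound[OF prod]) (measurable, auto)
  \<comment> \<open>The derivative of a test function has integral zero, so the primitive may be replaced by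
    its increment from \<open>- R\<close>.\<close>
  have zero: "(LINT x|lborel. a x) = 0"
    unfolding a_def using integral_deriv_test[OF R(4,5), of "-R" R] R(1) R(2)[of R] R(2)[of "-R"] by simp
  have "(LINT x|lborel. deriv \<phi> x * primitive g x) = (LINT x|lborel. a x * (primitive g x - primitive g (-R)) + primitive g (-R) * a x)"
  proof (rule Bochner_Integration.integral_cong)
    fix x show "deriv \<phi> x * primitive g x = a x * (primitive g x - primitive g (-R)) + primitive g (-R) * a x"
      using R(3)[of x] by (cases "R \<le> \<bar>x\<bar>") (auto simp: a_def indicator_def algebra_simps)
  qed simp
  also have "\<dots> = (LINT x|lborel. a x * (primitive g x - primitive g (-R))) + (LINT x|lborel. primitive g (-R) * a x)"
  proof (rule Bochner_Integration.integral_add)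
    have cp: "continuous_on UNIV (\<lambda>x. deriv \<phi> x * (primitive g x - primitive g (-R)))"
      by (intro continuous_intros R(5) primitive_continuous[OF g])
    show "integrable lborel (\<lambda>x. a x * (primitive g x - primitive g (-R)))"
      using locally_integrable_Icc[OF locally_integrable_continuous[OF cp], of "-R" R] by (simp add: a_def mult.assoc)
    show "integrable lborel (\<lambda>x. primitive g (-R) * a x)" using ai by simp
  qed
  also have "(LINT x|lborel. primitive g (-R) * a x) = 0" using zero by simp
  also have "(LINT x|lborel. a x * (primitive g x - primitive g (-R))) 
     = (LINT x|lborel. (LINT y|lborel. (if y \<le> x then 1 else 0) * (a x * b y)))"
  proof (rule Bochner_Integration.integral_cong)
    fix x
    show "a x * (primitive g x - primitive g (-R)) = (LINT y|lborel. (if y \<le> x then 1 else 0) * (a x * b y))"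
    proof (cases "x \<in> {-R..R}")
      case False then show ?thesis by (simp add: a_def)
    next
      case True
      have "primitive g x - primitive g (-R) = (LINT y|lborel. indicator {-R..x} y * g y)"
        by (rule primitive_diff[OF g]) (use True in auto)
      also have "\<dots> = (LINT y|lborel. (if y \<le> x then 1 else 0) * b y)"
        by (rule Bochner_Integration.integral_cong) (use True in \<open>auto simp: b_def indicator_def\<close>)
      finally have "a x * (primitive g x - primitive g (-R)) = (LINT y|lborel. a x * ((if y \<le> x then 1 else 0) * b y))"
        by simp
      then show ?thesis by (simp add: mult.left_commute)
    qed
  qed simp
  also have "\<dots> = (LINT y|lborel. (LINT x|lborel. (if y \<le> x then 1 else 0) * (a x * b y)))"
    using lborel_pair.Fubini_integral[OF tri] by simp
  also have "\<dots> = (LINT y|lborel. - (\<phi> y * g y))"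
  proof (rule Bochner_Integration.integral_cong)
    fix y
    show "(LINT x|lborel. (if y \<le> x then 1 else 0) * (a x * b y)) = - (\<phi> y * g y)"
    proof (cases "y \<in> {-R..R}")
      case False then show ?thesis using R(2)[of y] by (auto simp: b_def)
    next
      case True
      have "(LINT x|lborel. (if y \<le> x then 1 else 0) * (a x * b y)) = (LINT x|lborel. b y * (indicator {y..R} x * deriv \<phi> x))"
        by (rule Bochner_Integration.integral_cong) (use True in \<open>auto simp: a_def indicator_def\<close>)
      also have "\<dots> = b y * (\<phi> R - \<phi> y)"
        using integral_deriv_test[OF R(4,5), of y R] True by simp
      finally show ?thesis using R(1) R(2)[of R] True by (simp add: b_def)
    qed
  qed simp
  finally show ?thesis by simp
qed

lemma test_function_mult_integrable:
  assumes f: "locally_integrable f" and \<phi>: "test_function \<phi>"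
  shows "integrable lborel (\<lambda>x. \<phi> x * f x)" "integrable lborel (\<lambda>x. deriv \<phi> x * f x)"
proof -
  obtain R where R: "R > 0" "\<And>x. R \<le> \<bar>x\<bar> \<Longrightarrow> \<phi> x = 0" "\<And>x. R \<le> \<bar>x\<bar> \<Longrightarrow> deriv \<phi> x = 0"
    "continuous_on UNIV (deriv \<phi>)" "continuous_on UNIV \<phi>"
    using test_functionE[OF \<phi>] by metis
  obtain B where B: "\<And>x. \<bar>\<phi> x\<bar> \<le> B" using continuous_compact_support_bounded[OF R(5,2)] by metis
  obtain B' where B': "\<And>x. \<bar>deriv \<phi> x\<bar> \<le> B'" using continuous_compact_support_bounded[OF R(4,3)] by metis
  show "integrable lborel (\<lambda>x. \<phi> x * f x)"
    by (rule locally_integrable_mult_bounded[OF f borel_measurable_continuous_onI[OF R(5)] B, of R]) (use R(2) in simp)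
  show "integrable lborel (\<lambda>x. deriv \<phi> x * f x)"
    by (rule locally_integrable_mult_bounded[OF f borel_measurable_continuous_onI[OF R(4)] B', of R]) (use R(3) in simp)
qed

text \<open>The lemma of du Bois-Reymond: \<open>u\<close> minus a primitive of \<open>g\<close> has weak
  derivative zero.\<close>

lemma weakly_differentiable_imp_primitive:
  assumes u: "locally_integrable u" and g: "locally_integrable g"
    and weak: "\<And>\<phi>. test_function \<phi> \<Longrightarrow> (LINT x|lborel. deriv \<phi> x * u x) = - (LINT x|lborel. \<phi> x * g x)"
  obtains U where "continuous_on UNIV U" "AE x in lborel. u x = U x"
    "\<And>a b. a \<le> b \<Longrightarrow> U b - U a = (LINT x|lborel. indicator {a..b} x * g x)"
proof -
  note lp = locally_integrable_continuous[OF primitive_continuous[OF g]]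
  have "(LINT x|lborel. deriv \<phi> x * (u x - primitive g x)) = 0" if \<phi>: "test_function \<phi>" for \<phi>
    using weak[OF \<phi>] primitive_by_parts[OF g \<phi>] test_function_mult_integrable(2)[OF u \<phi>]
      test_function_mult_integrable(2)[OF lp \<phi>] by (simp add: right_diff_distrib)
  from constant_if_zero_weak_derivative[OF locally_integrable_diff[OF u lp] this]
  obtain \<kappa> where k: "AE x in lborel. u x - primitive g x = \<kappa>" by metis
  show thesis
  proof (rule that[of "\<lambda>x. primitive g x + \<kappa>"])
    show "continuous_on UNIV (\<lambda>x. primitive g x + \<kappa>)" by (intro continuous_intros primitive_continuous[OF g])
    show "AE x in lborel. u x = primitive g x + \<kappa>" using k by eventually_elim auto
  qed (use primitive_diff[OF g] in auto)
qed

section \<open>Line eigenfunctions restrict to matched half-line solutions\<close>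

lemma L2_norm_locally_integrable:
  assumes "f \<in> L2" shows "locally_integrable (\<lambda>x. cmod (f x))"
  unfolding locally_integrable_def
proof (intro conjI allI)
  have [measurable]: "f \<in> borel_measurable borel" using assms by (simp add: L2_def)
  show m: "(\<lambda>x. cmod (f x)) \<in> borel_measurable borel" by measurable
  fix a b :: real
  show "integrable lborel (\<lambda>x. indicator {a..b} x * cmod (f x))"
  proof (rule Bochner_Integration.integrable_bound)
    have "integrable lborel (\<lambda>x. indicator {a..b} x *\<^sub>R (1::real))"
      by (rule borel_integrable_compact) auto
    then show "integrable lborel (\<lambda>x. indicator {a..b} x + (cmod (f x))\<^sup>2)" using assms by (simp add: L2_def)
    show "(\<lambda>x. indicator {a..b} x * cmod (f x)) \<in> borel_measurable lborel" by measurable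
    have "cmod (f x) \<le> 1 + (cmod (f x))\<^sup>2" for x
    proof -
      have "2 * cmod (f x) \<le> 1 + (cmod (f x))\<^sup>2" using sum_squares_bound[of 1 "cmod (f x)"] by simp
      then show ?thesis using norm_ge_zero[of "f x"] by linarith
    qed
    then show "AE x in lborel. norm (indicator {a..b} x * cmod (f x)) \<le> norm (indicator {a..b} x + (cmod (f x))\<^sup>2)"
      by (intro AE_I2) (auto simp: indicator_def)
  qed
qed

text \<open>Real and imaginary part are treated together; an eigenfunction that is not zero almost everywhere
  has one of them not zero almost everywhere.\<close>

locale complex_part =
  fixes P :: "complex \<Rightarrow> real"
  assumes P_linear: "bounded_linear P" and P_le: "\<bar>P z\<bar> \<le> cmod z"
begin

lemma P_measurable: "f \<in> borel_measurable borel \<Longrightarrow> (\<lambda>x. P (f x)) \<in> borel_measurable borel"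
  using measurable_compose[OF _ borel_measurable_continuous_onI[OF linear_continuous_on[OF P_linear]]] by blast

lemma P_locally_integrable:
  assumes "f \<in> L2" shows "locally_integrable (\<lambda>x. P (f x))"
  unfolding locally_integrable_def
proof (intro conjI allI)
  have fm: "f \<in> borel_measurable borel" using assms by (simp add: L2_def)
  note [measurable] = P_measurable[OF fm]
  show "(\<lambda>x. P (f x)) \<in> borel_measurable borel" by measurable
  show "integrable lborel (\<lambda>x. indicator {a..b} x * P (f x))" for a b
    by (rule Bochner_Integration.integrable_bound[OF locally_integrable_Icc[OF L2_norm_locally_integrable[OF assms], of a b]])
       (measurable, auto simp: indicator_def P_le)
qed

lemma P_square_integrable:
  assumes "f \<in> L2" shows "integrable lborel (\<lambda>x. (P (f x))\<^sup>2)"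
proof (rule Bochner_Integration.integrable_bound)
  have fm: "f \<in> borel_measurable borel" using assms by (simp add: L2_def)
  note [measurable] = P_measurable[OF fm]
  show "integrable lborel (\<lambda>x. (cmod (f x))\<^sup>2)" using assms by (simp add: L2_def)
  show "(\<lambda>x. (P (f x))\<^sup>2) \<in> borel_measurable lborel" by measurable
  show "AE x in lborel. norm ((P (f x))\<^sup>2) \<le> norm ((cmod (f x))\<^sup>2)"
    using P_le by (intro AE_I2) (simp add: abs_le_square_iff[symmetric])
qed

lemma P_weak_deriv:
  assumes w: "weak_deriv_L2 u g" and \<phi>: "test_function \<phi>"
  shows "(LINT x|lborel. deriv \<phi> x * P (u x)) = - (LINT x|lborel. \<phi> x * P (g x))"
proof -
  have L2: "u \<in> L2" "g \<in> L2" and eq: "(LINT x|lborel. deriv \<phi> x *\<^sub>R u x) = - (LINT x|lborel. \<phi> x *\<^sub>R g x)"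
    using w \<phi> by (auto simp: weak_deriv_L2_def)
  obtain R where R: "continuous_on UNIV (deriv \<phi>)" "continuous_on UNIV \<phi>"
    using test_functionE[OF \<phi>] by metis
  note [measurable] = R[THEN borel_measurable_continuous_onI]
  have I: "integrable lborel (\<lambda>x. a x *\<^sub>R f x)" if "f \<in> L2" "integrable lborel (\<lambda>x. a x * cmod (f x))"
    "a \<in> borel_measurable borel" for a f
  proof (rule Bochner_Integration.integrable_bound[OF that(2)])
    have [measurable]: "f \<in> borel_measurable borel" using that by (simp add: L2_def)
    note [measurable] = that(3)
    show "(\<lambda>x. a x *\<^sub>R f x) \<in> borel_measurable lborel" by measurable
  qed auto
  have lin: "P (r *\<^sub>R z) = r * P z" for r z
    using linear_scale[OF bounded_linear.linear[OF P_linear]] by simp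
  have "(LINT x|lborel. deriv \<phi> x * P (u x)) = P (LINT x|lborel. deriv \<phi> x *\<^sub>R u x)"
    using integral_bounded_linear[OF P_linear I[OF L2(1) test_function_mult_integrable(2)[OF L2_norm_locally_integrable[OF L2(1)] \<phi>]]]
    by (simp add: lin)
  also have "\<dots> = - P (LINT x|lborel. \<phi> x *\<^sub>R g x)"
    unfolding eq using linear_neg[OF bounded_linear.linear[OF P_linear]] by simp
  also have "P (LINT x|lborel. \<phi> x *\<^sub>R g x) = (LINT x|lborel. \<phi> x * P (g x))"
    using integral_bounded_linear[OF P_linear I[OF L2(2) test_function_mult_integrable(1)[OF L2_norm_locally_integrable[OF L2(2)] \<phi>]]]
    by (simp add: lin)
  finally show ?thesis by simp
qed

end

lemma deriv_from_increments:
  assumes x: "x \<in> {c..e}" and g: "continuous_on {c..e} g"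
    and F: "\<And>b. b \<in> {c..e} \<Longrightarrow> F b - F c = (LINT y|lborel. indicator {c..b} y * g y)"
  shows "(F has_real_derivative g x) (at x within {c..e})"
proof (rule has_real_derivative_eq_on[of "\<lambda>b. F c + integral {c..b} g"])
  show "((\<lambda>b. F c + integral {c..b} g) has_real_derivative g x) (at x within {c..e})"
    using DERIV_add[OF DERIV_const integral_has_real_derivative[OF g x]] by simp
  fix b assume b: "b \<in> {c..e}"
  have "continuous_on {c..b} g" by (rule continuous_on_subset[OF g]) (use b in auto)
  then have "set_integrable lborel {c..b} g" by (rule borel_integrable_atLeastAtMost')
  from set_borel_integral_eq_integral(2)[OF this]
  have "(LINT y|lborel. indicator {c..b} y * g y) = integral {c..b} g" by (simp add: set_lebesgue_integral_def)
  then show "F b = F c + integral {c..b} g" using F[OF b] by simp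
qed (use x in simp)

lemma solves_on_halfline:
  assumes "\<And>L. L > 0 \<Longrightarrow> solves_on {0..L} q u v" shows "solves_on {0..} q u v"
  unfolding solves_on_def
proof
  fix x :: real assume x: "x \<in> {0..}"
  have "at x within {0..} = at x within {0..x+1}"
    by (rule at_within_nhd[of x "{..<x+1}"]) auto
  then show "(u has_real_derivative v x) (at x within {0..}) \<and>
     (v has_real_derivative q x * u x) (at x within {0..})"
    using solves_onD[OF assms[of "x+1"], of x] x by auto
qed

definition L2_halfline :: "(real \<Rightarrow> real) \<Rightarrow> bool" where
  "L2_halfline f \<longleftrightarrow> integrable lborel (\<lambda>x. indicator {0..} x * (f x)\<^sup>2)"

lemma L2_halflineI:
  assumes "integrable lborel (\<lambda>x. (U x)\<^sup>2)"
  shows "L2_halfline U" "L2_halfline (\<lambda>x. U (- x))"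
proof -
  have "integrable lborel (\<lambda>x. (U (- x))\<^sup>2)" using lborel_integrable_real_affine[OF assms, of "-1" 0] by simp
  then show "L2_halfline U" "L2_halfline (\<lambda>x. U (- x))"
    unfolding L2_halfline_def
    using integrable_mult_indicator[of "{0..}" lborel "\<lambda>x. (U x)\<^sup>2"] integrable_mult_indicator[of "{0..}" lborel "\<lambda>x. (U (-x))\<^sup>2"] assms
    by simp_all
qed

text \<open>Two applications of the lemma of du Bois-Reymond make the eigenfunction continuously
  differentiable. On each half-line the potential is continuous, so there it is a classical solution; the left
  half is reflected, which is the reason for the sign in \<open>g' 0 = - f' 0\<close>.\<close>

lemma line_eigenfunction_halves:
  assumes V: "continuous_on UNIV V\<^sub>0" and even: "\<And>x. V\<^sub>0 (- x) = V\<^sub>0 x"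
    and ev: "line_eigenvalue (dislocation_potential V\<^sub>0 t) E"
  obtains f f' g g' where "solves_on {0..} (\<lambda>x. V\<^sub>0 (x + t) - E) f f'" "solves_on {0..} (\<lambda>x. V\<^sub>0 x - E) g g'"
    "g 0 = f 0" "g' 0 = - f' 0" "f 0 \<noteq> 0 \<or> f' 0 \<noteq> 0"
    "L2_halfline f" "L2_halfline f'" "L2_halfline g" "L2_halfline g'"
proof -
  define W where "W = dislocation_potential V\<^sub>0 t"
  obtain u u1 u2 where nz: "\<not> (AE x in lborel. u x = 0)" and w1: "weak_deriv_L2 u u1" and w2: "weak_deriv_L2 u1 u2"
    and eq: "AE x in lborel. of_real E * u x = - u2 x + of_real (W x) * u x"
    using ev unfolding line_eigenvalue_def schroedinger_op_def W_def by blast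
  have part: "\<exists>P. complex_part P \<and> \<not> (AE x in lborel. P (u x) = 0)"
  proof (rule ccontr)
    assume no: "\<not> ?thesis"
    have "complex_part Re" "complex_part Im"
      by (rule complex_part.intro, rule bounded_linear_Re, rule abs_Re_le_cmod,
          rule complex_part.intro, rule bounded_linear_Im, rule abs_Im_le_cmod)
    then have "AE x in lborel. Re (u x) = 0" "AE x in lborel. Im (u x) = 0" using no by blast+
    then have "AE x in lborel. u x = 0" by eventually_elim (simp add: complex_eq_iff)
    then show False using nz by simp
  qed
  then obtain P where "complex_part P" and Pnz: "\<not> (AE x in lborel. P (u x) = 0)" by blast
  then interpret complex_part P by simp
  have L2: "u \<in> L2" "u1 \<in> L2" "u2 \<in> L2" using w1 w2 by (auto simp: weak_deriv_L2_def)
  obtain U where U: "continuous_on UNIV U" "AE x in lborel. P (u x) = U x"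
    "\<And>a b. a \<le> b \<Longrightarrow> U b - U a = (LINT x|lborel. indicator {a..b} x * P (u1 x))"
    using weakly_differentiable_imp_primitive[OF P_locally_integrable[OF L2(1)] P_locally_integrable[OF L2(2)] P_weak_deriv[OF w1]] by metis
  obtain U1 where U1: "continuous_on UNIV U1" "AE x in lborel. P (u1 x) = U1 x"
    "\<And>a b. a \<le> b \<Longrightarrow> U1 b - U1 a = (LINT x|lborel. indicator {a..b} x * P (u2 x))"
    using weakly_differentiable_imp_primitive[OF P_locally_integrable[OF L2(2)] P_locally_integrable[OF L2(3)] P_weak_deriv[OF w2]] by metis
  have [measurable]: "U \<in> borel_measurable borel" "U1 \<in> borel_measurable borel" "V\<^sub>0 \<in> borel_measurable borel"
    using U(1) U1(1) V by (auto intro: borel_measurable_continuous_onI)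
  have [measurable]: "(\<lambda>x. P (u1 x)) \<in> borel_measurable borel" "(\<lambda>x. P (u2 x)) \<in> borel_measurable borel"
    using P_locally_integrable[OF L2(2)] P_locally_integrable[OF L2(3)] by (auto simp: locally_integrable_def)
  have lin: "P (r *\<^sub>R z) = r * P z" "P (a - b) = P a - P b" for r z a b
    using linear_scale[OF bounded_linear.linear[OF P_linear]] linear_diff[OF bounded_linear.linear[OF P_linear]] by auto
  have eqP: "AE x in lborel. P (u2 x) = (W x - E) * U x"
    using eq U(2)
  proof eventually_elim
    case (elim x)
    have "u2 x = W x *\<^sub>R u x - E *\<^sub>R u x" using elim(1) by (simp add: scaleR_conv_of_real)
    then have "P (u2 x) = W x * P (u x) - E * P (u x)" by (simp add: lin)
    then show ?case using elim(2) by (simp add: algebra_simps)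
  qed
  have dU: "U b - U a = (LINT x|lborel. indicator {a..b} x * U1 x)" if "a \<le> b" for a b
    unfolding U(3)[OF that] by (rule integral_cong_AE) (measurable, use U1(2) in eventually_elim, simp)
  have dU1R: "U1 b - U1 0 = (LINT x|lborel. indicator {0..b} x * ((V\<^sub>0 (x + t) - E) * U x))" if "0 \<le> b" for b
    unfolding U1(3)[OF that] 
    by (rule integral_cong_AE) (measurable, use eqP in eventually_elim, auto simp: W_def dislocation_potential_def indicator_def)
  have dU1L: "U1 b - U1 a = (LINT x|lborel. indicator {a..b} x * ((V\<^sub>0 x - E) * U x))" if "a \<le> b" "b \<le> 0" for a b
    unfolding U1(3)[OF that(1)]
  proof (rule integral_cong_AE)
    show "AE x in lborel. indicator {a..b} x * P (u2 x) = indicator {a..b} x * ((V\<^sub>0 x - E) * U x)"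
      using eqP AE_lborel_singleton[of 0]
      by eventually_elim (use that in \<open>auto simp: W_def dislocation_potential_def indicator_def\<close>)
  qed measurable
  have SR: "solves_on {0..} (\<lambda>x. V\<^sub>0 (x + t) - E) U U1"
  proof (rule solves_on_halfline)
    fix L :: real assume "L > 0"
    show "solves_on {0..L} (\<lambda>x. V\<^sub>0 (x + t) - E) U U1"
      unfolding solves_on_def
    proof (intro ballI conjI)
      fix x assume x: "x \<in> {0..L}"
      show "(U has_real_derivative U1 x) (at x within {0..L})"
        by (rule deriv_from_increments[OF x continuous_on_subset[OF U1(1)]]) (use dU in auto)
      show "(U1 has_real_derivative (V\<^sub>0 (x + t) - E) * U x) (at x within {0..L})"
        by (rule deriv_from_increments[OF x, of "\<lambda>x. (V\<^sub>0 (x + t) - E) * U x"]) 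
           (use dU1R in \<open>auto intro!: continuous_intros continuous_on_compose2[OF V] continuous_on_subset[OF U(1)]\<close>)
    qed
  qed
  have SL: "solves_on {-L..0} (\<lambda>x. V\<^sub>0 x - E) U U1" if "L > 0" for L
    unfolding solves_on_def
  proof (intro ballI conjI)
    fix x assume x: "x \<in> {-L..0}"
    show "(U has_real_derivative U1 x) (at x within {-L..0})"
      by (rule deriv_from_increments[OF x continuous_on_subset[OF U1(1)]]) (use dU in auto)
    show "(U1 has_real_derivative (V\<^sub>0 x - E) * U x) (at x within {-L..0})"
      by (rule deriv_from_increments[OF x, of "\<lambda>x. (V\<^sub>0 x - E) * U x"]) 
         (use dU1L in \<open>auto intro!: continuous_intros continuous_on_compose2[OF V] continuous_on_subset[OF U(1)]\<close>)
  qed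
  have SL': "solves_on {0..} (\<lambda>x. V\<^sub>0 x - E) (\<lambda>x. U (- x)) (\<lambda>x. - U1 (- x))"
    by (rule solves_on_halfline) (use solves_on_neg[OF SL] in \<open>simp add: even\<close>)
  have sq: "integrable lborel (\<lambda>x. (U x)\<^sup>2)"
    by (rule integrable_cong_AE_imp[OF P_square_integrable[OF L2(1)]]) (measurable, use U(2) in eventually_elim, simp)
  have sq1: "integrable lborel (\<lambda>x. (U1 x)\<^sup>2)"
    by (rule integrable_cong_AE_imp[OF P_square_integrable[OF L2(2)]]) (measurable, use U1(2) in eventually_elim, simp)
  have init: "U 0 \<noteq> 0 \<or> U1 0 \<noteq> 0"
  proof (rule ccontr)
    assume "\<not> ?thesis"
    then have z: "U 0 = 0" "U1 0 = 0" by auto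
    have zero: "solves_on I q (\<lambda>x. 0) (\<lambda>x. 0)" for I q by (simp add: solves_on_def)
    have "U x = 0" for x
    proof (cases "x \<ge> 0")
      case True
      show ?thesis
        by (rule ivp_unique(1)[OF solves_on_subset[OF SR] zero, of x])
           (use True z in \<open>auto intro!: continuous_intros continuous_on_compose2[OF V]\<close>)
    next
      case False
      have "U (- (- x)) = 0"
        by (rule ivp_unique(1)[OF solves_on_subset[OF SL'] zero, of "-x"])
           (use False z in \<open>auto intro!: continuous_intros continuous_on_compose2[OF V]\<close>)
      then show ?thesis by simp
    qed
    then have "AE x in lborel. P (u x) = 0" using U(2) by simp
    then show False using Pnz by simp
  qed
  show thesis
  proof (rule that[OF SR SL'])
    show "L2_halfline (\<lambda>x. - U1 (- x))" using L2_halflineI(2)[OF sq1] by (simp add: L2_halfline_def)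
  qed (use init L2_halflineI[OF sq] L2_halflineI[OF sq1] in auto)
qed

text \<open>The Wronskian is constant and, as a sum of products of square integrable functions, integrable on
  a half-line; so it is zero. This determines a square integrable solution up to a factor without any analysis
  of its growth.\<close>

lemma L2_wronskian_zero:
  assumes u: "solves_on {0..} q u v" and f: "solves_on {0..} q f g"
    and L: "L2_halfline u" "L2_halfline v" "L2_halfline f" "L2_halfline g"
  shows "v 0 * f 0 = u 0 * g 0"
proof -
  define w where "w = v 0 * f 0 - u 0 * g 0"
  have const: "v x * f x - u x * g x = w" if "x \<ge> 0" for x
    unfolding w_def by (rule wronskian_constant[OF u f]) (use that in auto)
  have prod: "integrable lborel (\<lambda>x. indicator {0..} x * (a x * b x))"
    if "L2_halfline a" "L2_halfline b" "continuous_on {0..} a" "continuous_on {0..} b" for a b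
  proof (rule Bochner_Integration.integrable_bound)
    show "integrable lborel (\<lambda>x. indicator {0..} x * (a x)\<^sup>2 + indicator {0..} x * (b x)\<^sup>2)"
      using that by (simp add: L2_halfline_def)
    have "(\<lambda>x. indicator {0..} x *\<^sub>R (a x * b x)) \<in> borel_measurable borel"
      by (rule borel_measurable_continuous_on_indicator) (use that in \<open>auto intro!: continuous_intros\<close>)
    then show "(\<lambda>x. indicator {0..} x * (a x * b x)) \<in> borel_measurable lborel" by simp
    have "\<bar>a x * b x\<bar> \<le> (a x)\<^sup>2 + (b x)\<^sup>2" for x
    proof -
      have "2 * (\<bar>a x\<bar> * \<bar>b x\<bar>) \<le> (a x)\<^sup>2 + (b x)\<^sup>2"
        using sum_squares_bound[of "\<bar>a x\<bar>" "\<bar>b x\<bar>"] by (simp add: mult.assoc)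
      moreover have "0 \<le> \<bar>a x\<bar> * \<bar>b x\<bar>" by simp
      ultimately show ?thesis unfolding abs_mult by linarith
    qed
    then show "AE x in lborel. norm (indicator {0..} x * (a x * b x)) \<le> norm (indicator {0..} x * (a x)\<^sup>2 + indicator {0..} x * (b x)\<^sup>2)"
      by (intro AE_I2) (auto simp: indicator_def)
  qed
  note c = solves_on_continuous[OF u] solves_on_continuous[OF f]
  have "integrable lborel (\<lambda>x. indicator {0..} x * (v x * f x) - indicator {0..} x * (u x * g x))"
    by (intro Bochner_Integration.integrable_diff prod L c)
  moreover have "(\<lambda>x. indicator {0..} x * (v x * f x) - indicator {0..} x * (u x * g x)) = (\<lambda>x. indicator {0..} x * w)"
    using const by (auto simp: indicator_def fun_eq_iff)
  ultimately have I: "integrable lborel (\<lambda>x::real. indicator {0..} x * w)" by simp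
  have "w = 0"
  proof (rule ccontr)
    assume "w \<noteq> 0"
    then have "integrable lborel (\<lambda>x::real. indicator {0..} x :: real)" using I by simp
    then have fin: "emeasure lborel {0::real..} < \<infinity>" by (simp add: integrable_indicator_iff)
    have "emeasure lborel {0..real n} \<le> emeasure lborel {0::real..}" for n by (rule emeasure_mono) auto
    then have le: "ennreal (real n) \<le> emeasure lborel {0::real..}" for n by simp
    obtain r where r: "emeasure lborel {0::real..} = ennreal r" "r \<ge> 0" using fin by (cases "emeasure lborel {0::real..}") auto
    obtain n :: nat where "r < real n" using reals_Archimedean2 by blast
    then show False using le[of n] r by simp
  qed
  then show ?thesis by (simp add: w_def)
qed

section \<open>Matched half-line solutions are line eigenfunctions\<close>

text \<open>Integration by parts. The point \<open>0\<close> is exempt because \<open>u'\<close> has a kink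
  where the potential jumps.\<close>

lemma weak_deriv_of_classical:
  assumes c: "continuous_on UNIV U" and m: "U1 \<in> borel_measurable borel"
    and D: "\<And>x. x \<noteq> 0 \<Longrightarrow> (U has_real_derivative U1 x) (at x)"
    and L: "integrable lborel (\<lambda>x. (U x)\<^sup>2)" "integrable lborel (\<lambda>x. (U1 x)\<^sup>2)"
  shows "weak_deriv_L2 (\<lambda>x. of_real (U x)) (\<lambda>x. of_real (U1 x))"
  unfolding weak_deriv_L2_def
proof (intro conjI allI impI)
  have [measurable]: "U \<in> borel_measurable borel" "U1 \<in> borel_measurable borel"
    using c m by (auto intro: borel_measurable_continuous_onI)
  show L2: "(\<lambda>x. complex_of_real (U x)) \<in> L2" "(\<lambda>x. complex_of_real (U1 x)) \<in> L2"
    using L by (auto simp: L2_def)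
  have loc: "locally_integrable U" "locally_integrable U1"
  proof -
    have abs: "locally_integrable (\<lambda>x. \<bar>U x\<bar>)" "locally_integrable (\<lambda>x. \<bar>U1 x\<bar>)"
      using L2[THEN L2_norm_locally_integrable] by simp_all
    have "locally_integrable w"
      if [measurable]: "w \<in> borel_measurable borel" and w: "locally_integrable (\<lambda>x. \<bar>w x\<bar>)" for w
      unfolding locally_integrable_def
    proof (intro conjI allI that(1))
      fix a b show "integrable lborel (\<lambda>x. indicator {a..b} x * w x)"
        by (rule Bochner_Integration.integrable_bound[OF locally_integrable_Icc[OF w, of a b]])
           (measurable, simp add: abs_mult)
    qed
    from this[OF _ abs(1)] this[OF _ abs(2)] show "locally_integrable U" "locally_integrable U1" by simp_all
  qed
  fix \<phi> assume \<phi>: "test_function \<phi>"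
  obtain R where R: "R > 0" "\<And>x. R \<le> \<bar>x\<bar> \<Longrightarrow> \<phi> x = 0" "\<And>x. R \<le> \<bar>x\<bar> \<Longrightarrow> deriv \<phi> x = 0"
    "\<And>x. (\<phi> has_real_derivative deriv \<phi> x) (at x)" "continuous_on UNIV \<phi>"
    using test_functionE[OF \<phi>] by metis
  note I = test_function_mult_integrable(2)[OF loc(1) \<phi>] test_function_mult_integrable(1)[OF loc(2) \<phi>]
  have "((\<lambda>x. deriv \<phi> x * U x + \<phi> x * U1 x) has_integral (\<phi> R * U R - \<phi> (-R) * U (-R))) {-R..R}"
  proof (rule fundamental_theorem_of_calculus_interior_strong[of "{0}"])
    fix x assume "x \<in> {-R<..<R} - {0}"
    then have "((\<lambda>x. \<phi> x * U x) has_real_derivative deriv \<phi> x * U x + U1 x * \<phi> x) (at x)"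
      by (intro DERIV_mult R(4) D) auto
    then show "((\<lambda>x. \<phi> x * U x) has_vector_derivative (deriv \<phi> x * U x + \<phi> x * U1 x)) (at x)"
      by (simp add: has_real_derivative_iff_has_vector_derivative mult.commute)
  qed (use R(1) in \<open>auto intro!: continuous_intros continuous_on_subset[OF c] continuous_on_subset[OF R(5)]\<close>)
  then have "((\<lambda>x. deriv \<phi> x * U x + \<phi> x * U1 x) has_integral 0) {-R..R}"
    using R(1) R(2)[of R] R(2)[of "-R"] by simp
  then have "((\<lambda>x. deriv \<phi> x * U x + \<phi> x * U1 x) has_integral 0) UNIV"
    by (rule has_integral_on_superset) (use R(2,3) in \<open>auto simp: abs_le_iff not_le abs_if\<close>)
  moreover have "((\<lambda>x. deriv \<phi> x * U x + \<phi> x * U1 x) has_integral (LINT x|lborel. deriv \<phi> x * U x + \<phi> x * U1 x)) UNIV"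
    by (rule has_integral_integral_lborel) (use I in simp)
  ultimately have "(LINT x|lborel. deriv \<phi> x * U x + \<phi> x * U1 x) = 0" by (metis has_integral_unique)
  then have "(LINT x|lborel. deriv \<phi> x * U x) = - (LINT x|lborel. \<phi> x * U1 x)" using I by simp
  then have "complex_of_real (LINT x|lborel. deriv \<phi> x * U x) = complex_of_real (- (LINT x|lborel. \<phi> x * U1 x))"
    by (simp only:)
  then show "(LINT x|lborel. deriv \<phi> x *\<^sub>R complex_of_real (U x)) = - (LINT x|lborel. \<phi> x *\<^sub>R complex_of_real (U1 x))"
    by (simp add: scaleR_conv_of_real integral_complex_of_real[symmetric])
qed

text \<open>The left half is given as a function of \<open>- x\<close>.\<close>

definition glue :: "(real \<Rightarrow> real) \<Rightarrow> (real \<Rightarrow> real) \<Rightarrow> real \<Rightarrow> real" where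
  "glue l r x = (if x \<le> 0 then l (- x) else r x)"

lemma glue_continuous:
  assumes "continuous_on {0..} l" "continuous_on {0..} r" "l 0 = r 0"
  shows "continuous_on UNIV (glue l r)"
  unfolding glue_def
  by (rule continuous_on_cases_le)
     (use assms in \<open>auto intro!: continuous_intros continuous_on_compose2[OF assms(1)] continuous_on_subset[OF assms(2)]\<close>)

lemma glue_square_integrable:
  assumes "L2_halfline l" "L2_halfline r" shows "integrable lborel (\<lambda>x. (glue l r x)\<^sup>2)"
proof -
  have "integrable lborel (\<lambda>x. indicator {0..} (- x) * (l (- x))\<^sup>2)"
    using lborel_integrable_real_affine[of "\<lambda>x. indicator {0..} x * (l x)\<^sup>2" "-1" 0] assms(1) 
    by (simp add: L2_halfline_def)
  then have "integrable lborel (\<lambda>x. indicator {..0} x * (l (- x))\<^sup>2)"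
    by (rule back_subst[of "integrable lborel"]) (auto simp: indicator_def)
  moreover have "integrable lborel (\<lambda>x. indicator {0<..} x *\<^sub>R (indicator {0..} x * (r x)\<^sup>2))"
    by (rule integrable_mult_indicator) (use assms(2) in \<open>auto simp: L2_halfline_def\<close>)
  ultimately have "integrable lborel (\<lambda>x. indicator {..0} x * (l (- x))\<^sup>2 + indicator {0<..} x *\<^sub>R (indicator {0..} x * (r x)\<^sup>2))"
    by (rule Bochner_Integration.integrable_add)
  then show ?thesis
    by (rule back_subst[of "integrable lborel"]) (auto simp: indicator_def glue_def fun_eq_iff)
qed

lemma glue_derivative:
  assumes L: "\<And>x. x \<ge> 0 \<Longrightarrow> (l has_real_derivative l' x) (at x within {0..})"
    and R: "\<And>x. x \<ge> 0 \<Longrightarrow> (r has_real_derivative r' x) (at x within {0..})" and x: "x \<noteq> 0"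
  shows "(glue l r has_real_derivative glue (\<lambda>x. - l' x) r' x) (at x)"
proof (cases "x < 0")
  case True
  have "at (-x) within {0..} = at (-x)" using True by (intro at_within_interior) auto
  then have "(l has_real_derivative l' (- x)) (at (- x))" using L[of "-x"] True by simp
  then have "((\<lambda>y. l (- y)) has_real_derivative - l' (- x)) (at x)"
    using DERIV_mirror[of l "l' (-x)" x] by simp
  then have "(glue l r has_real_derivative - l' (- x)) (at x)"
    by (rule has_field_derivative_transform_within_open[where S = "{..<0}"]) (use True in \<open>auto simp: glue_def\<close>)
  then show ?thesis using True by (simp add: glue_def)
next
  case False
  then have x: "x > 0" using x by simp
  have "at x within {0..} = at x" using x by (intro at_within_interior) auto
  then have "(r has_real_derivative r' x) (at x)" using R[of x] x by simp
  then have "(glue l r has_real_derivative r' x) (at x)"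
    by (rule has_field_derivative_transform_within_open[where S = "{0<..}"]) (use x in \<open>auto simp: glue_def\<close>)
  then show ?thesis using x by (simp add: glue_def)
qed

text \<open>The matching conditions make the glued function continuously differentiable, and boundedness of
  \<open>V\<^sub>0\<close> makes its second derivative square integrable.\<close>

lemma matched_halves_eigenvalue:
  assumes V: "continuous_on UNIV V\<^sub>0" and even: "\<And>x. V\<^sub>0 (- x) = V\<^sub>0 x" and K: "\<And>x. \<bar>V\<^sub>0 x\<bar> \<le> K"
    and f: "solves_on {0..} (\<lambda>x. V\<^sub>0 (x + t) - E) f f'" and g: "solves_on {0..} (\<lambda>x. V\<^sub>0 x - E) g g'"
    and match: "g 0 = f 0" "g' 0 = - f' 0" and nz: "f 0 \<noteq> 0 \<or> f' 0 \<noteq> 0"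
    and L: "L2_halfline f" "L2_halfline f'" "L2_halfline g" "L2_halfline g'"
  shows "line_eigenvalue (dislocation_potential V\<^sub>0 t) E"
proof -
  define W where "W = dislocation_potential V\<^sub>0 t"
  define U where "U = glue g f"
  define U1 where "U1 = glue (\<lambda>x. - g' x) f'"
  define U2 where "U2 x = (W x - E) * U x" for x
  have c: "continuous_on UNIV U" "continuous_on UNIV U1"
    unfolding U_def U1_def using match
    by (auto intro!: glue_continuous continuous_intros solves_on_continuous[OF f] solves_on_continuous[OF g])
  have [measurable]: "U \<in> borel_measurable borel" "U1 \<in> borel_measurable borel" "V\<^sub>0 \<in> borel_measurable borel"
    using c V by (auto intro: borel_measurable_continuous_onI)
  have Wm [measurable]: "W \<in> borel_measurable borel"
    unfolding W_def dislocation_potential_def by measurable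
  have U2m: "U2 \<in> borel_measurable borel" unfolding U2_def by measurable
  have D: "(U has_real_derivative U1 x) (at x)" if "x \<noteq> 0" for x
    unfolding U_def U1_def by (rule glue_derivative[OF _ _ that]) (use solves_onD(1)[OF f] solves_onD(1)[OF g] in auto)
  have D1: "(U1 has_real_derivative U2 x) (at x)" if x: "x \<noteq> 0" for x
  proof -
    have "(U1 has_real_derivative glue (\<lambda>x. - (- ((V\<^sub>0 x - E) * g x))) (\<lambda>x. (V\<^sub>0 (x + t) - E) * f x) x) (at x)"
      unfolding U1_def
      by (rule glue_derivative[OF _ _ x]) (use solves_onD(2)[OF f] solves_onD(2)[OF g] in \<open>auto intro!: DERIV_minus\<close>)
    moreover have "glue (\<lambda>x. - (- ((V\<^sub>0 x - E) * g x))) (\<lambda>x. (V\<^sub>0 (x + t) - E) * f x) x = U2 x"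
      using x by (auto simp: glue_def U2_def U_def W_def dislocation_potential_def even)
    ultimately show ?thesis by simp
  qed
  have "L2_halfline (\<lambda>x. - g' x)" using L(4) by (simp add: L2_halfline_def)
  then have sq: "integrable lborel (\<lambda>x. (U x)\<^sup>2)" "integrable lborel (\<lambda>x. (U1 x)\<^sup>2)"
    unfolding U_def U1_def by (intro glue_square_integrable L)+
  have sq2: "integrable lborel (\<lambda>x. (U2 x)\<^sup>2)"
  proof (rule Bochner_Integration.integrable_bound)
    show "integrable lborel (\<lambda>x. (K + \<bar>E\<bar>)\<^sup>2 * (U x)\<^sup>2)" using sq(1) by simp
    show "(\<lambda>x. (U2 x)\<^sup>2) \<in> borel_measurable lborel" using U2m by measurable
    have "\<bar>W x - E\<bar> \<le> K + \<bar>E\<bar>" for x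
      using K[of x] K[of "x+t"] by (auto simp: W_def dislocation_potential_def)
    then have "(W x - E)\<^sup>2 \<le> (K + \<bar>E\<bar>)\<^sup>2" for x by (metis abs_ge_zero power2_abs power_mono)
    then show "AE x in lborel. norm ((U2 x)\<^sup>2) \<le> norm ((K + \<bar>E\<bar>)\<^sup>2 * (U x)\<^sup>2)"
      by (intro AE_I2) (simp add: U2_def power_mult_distrib mult_right_mono)
  qed
  have w1: "weak_deriv_L2 (\<lambda>x. of_real (U x)) (\<lambda>x. of_real (U1 x))"
    by (rule weak_deriv_of_classical[OF c(1) _ D sq]) measurable
  have w2: "weak_deriv_L2 (\<lambda>x. of_real (U1 x)) (\<lambda>x. of_real (U2 x))"
    by (rule weak_deriv_of_classical[OF c(2) U2m D1 sq(2) sq2])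
  have nonzero: "\<not> (AE x in lborel. complex_of_real (U x) = 0)"
  proof
    assume "AE x in lborel. complex_of_real (U x) = 0"
    then have ae: "AE x in lborel. x \<in> UNIV \<longrightarrow> U x = 0" by eventually_elim simp
    have all: "U x = 0" for x
    proof (rule ccontr)
      assume "U x \<noteq> 0"
      have op: "open {y. U y \<noteq> 0}" by (intro open_Collect_neq c continuous_intros)
      have "{y. U y \<noteq> 0} \<in> null_sets lborel" 
        using ae AE_iff_null_sets[of "{y. U y \<noteq> 0}" lborel] op by auto
      then have "emeasure lborel {y. U y \<noteq> 0} = 0" by auto
      moreover obtain e where e: "e > 0" "ball x e \<subseteq> {y. U y \<noteq> 0}"
        using open_contains_ball[of "{y. U y \<noteq> 0}"] op \<open>U x \<noteq> 0\<close> by blast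
      moreover have "{x - e/2..x + e/2} \<subseteq> ball x e" using e by (auto simp: dist_real_def)
      then have "emeasure lborel {x - e/2..x + e/2} \<le> emeasure lborel {y. U y \<noteq> 0}"
        using e op by (intro emeasure_mono) auto
      ultimately show False using e by simp
    qed
    have f0: "f x = 0" if "x \<ge> 0" for x
      using all[of x] match all[of 0] that by (cases "x = 0") (auto simp: U_def glue_def)
    have "at (1::real) within {0..} = at 1" by (intro at_within_interior) auto
    then have "(f has_real_derivative f' 1) (at 1)" using solves_onD(1)[OF f, of 1] by simp
    moreover have "(f has_real_derivative 0) (at 1)"
      by (rule has_field_derivative_transform_within_open[where f = "\<lambda>_. 0" and S = "{0<..}"]) (use f0 in auto)
    ultimately have f1: "f' 1 = 0" by (rule DERIV_unique)
    have zero: "solves_on I q (\<lambda>x. 0) (\<lambda>x. 0)" for I q by (simp add: solves_on_def)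
    interpret cp: continuous_potential "\<lambda>x. V\<^sub>0 (x + t)"
      by unfold_locales (auto intro!: continuous_intros continuous_on_compose2[OF V])
    have fI: "solves_on {0..1} (\<lambda>x. V\<^sub>0 (x + t) - E) f f'" by (rule solves_on_subset[OF f]) auto
    have "f' 0 = 0"
    proof -
      have rep: "f 1 = f 0 * cs (\<lambda>x. V\<^sub>0 (x + t)) E 1 + f' 0 * sn (\<lambda>x. V\<^sub>0 (x + t)) E 1"
        "f' 1 = f 0 * cs' (\<lambda>x. V\<^sub>0 (x + t)) E 1 + f' 0 * sn' (\<lambda>x. V\<^sub>0 (x + t)) E 1"
        by (rule cp.solution_representation[OF fI]; simp)+
      then have "f' 0 * sn (\<lambda>x. V\<^sub>0 (x + t)) E 1 = 0" "f' 0 * sn' (\<lambda>x. V\<^sub>0 (x + t)) E 1 = 0"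
        using f0[of 0] f0[of 1] f1 by simp_all
      then show ?thesis using cp.cs_sn_wronskian[of 1 E] by auto
    qed
    then show False using nz f0[of 0] by simp
  qed
  have "schroedinger_op W (\<lambda>x. of_real (U x)) (\<lambda>x. of_real E * of_real (U x))"
    unfolding schroedinger_op_def H2_def
  proof (intro conjI exI CollectI)
    show "AE x in lborel. complex_of_real E * complex_of_real (U x) = - complex_of_real (U2 x) + complex_of_real (W x) * complex_of_real (U x)"
      by (intro AE_I2) (simp add: U2_def algebra_simps)
  qed (rule w1 w2)+
  then show ?thesis unfolding line_eigenvalue_def W_def
    by (intro exI[of _ "\<lambda>x. of_real (U x)"] conjI nonzero)
qed

section \<open>The decaying solution and its angle\<close>

lemma exp_decay_integrable:
  assumes "k > 0" shows "integrable lborel (\<lambda>x. indicator {0..} x * exp (- k * x) :: real)"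
proof -
  have "LIM x at_top. k * x :> at_top"
    by (rule filterlim_tendsto_pos_mult_at_top[OF tendsto_const assms filterlim_ident])
  then have "LIM x at_top. - k * x :> at_bot" by (simp add: filterlim_uminus_at_top)
  from filterlim_compose[OF exp_at_bot this]
  have "((\<lambda>x. - exp (- k * x) / k) \<longlongrightarrow> - 0 / k) at_top"
    by (intro tendsto_divide tendsto_minus tendsto_const) (use assms in auto)
  then have lim: "((\<lambda>x. - exp (- k * x) / k) \<longlongrightarrow> 0) at_top" by simp
  have "(\<integral>\<^sup>+x. ennreal (exp (- k * x)) * indicator {0..} x \<partial>lborel) = ennreal (0 - (- exp (- k * 0) / k))"
    by (rule nn_integral_FTC_atLeast[OF _ _ _ lim])
       (use assms in \<open>auto intro!: derivative_eq_intros\<close>)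
  moreover have "(\<integral>\<^sup>+x. ennreal (exp (- k * x)) * indicator {0..} x \<partial>lborel) 
     = (\<integral>\<^sup>+x. ennreal (indicator {0..} x * exp (- k * x)) \<partial>lborel)"
    by (intro nn_integral_cong) (auto simp: indicator_def)
  ultimately have "(\<integral>\<^sup>+x. ennreal (indicator {0..} x * exp (- k * x)) \<partial>lborel) = ennreal (0 - (- exp (- k * 0) / k))"
    by (simp only:)
  then have "(\<integral>\<^sup>+x. ennreal (indicator {0..} x * exp (- k * x)) \<partial>lborel) < \<infinity>"
    by (simp only: ennreal_less_top infinity_ennreal_def)
  then show ?thesis by (intro integrableI_nonneg) (auto simp: indicator_def)
qed

lemma geometric_iterate_bound:
  fixes f :: "real \<Rightarrow> real"
  assumes step: "\<And>x. x \<ge> 0 \<Longrightarrow> \<bar>f (x + d)\<bar> \<le> r * \<bar>f x\<bar>" and M: "\<And>x. x \<in> {0..d} \<Longrightarrow> \<bar>f x\<bar> \<le> M"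
    and r: "r \<ge> 0" and d: "d > 0" and x: "x \<in> {0..d}"
  shows "\<bar>f (x + real n * d)\<bar> \<le> r ^ n * M"
proof (induction n)
  case 0 then show ?case using M[OF x] by simp
next
  case (Suc n)
  have eq: "x + real (Suc n) * d = (x + real n * d) + d" by (simp add: algebra_simps)
  have "\<bar>f (x + real (Suc n) * d)\<bar> \<le> r * \<bar>f (x + real n * d)\<bar>"
    unfolding eq by (rule step) (use x d in simp)
  also have "\<dots> \<le> r * (r ^ n * M)" by (rule mult_left_mono[OF Suc.IH r])
  finally show ?case by (simp add: mult_ac)
qed

lemma cell_decomposition:
  assumes "d > 0" "x \<ge> (0::real)"
  obtains y n where "y \<in> {0..d}" "x = y + real n * d"
proof -
  define n where "n = nat \<lfloor>x / d\<rfloor>"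
  have n: "real n = of_int \<lfloor>x / d\<rfloor>" using assms by (simp add: n_def)
  have "real n * d \<le> x" using assms unfolding n by (simp add: pos_le_divide_eq[symmetric])
  moreover have "x / d < real n + 1" unfolding n by linarith
  then have "x < (real n + 1) * d" using assms by (simp add: pos_divide_less_eq)
  ultimately show thesis by (intro that[of "x - real n * d" n]) (auto simp: algebra_simps)
qed

text \<open>A contraction from cell to cell gives exponential decay. The factor is raised to at least
  \<open>1/2\<close>, so that its logarithm is finite also for \<open>r0 \<le> 0\<close>.\<close>

lemma L2_halfline_geometric:
  assumes c: "continuous_on {0..} f" and step: "\<And>x. x \<ge> 0 \<Longrightarrow> \<bar>f (x + d)\<bar> \<le> r0 * \<bar>f x\<bar>"
    and r0: "r0 < 1" and d: "d > 0"
  shows "L2_halfline f"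
proof -
  define r where "r = max r0 (1/2)"
  have r: "0 < r" "r < 1" using r0 by (auto simp: r_def)
  have step': "\<bar>f (x + d)\<bar> \<le> r * \<bar>f x\<bar>" if "x \<ge> 0" for x
    using step[OF that] mult_right_mono[of r0 r "\<bar>f x\<bar>"] by (simp add: r_def)
  have "continuous_on {0..d} f" by (rule continuous_on_subset[OF c]) auto
  from continuous_on_Icc_bounded[OF this]
  obtain M where M: "\<And>x. x \<in> {0..d} \<Longrightarrow> \<bar>f x\<bar> \<le> M" by blast
  have M0: "M \<ge> 0" using M[of 0] d by auto
  define k where "k = - ln r / d"
  have k: "k > 0" using r d by (simp add: k_def divide_neg_pos)
  have er: "exp (- k * d) = r" using r d by (simp add: k_def)
  have bound: "\<bar>f x\<bar> \<le> M * exp (k * d) * exp (- k * x)" if x0: "x \<ge> 0" for x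
  proof -
    obtain y n where y: "y \<in> {0..d}" "x = y + real n * d" using cell_decomposition[OF d x0] by metis
    have "\<bar>f x\<bar> \<le> r ^ n * M" unfolding y(2) by (rule geometric_iterate_bound[where f = f, OF step' M]) (use r d y in auto)
    also have "r ^ n = exp (- k * (real n * d))" unfolding er[symmetric] by (simp add: exp_of_nat_mult[symmetric] mult_ac)
    also have "\<dots> = exp (k * y) * exp (- k * x)" unfolding y(2) by (simp add: exp_add[symmetric] algebra_simps)
    also have "\<dots> * M \<le> (exp (k * d) * exp (- k * x)) * M"
      using y k M0 by (intro mult_right_mono) auto
    finally show ?thesis by (simp add: mult_ac)
  qed
  show ?thesis
    unfolding L2_halfline_def
  proof (rule Bochner_Integration.integrable_bound)
    show "integrable lborel (\<lambda>x. (M * exp (k * d))\<^sup>2 * (indicator {0..} x * exp (- (2 * k) * x)))"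
      using exp_decay_integrable[of "2 * k"] k by simp
    have "(\<lambda>x. indicator {0..} x *\<^sub>R (f x)\<^sup>2) \<in> borel_measurable borel"
      by (rule borel_measurable_continuous_on_indicator) (use c in \<open>auto intro!: continuous_intros\<close>)
    then show "(\<lambda>x. indicator {0..} x * (f x)\<^sup>2) \<in> borel_measurable lborel" by simp
    have "(f x)\<^sup>2 \<le> (M * exp (k * d))\<^sup>2 * exp (- (2 * k) * x)" if "x \<ge> 0" for x
    proof -
      have "(f x)\<^sup>2 \<le> (M * exp (k * d) * exp (- k * x))\<^sup>2"
        using bound[OF that] by (metis abs_ge_zero power2_abs power_mono)
      also have "\<dots> = (M * exp (k * d))\<^sup>2 * exp (- (2 * k) * x)"
        by (simp add: power_mult_distrib exp_double[symmetric] mult_ac)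
      finally show ?thesis .
    qed
    then show "AE x in lborel. norm (indicator {0..} x * (f x)\<^sup>2) \<le> norm ((M * exp (k * d))\<^sup>2 * (indicator {0..} x * exp (- (2 * k) * x)))"
      by (intro AE_I2) (auto simp: indicator_def)
  qed
qed

lemma (in even_periodic_potential) V_bounded:
  obtains K where "\<And>x. \<bar>V x\<bar> \<le> K"
proof -
  obtain K where K: "\<And>x. x \<in> {0..d} \<Longrightarrow> \<bar>V x\<bar> \<le> K" using V_bounded_on[of d] by blast
  have pos: "\<bar>V x\<bar> \<le> K" if x: "x \<ge> 0" for x
  proof -
    obtain y n where y: "y \<in> {0..d}" "x = y + real n * d" using cell_decomposition[OF d_pos x] by metis
    have "\<bar>V x\<bar> \<le> 1 ^ n * K" unfolding y(2) by (rule geometric_iterate_bound[where f = V, OF _ K]) (use V_periodic d_pos y in auto)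
    then show ?thesis by simp
  qed
  have "\<bar>V x\<bar> \<le> K" for x using pos[of x] pos[of "-x"] V_even[of x] by (cases "x \<ge> 0") auto
  then show thesis by (rule that)
qed

text \<open>A continuous function attains its maximum over \<open>[x, y]\<close>, which by the local increase
  can only be at \<open>y\<close>. The end points of \<open>[l, r]\<close> are reached by continuity.\<close>

lemma strict_mono_from_local:
  fixes f :: "real \<Rightarrow> real"
  assumes c: "continuous_on {l..r} f" 
    and loc: "\<And>x. x \<in> {l<..<r} \<Longrightarrow> \<exists>e>0. \<forall>y. x < y \<and> y < x + e \<longrightarrow> f x < f y"
  shows "strict_mono_on {l..r} f"
proof -
  have inner: "f x < f y" if x: "l < x" "x < y" "y \<le> r" for x y
  proof -
    have "\<exists>z\<in>{x..y}. \<forall>w\<in>{x..y}. f w \<le> f z"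
      by (rule continuous_attains_sup) (use x in \<open>auto intro: continuous_on_subset[OF c]\<close>)
    then obtain z where z: "z \<in> {x..y}" "\<And>w. w \<in> {x..y} \<Longrightarrow> f w \<le> f z" by blast
    have "z = y"
    proof (rule ccontr)
      assume "z \<noteq> y"
      then obtain e where e: "e > 0" "\<And>w. z < w \<Longrightarrow> w < z + e \<Longrightarrow> f z < f w" using loc[of z] z x by auto
      define w where "w = z + min (e/2) (y - z)"
      have "z < w" "w < z + e" "w \<le> y" using e z \<open>z \<noteq> y\<close> by (auto simp: w_def min_def)
      then show False using e(2)[of w] z(2)[of w] z(1) by auto
    qed
    obtain e where e: "e > 0" "\<And>w. x < w \<Longrightarrow> w < x + e \<Longrightarrow> f x < f w" using loc[of x] x by auto
    define w where "w = x + min (e/2) (y - x)"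
    have "x < w" "w < x + e" "w \<le> y" using e x by (auto simp: w_def min_def)
    then show ?thesis using e(2)[of w] z(2)[of w] \<open>z = y\<close> by auto
  qed
  have left: "f l < f y" if y: "l < y" "y \<le> r" for y
  proof -
    define m where "m = (l + y) / 2"
    have m: "l < m" "m < y" using y by (auto simp: m_def)
    have "f l \<le> f m"
    proof (rule ccontr)
      assume "\<not> f l \<le> f m"
      then have pos: "f l - f m > 0" by simp
      have "l \<in> {l..r}" using y by simp
      then obtain e where e: "e > 0" "\<And>w. w \<in> {l..r} \<Longrightarrow> dist w l < e \<Longrightarrow> dist (f w) (f l) < f l - f m"
        using c pos unfolding continuous_on_iff by blast
      define w where "w = l + min (e/2) ((m - l)/2)"
      have "w \<le> l + e/2" "w \<le> l + (m - l)/2" "l < w"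
        using min.cobounded1[of "e/2" "(m - l)/2"] min.cobounded2[of "e/2" "(m - l)/2"] e(1) m(1)
        unfolding w_def by (linarith, linarith, auto)
      then have w: "l < w" "w < l + e" "w < m" using e(1) m(1) by argo+
      then have "dist (f w) (f l) < f l - f m" using e(2)[of w] m y by (auto simp: dist_real_def)
      then have "f m < f w" by (auto simp: dist_real_def)
      moreover have "f w < f m" using inner[of w m] w m y by auto
      ultimately show False by simp
    qed
    also have "f m < f y" using inner[of m y] m y by auto
    finally show ?thesis .
  qed
  show ?thesis
  proof (rule strict_mono_onI)
    fix x y assume "x \<in> {l..r}" "y \<in> {l..r}" "x < y"
    then show "f x < f y" using inner[of x y] left[of y] by (cases "x = l") auto
  qed
qed

text \<open>A continuous family of initial values \<open>(p, q)\<close> on the closed interval of energies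
  whose solutions contract by the Floquet multiplier \<open>\<rho>\<close> at interior energies. At the ends
  the multiplier may have modulus one.\<close>

locale decaying_family = even_periodic_potential V d for V d +
  fixes l r :: real and p q \<rho> :: "real \<Rightarrow> real"
  assumes lr: "l < r" and p_cont: "continuous_on {l..r} p" and q_cont': "continuous_on {l..r} q"
    and pq: "E \<in> {l..r} \<Longrightarrow> p E \<noteq> 0 \<or> q E \<noteq> 0"
    and multiplier: "E \<in> {l<..<r} \<Longrightarrow> p E * cs V E d + q E * sn V E d = \<rho> E * p E"
      "E \<in> {l<..<r} \<Longrightarrow> p E * cs' V E d + q E * sn' V E d = \<rho> E * q E"
    and contracting: "E \<in> {l<..<r} \<Longrightarrow> \<bar>\<rho> E\<bar> < 1"
begin

definition phi :: "real \<Rightarrow> real \<Rightarrow> real" where "phi E x = p E * cs V E x + q E * sn V E x"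
definition phi' :: "real \<Rightarrow> real \<Rightarrow> real" where "phi' E x = p E * cs' V E x + q E * sn' V E x"

lemma phi_solves: "solves_on {0..} (\<lambda>x. V x - E) (phi E) (phi' E)"
  using solves_on_lincomb[OF cs_solves sn_solves] by (simp add: phi_def[abs_def] phi'_def[abs_def])

lemma phi_0 [simp]: "phi E 0 = p E" "phi' E 0 = q E" by (simp_all add: phi_def phi'_def)

lemma phi_floquet:
  assumes E: "E \<in> {l<..<r}" and x: "x \<ge> 0"
  shows "phi E (x + d) = \<rho> E * phi E x" "phi' E (x + d) = \<rho> E * phi' E x"
proof -
  have "solves_on {0..} (\<lambda>x. V x - E) (\<lambda>x. phi E (x + d)) (\<lambda>x. phi' E (x + d))"
    using solves_on_shift[OF phi_solves[of E], of d] d_pos by (simp add: V_periodic)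
  then have "solves_on {0..x} (\<lambda>x. V x - E) (\<lambda>x. phi E (x + d)) (\<lambda>x. phi' E (x + d))"
    by (rule solves_on_subset) auto
  note rep = solution_representation[OF this, of x]
  have "phi E d = \<rho> E * p E" "phi' E d = \<rho> E * q E" using multiplier[OF E] by (simp_all add: phi_def phi'_def)
  then show "phi E (x + d) = \<rho> E * phi E x" "phi' E (x + d) = \<rho> E * phi' E x"
    using rep x by (simp_all add: phi_def phi'_def algebra_simps)
qed

lemma phi_L2:
  assumes E: "E \<in> {l<..<r}" shows "L2_halfline (phi E)" "L2_halfline (phi' E)"
  by (rule L2_halfline_geometric[OF _ _ contracting[OF E] d_pos];
      use phi_floquet[OF E] solves_on_continuous[OF phi_solves] in \<open>simp add: abs_mult\<close>)+

lemma phi_nonzero: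
  assumes E: "E \<in> {l..r}" and x: "x \<ge> 0" shows "phi E x \<noteq> 0 \<or> phi' E x \<noteq> 0"
proof (rule ccontr)
  assume "\<not> ?thesis"
  then have z: "p E * cs V E x + q E * sn V E x = 0" "p E * cs' V E x + q E * sn' V E x = 0"
    by (auto simp: phi_def phi'_def)
  have "p E = 0 \<and> q E = 0" using z cs_sn_wronskian[OF x, of E] by algebra
  then show False using pq[OF E] by simp
qed

text \<open>Both halves of an eigenfunction are multiples of the decaying solution, so an eigenfunction exists
  exactly if \<open>(\<phi>(t), \<phi>'(t))\<close> and \<open>(\<phi>(0), - \<phi>'(0))\<close> are
  parallel.\<close>

lemma dislocation_eigenvalue_iff:
  assumes E: "E \<in> {l<..<r}" and t: "t \<ge> 0"
  shows "E \<in> dislocation_eigenvalues V t \<longleftrightarrow> phi E t * q E + phi' E t * p E = 0"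
proof
  have E': "E \<in> {l..r}" using E by auto
  have shift: "solves_on {0..} (\<lambda>x. V (x + t) - E) (\<lambda>x. phi E (x + t)) (\<lambda>x. phi' E (x + t))"
    using solves_on_shift[OF phi_solves[of E] t] by simp
  have floq: "phi E (x + t + d) = \<rho> E * phi E (x + t)" "phi' E (x + t + d) = \<rho> E * phi' E (x + t)" if "x \<ge> 0" for x
    using phi_floquet[OF E, of "x + t"] that t by auto
  have L2t: "L2_halfline (\<lambda>x. phi E (x + t))" "L2_halfline (\<lambda>x. phi' E (x + t))"
    by (rule L2_halfline_geometric[OF _ _ contracting[OF E] d_pos];
        use floq solves_on_continuous[OF shift] in \<open>simp add: abs_mult add.commute add.left_commute add.assoc\<close>)+
  {
    assume "E \<in> dislocation_eigenvalues V t"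
    then have ev: "line_eigenvalue (dislocation_potential V t) E" by (simp add: dislocation_eigenvalues_def)
    obtain f f' g g' where S: "solves_on {0..} (\<lambda>x. V (x + t) - E) f f'" "solves_on {0..} (\<lambda>x. V x - E) g g'"
      and m: "g 0 = f 0" "g' 0 = - f' 0" and nz: "f 0 \<noteq> 0 \<or> f' 0 \<noteq> 0"
      and L: "L2_halfline f" "L2_halfline f'" "L2_halfline g" "L2_halfline g'"
      by (rule line_eigenfunction_halves[OF V_cont_UNIV V_even ev])
    have 1: "phi' E t * f 0 = phi E t * f' 0"
      using L2_wronskian_zero[OF shift S(1) L2t L(1,2)] by simp
    have 2: "q E * f 0 = - p E * f' 0"
      using L2_wronskian_zero[OF phi_solves S(2) phi_L2[OF E] L(3,4)] m by simp
    have "f 0 * (phi E t * q E + phi' E t * p E) = 0" "f' 0 * (phi E t * q E + phi' E t * p E) = 0"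
      using 1 2 by algebra+
    then show "phi E t * q E + phi' E t * p E = 0" using nz by auto
  }
  {
    assume F: "phi E t * q E + phi' E t * p E = 0"
    \<comment> \<open>Parallel vectors: the factor \<open>a\<close> on the right half must not vanish, so it
      is \<open>p E\<close> or \<open>q E\<close>.\<close>
    obtain a b where ab: "b * p E = a * phi E t" "b * q E = - (a * phi' E t)" "a \<noteq> 0"
    proof (cases "p E = 0")
      case True
      then have "q E \<noteq> 0" using pq[OF E'] by simp
      then show thesis using that[of "- phi' E t" "q E"] F True by (simp add: mult.commute)
    next
      case False
      have "phi E t * q E = - (p E * phi' E t)" using F by (simp add: mult.commute add_eq_0_iff)
      then show thesis using that[of "phi E t" "p E"] False by (simp add: mult.commute)
    qed
    obtain K where K: "\<And>x. \<bar>V x\<bar> \<le> K" using V_bounded by metis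
    have scale: "solves_on {0..} Q (\<lambda>x. c * u x) (\<lambda>x. c * v x)" if "solves_on {0..} Q u v" for Q u v c
      using solves_on_lincomb[OF that that, of c 0] by simp
    have scaleL: "L2_halfline (\<lambda>x. c * u x)" if "L2_halfline u" for c u
      using integrable_mult_right[OF that[unfolded L2_halfline_def], of "c\<^sup>2"]
      by (simp add: L2_halfline_def power_mult_distrib mult_ac)
    have "line_eigenvalue (dislocation_potential V t) E"
      by (rule matched_halves_eigenvalue[OF V_cont_UNIV V_even K scale[OF shift, of a] scale[OF phi_solves[of E], of b]])
         (use ab phi_nonzero[OF E' t] in \<open>auto intro!: scaleL L2t phi_L2[OF E]\<close>)
    then show "E \<in> dislocation_eigenvalues V t" by (simp add: dislocation_eigenvalues_def)
  }
qed

lemma phi_jointly_continuous: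
  assumes "b \<ge> 0"
  shows "continuous_on ({0..b} \<times> {l..r}) (\<lambda>z. phi (snd z) (fst z))"
    "continuous_on ({0..b} \<times> {l..r}) (\<lambda>z. phi' (snd z) (fst z))"
proof -
  have sub: "{0..b} \<times> {l..r} \<subseteq> {0..b} \<times> UNIV" by auto
  have c: "continuous_on ({0..b} \<times> {l..r}) (\<lambda>z. p (snd z))" "continuous_on ({0..b} \<times> {l..r}) (\<lambda>z. q (snd z))"
    by (auto intro!: continuous_on_compose2[OF p_cont] continuous_on_compose2[OF q_cont'] continuous_intros)
  note J = jointly_continuous_cs_sn[OF assms, THEN continuous_on_subset[OF _ sub]]
  show "continuous_on ({0..b} \<times> {l..r}) (\<lambda>z. phi (snd z) (fst z))"
    "continuous_on ({0..b} \<times> {l..r}) (\<lambda>z. phi' (snd z) (fst z))"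
    unfolding phi_def phi'_def by (intro continuous_intros c J)+
qed

text \<open>At \<open>E2 = E1\<close> the integral is that of a square, and it is continuous in
  \<open>E2\<close>.\<close>

lemma phi_overlap_positive:
  assumes E1: "E1 \<in> {l<..<r}" and x: "x \<ge> 0"
  shows "\<exists>e>0. \<forall>E2. \<bar>E2 - E1\<bar> < e \<longrightarrow> E2 \<in> {l<..<r} \<and> integral {x..x+d} (\<lambda>y. phi E2 y * phi E1 y) > 0"
proof -
  define I where "I E = integral {x..x+d} (\<lambda>y. phi E y * phi E1 y)" for E
  have "continuous_on ({l..r} \<times> cbox x (x+d)) (\<lambda>(E, y). phi E y * phi E1 y)"
  proof -
    have 1: "continuous_on ({l..r} \<times> {x..x+d}) (\<lambda>z. phi (fst z) (snd z))"
      by (rule continuous_on_compose2[OF phi_jointly_continuous(1)[of "x+d"], of _ "\<lambda>z. (snd z, fst z)", simplified])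
         (use x d_pos in \<open>auto intro!: continuous_intros\<close>)
    have 2: "continuous_on ({l..r} \<times> {x..x+d}) (\<lambda>z. phi E1 (snd z))"
      by (rule continuous_on_compose2[OF solves_on_continuous(1)[OF phi_solves]])
         (use x in \<open>auto intro!: continuous_intros\<close>)
    show ?thesis using continuous_on_mult[OF 1 2] by (simp add: case_prod_beta)
  qed
  from integral_continuous_on_param[OF this] have cI: "continuous_on {l..r} I" by (simp add: I_def[abs_def])
  have cphi: "continuous_on {x..x+d} (phi E1)"
    by (rule continuous_on_subset[OF solves_on_continuous(1)[OF phi_solves]]) (use x in auto)
  have "I E1 \<noteq> 0"
  proof
    assume "I E1 = 0"
    then have z: "\<forall>y\<in>{x..x+d}. phi E1 y * phi E1 y = 0"
      unfolding I_def by (subst (asm) integral_eq_0_iff) (use d_pos in \<open>auto intro!: continuous_intros cphi\<close>)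
    define m where "m = x + d/2"
    have m: "m \<in> {x<..<x+d}" using d_pos by (auto simp: m_def)
    have "at m within {0..} = at m" using m x by (intro at_within_interior) auto
    then have "(phi E1 has_real_derivative phi' E1 m) (at m)"
      using solves_onD(1)[OF phi_solves[of E1], of m] m x by simp
    moreover have "(phi E1 has_real_derivative 0) (at m)"
      by (rule has_field_derivative_transform_within_open[where f = "\<lambda>_. 0" and S = "{x<..<x+d}"]) (use z m in auto)
    ultimately have "phi' E1 m = 0" by (rule DERIV_unique)
    moreover have "phi E1 m = 0" using z m by auto
    moreover have "E1 \<in> {l..r}" "m \<ge> 0" using E1 m x by auto
    ultimately show False using phi_nonzero[of E1 m] by simp
  qed
  moreover have "I E1 \<ge> 0" unfolding I_def by (rule Henstock_Kurzweil_Integration.integral_nonneg)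
    (auto intro!: integrable_continuous_interval continuous_intros cphi)
  ultimately have pos: "I E1 > 0" by simp
  have "E1 \<in> {l..r}" using E1 by auto
  then obtain e where e: "e > 0" "\<And>E2. E2 \<in> {l..r} \<Longrightarrow> dist E2 E1 < e \<Longrightarrow> dist (I E2) (I E1) < I E1"
    using cI pos unfolding continuous_on_iff by blast
  define e' where "e' = min e (min (E1 - l) (r - E1))"
  have "e' > 0" using e E1 by (auto simp: e'_def)
  moreover have "E2 \<in> {l<..<r} \<and> I E2 > 0" if E2: "\<bar>E2 - E1\<bar> < e'" for E2
  proof -
    have "E2 \<in> {l<..<r}" using E2 by (auto simp: e'_def abs_less_iff)
    moreover from this have "dist (I E2) (I E1) < I E1" using e(2)[of E2] E2 by (auto simp: dist_real_def e'_def)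
    ultimately show ?thesis by (auto simp: dist_real_def)
  qed
  ultimately show ?thesis unfolding I_def by blast
qed

text \<open>Over one period the Wronskian \<open>w\<close> of the two solutions is multiplied by \<open>\<rho>
  E1 * \<rho> E2\<close>, of modulus less than one, and by Lagrange's identity it decreases by \<open>E2 -
  E1\<close> times the overlap. This stands in for the formula that expresses \<open>w x\<close> as an
  integral over the whole half-line.\<close>

lemma phi_turns:
  assumes E1: "E1 \<in> {l<..<r}" and E2: "E2 \<in> {l<..<r}" and less: "E1 < E2" and x: "x \<ge> 0"
    and pos: "integral {x..x+d} (\<lambda>y. phi E2 y * phi E1 y) > 0"
  shows "phi' E2 x * phi E1 x - phi E2 x * phi' E1 x > 0"
proof -
  define w where "w y = phi' E2 y * phi E1 y - phi E2 y * phi' E1 y" for y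
  have sub: "{x..x+d} \<subseteq> {0..}" using x by auto
  have D: "(w has_vector_derivative (E1 - E2) * (phi E2 y * phi E1 y)) (at y within {x..x+d})" if "y \<in> {x..x+d}" for y
    using wronskian_derivative[OF solves_on_subset[OF phi_solves[of E2] sub] solves_on_subset[OF phi_solves[of E1] sub] that]
    unfolding w_def has_real_derivative_iff_has_vector_derivative[symmetric] by simp
  have "((\<lambda>y. (E1 - E2) * (phi E2 y * phi E1 y)) has_integral w (x + d) - w x) {x..x+d}"
    by (rule fundamental_theorem_of_calculus[OF _ D]) (use d_pos in auto)
  then have "w (x + d) - w x = integral {x..x+d} (\<lambda>y. (E1 - E2) * (phi E2 y * phi E1 y))"
    by (rule integral_unique[symmetric])
  also have "\<dots> = (E1 - E2) * integral {x..x+d} (\<lambda>y. phi E2 y * phi E1 y)" by simp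
  also have "\<dots> < 0" using less pos by (simp add: mult_neg_pos)
  finally have 1: "w (x + d) < w x" by simp
  have "w (x + d) = (\<rho> E1 * \<rho> E2) * w x"
    unfolding w_def phi_floquet[OF E1 x] phi_floquet[OF E2 x] by (simp add: algebra_simps)
  then have "0 < (1 - \<rho> E1 * \<rho> E2) * w x" using 1 by (simp add: algebra_simps)
  moreover have "\<bar>\<rho> E1 * \<rho> E2\<bar> < 1 * 1" unfolding abs_mult
    by (rule mult_strict_mono') (use contracting[OF E1] contracting[OF E2] in auto)
  then have "1 - \<rho> E1 * \<rho> E2 > 0" by (simp add: abs_less_iff)
  ultimately show ?thesis unfolding w_def by (simp add: zero_less_mult_iff)
qed

text \<open>A continuous nonvanishing function on a rectangle has a continuous logarithm. The angle is its
  imaginary part, shifted by a multiple of \<open>2 pi\<close> to the prescribed value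
  \<open>\<theta>\<close>.\<close>

lemma angle_exists:
  assumes E0: "E0 \<in> {l..r}" and m: "m > 0" and init: "p E0 = m * cos \<theta>" "q E0 = m * sin \<theta>"
  obtains R \<alpha> where "\<And>x E. x \<in> {0..d} \<Longrightarrow> E \<in> {l..r} \<Longrightarrow> R x E > 0"
    "\<And>x E. x \<in> {0..d} \<Longrightarrow> E \<in> {l..r} \<Longrightarrow> phi E x = R x E * cos (\<alpha> x E)"
    "\<And>x E. x \<in> {0..d} \<Longrightarrow> E \<in> {l..r} \<Longrightarrow> phi' E x = R x E * sin (\<alpha> x E)"
    "\<alpha> 0 E0 = (\<theta>::real)"
    "\<And>E. E \<in> {l..r} \<Longrightarrow> continuous_on {0..d} (\<lambda>x. \<alpha> x E)"
    "\<And>x. x \<in> {0..d} \<Longrightarrow> continuous_on {l..r} (\<lambda>E. \<alpha> x E)"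
proof -
  define S where "S = {0..d} \<times> {l..r}"
  define Z where "Z z = Complex (phi (snd z) (fst z)) (phi' (snd z) (fst z))" for z
  have cZ: "continuous_on S Z"
    unfolding Z_def S_def using phi_jointly_continuous[of d] d_pos by (intro continuous_on_Complex) auto
  have nz: "Z z \<noteq> 0" if "z \<in> S" for z
    using phi_nonzero[of "snd z" "fst z"] that by (auto simp: Z_def S_def complex_eq_iff)
  have "contractible S" unfolding S_def by (intro convex_imp_contractible convex_Times) auto
  from continuous_logarithm_on_contractible[OF cZ this nz]
  obtain g where g: "continuous_on S g" "\<And>z. z \<in> S \<Longrightarrow> Z z = exp (g z)" by metis
  have in0: "(0, E0) \<in> S" using E0 d_pos by (auto simp: S_def)
  define R where "R x E = exp (Re (g (x, E)))" for x E
  define \<alpha> where "\<alpha> x E = Im (g (x, E)) - (Im (g (0, E0)) - \<theta>)" for x E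
  have ph: "phi E x = R x E * cos (Im (g (x, E)))" "phi' E x = R x E * sin (Im (g (x, E)))"
    if "x \<in> {0..d}" "E \<in> {l..r}" for x E
  proof -
    have "(x, E) \<in> S" using that by (simp add: S_def)
    from g(2)[OF this] show "phi E x = R x E * cos (Im (g (x, E)))" "phi' E x = R x E * sin (Im (g (x, E)))"
      by (auto simp: Z_def R_def Re_exp Im_exp complex_eq_iff)
  qed
  have d0: "0 \<in> {0..d}" using d_pos by simp
  define \<beta> where "\<beta> = Im (g (0, E0))"
  define m' where "m' = R 0 E0"
  have m': "m' > 0" by (simp add: m'_def R_def)
  have eqs: "m' * cos \<beta> = m * cos \<theta>" "m' * sin \<beta> = m * sin \<theta>"
    using ph[OF d0 E0] init by (simp_all add: m'_def \<beta>_def)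
  have "m'\<^sup>2 = (m' * cos \<beta>)\<^sup>2 + (m' * sin \<beta>)\<^sup>2" 
    by (simp add: power_mult_distrib distrib_left[symmetric])
  also have "\<dots> = m\<^sup>2" unfolding eqs by (simp add: power_mult_distrib distrib_left[symmetric])
  finally have "m' = m" using m m' by simp
  then have "cos \<beta> = cos \<theta>" "sin \<beta> = sin \<theta>" using eqs m by simp_all
  then have sc: "cos (\<beta> - \<theta>) = 1" "sin (\<beta> - \<theta>) = 0"
    by (simp_all add: cos_diff sin_diff power2_eq_square[symmetric])
  have rot: "cos (a - (\<beta> - \<theta>)) = cos a" "sin (a - (\<beta> - \<theta>)) = sin a" for a
    using sc by (simp_all add: cos_diff sin_diff)
  have cg: "continuous_on {0..d} (\<lambda>x. g (x, E))" if "E \<in> {l..r}" for E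
    by (rule continuous_on_compose2[OF g(1)]) (use that in \<open>auto simp: S_def intro!: continuous_intros\<close>)
  have cg': "continuous_on {l..r} (\<lambda>E. g (x, E))" if "x \<in> {0..d}" for x
    by (rule continuous_on_compose2[OF g(1)]) (use that in \<open>auto simp: S_def intro!: continuous_intros\<close>)
  show thesis
  proof (rule that[of R \<alpha>])
    show "R x E > 0" for x E by (simp add: R_def)
    show "phi E x = R x E * cos (\<alpha> x E)" "phi' E x = R x E * sin (\<alpha> x E)" if "x \<in> {0..d}" "E \<in> {l..r}" for x E
      using ph[OF that] rot unfolding \<alpha>_def \<beta>_def by simp_all
    show "\<alpha> 0 E0 = \<theta>" by (simp add: \<alpha>_def)
    show "continuous_on {0..d} (\<lambda>x. \<alpha> x E)" if "E \<in> {l..r}" for E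
      unfolding \<alpha>_def by (intro continuous_intros cg that)
    show "continuous_on {l..r} (\<lambda>E. \<alpha> x E)" if "x \<in> {0..d}" for x
      unfolding \<alpha>_def by (intro continuous_intros cg' that)
  qed
qed

text \<open>The Wronskian at two nearby energies is a positive multiple of the sine of the difference of the
  angles.\<close>

lemma angle_strict_mono:
  assumes x: "x \<in> {0..d}"
    and R: "\<And>E. E \<in> {l..r} \<Longrightarrow> R E > 0"
    and c: "\<And>E. E \<in> {l..r} \<Longrightarrow> phi E x = R E * cos (\<alpha> E)"
    and s: "\<And>E. E \<in> {l..r} \<Longrightarrow> phi' E x = R E * sin (\<alpha> E)"
    and cont: "continuous_on {l..r} \<alpha>"
  shows "strict_mono_on {l..r} (\<alpha> :: real \<Rightarrow> real)"
proof (rule strict_mono_from_local[OF cont])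
  fix E1 assume E1: "E1 \<in> {l<..<r}"
  have x0: "x \<ge> 0" using x by simp
  obtain e where e: "e > 0" "\<And>E2. \<bar>E2 - E1\<bar> < e \<Longrightarrow> E2 \<in> {l<..<r} \<and> integral {x..x+d} (\<lambda>y. phi E2 y * phi E1 y) > 0"
    using phi_overlap_positive[OF E1 x0] by blast
  have "E1 \<in> {l..r}" using E1 by auto
  then obtain e1 where e1: "e1 > 0" "\<And>E2. E2 \<in> {l..r} \<Longrightarrow> dist E2 E1 < e1 \<Longrightarrow> dist (\<alpha> E2) (\<alpha> E1) < pi"
    using cont pi_gt_zero unfolding continuous_on_iff by blast
  have "\<alpha> E1 < \<alpha> E2" if E2: "E1 < E2" "E2 < E1 + min e e1" for E2
  proof -
    have in2: "E2 \<in> {l<..<r}" and pos: "integral {x..x+d} (\<lambda>y. phi E2 y * phi E1 y) > 0"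
      using e(2)[of E2] E2 by auto
    have cl: "E1 \<in> {l..r}" "E2 \<in> {l..r}" using E1 in2 by auto
    have near: "\<bar>\<alpha> E2 - \<alpha> E1\<bar> < pi" using e1(2)[OF cl(2)] E2 by (auto simp: dist_real_def)
    have "phi' E2 x * phi E1 x - phi E2 x * phi' E1 x > 0" by (rule phi_turns[OF E1 in2 E2(1) x0 pos])
    then have "(R E1 * R E2) * sin (\<alpha> E2 - \<alpha> E1) > 0"
      unfolding c[OF cl(1)] c[OF cl(2)] s[OF cl(1)] s[OF cl(2)] sin_diff by (simp add: algebra_simps)
    then have sp: "sin (\<alpha> E2 - \<alpha> E1) > 0"
      by (rule zero_less_mult_pos) (use R[OF cl(1)] R[OF cl(2)] in simp)
    show ?thesis
    proof (rule ccontr)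
      assume "\<not> \<alpha> E1 < \<alpha> E2"
      then have "sin (\<alpha> E1 - \<alpha> E2) \<ge> 0" using near by (intro sin_ge_zero) auto
      then show False using sp by (metis minus_diff_eq neg_less_0_iff_less not_le sin_minus)
    qed
  qed
  then show "\<exists>e>0. \<forall>y. E1 < y \<and> y < E1 + e \<longrightarrow> \<alpha> E1 < \<alpha> y"
    using e e1 by (intro exI[of _ "min e e1"]) auto
qed

end

section \<open>Counting multiples of \<open>pi\<close>\<close>

text \<open>A continuous angle that starts on a ray and then stays on one side of its line remains in that
  half-turn; at \<open>x\<close> itself it may reach the boundary.\<close>

lemma sector_closed:
  fixes f :: "real \<Rightarrow> real"
  assumes ax: "a < x" and c: "continuous_on {a..x} f" and fa: "f a = \<gamma>"
    and s: "\<And>y. y \<in> {a<..<x} \<Longrightarrow> sin (f y - \<gamma>) < 0"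
  shows "\<gamma> - pi \<le> f x" "f x \<le> \<gamma>"
proof -
  show "f x \<le> \<gamma>"
  proof (rule ccontr)
    assume gt: "\<not> f x \<le> \<gamma>"
    define h where "h = min (pi/2) ((f x - \<gamma>)/2)"
    have h: "0 < h" "h \<le> pi/2" "h < f x - \<gamma>" using gt by (auto simp: h_def min_def)
    obtain y where y: "a \<le> y" "y \<le> x" "f y = \<gamma> + h"
      using IVT'[of f a "\<gamma> + h" x] fa h ax c by auto
    have "y \<noteq> a" "y \<noteq> x" using y h fa by auto
    then have "sin (f y - \<gamma>) < 0" using s[of y] y by auto
    moreover have "sin h > 0" using h by (intro sin_gt_zero) auto
    ultimately show False using y by simp
  qed
  show "\<gamma> - pi \<le> f x"
  proof (rule ccontr)
    assume lt: "\<not> \<gamma> - pi \<le> f x"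
    obtain y where y: "a \<le> y" "y \<le> x" "f y = \<gamma> - pi"
      using IVT2'[of f x "\<gamma> - pi" a] fa lt ax c by auto
    have "y \<noteq> a" "y \<noteq> x" using y lt fa by auto
    then have "sin (f y - \<gamma>) < 0" using s[of y] y by auto
    then show False using y by simp
  qed
qed

lemma sector_below:
  fixes f :: "real \<Rightarrow> real"
  assumes ax: "a < x" and c: "continuous_on {a..x} f" and fa: "f a = \<gamma>"
    and s: "\<And>y. y \<in> {a<..x} \<Longrightarrow> sin (f y - \<gamma>) < 0"
  shows "\<gamma> - pi < f x" "f x < \<gamma>"
proof -
  have cl: "\<gamma> - pi \<le> f x" "f x \<le> \<gamma>" using sector_closed[OF ax c fa] s by auto
  have "sin (f x - \<gamma>) < 0" using s[of x] ax by auto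
  then have "f x - \<gamma> \<noteq> 0" "f x - \<gamma> \<noteq> - pi" by (metis order_less_irrefl sin_zero, metis order_less_irrefl sin_pi sin_minus neg_equal_0_iff_equal)
  then show "\<gamma> - pi < f x" "f x < \<gamma>" using cl by auto
qed

lemma sector_above:
  fixes f :: "real \<Rightarrow> real"
  assumes ax: "a < x" and c: "continuous_on {a..x} f" and fa: "f a = \<gamma>"
    and s: "\<And>y. y \<in> {a<..x} \<Longrightarrow> sin (f y - \<gamma>) > 0"
  shows "\<gamma> < f x" "f x < \<gamma> + pi"
proof -
  have s': "sin (- f y - (- \<gamma>)) < 0" if "y \<in> {a<..x}" for y
  proof -
    have "sin (- f y - (- \<gamma>)) = - sin (f y - \<gamma>)" by (metis minus_diff_eq minus_diff_minus sin_minus)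
    then show ?thesis using s[OF that] by simp
  qed
  have c': "continuous_on {a..x} (\<lambda>y. - f y)" by (intro continuous_intros c)
  show "\<gamma> < f x" "f x < \<gamma> + pi"
    using sector_below[OF ax c' _ s'] fa by auto
qed

text \<open>The half-open position of \<open>s\<close> and \<open>A\<close> is the one that makes a multiple
  of \<open>pi\<close> at an end of the interval not count.\<close>

lemma card_multiples_of_pi:
  assumes m: "of_int m * pi \<le> s" "s < (of_int m + 1) * pi" and n: "of_int n * pi < A" "A \<le> (of_int n + 1) * pi"
  shows "finite {k::int. s < of_int k * pi \<and> of_int k * pi < A}"
    "card {k::int. s < of_int k * pi \<and> of_int k * pi < A} = nat (n - m)"
proof -
  have low: "s < of_int k * pi \<longleftrightarrow> m < k" for k
  proof
    assume "s < of_int k * pi"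
    then have "of_int m * pi < of_int k * pi" using m by linarith
    then show "m < k" by simp
  next
    assume "m < k"
    then have "of_int m + 1 \<le> (of_int k :: real)" by linarith
    then have "(of_int m + 1) * pi \<le> of_int k * pi" by (intro mult_right_mono) auto
    then show "s < of_int k * pi" using m by linarith
  qed
  have high: "of_int k * pi < A \<longleftrightarrow> k \<le> n" for k
  proof
    assume "of_int k * pi < A"
    then have "of_int k * pi < (of_int n + 1) * pi" using n by linarith
    then have "of_int k < (of_int n + 1 :: real)" by simp
    then show "k \<le> n" by linarith
  next
    assume "k \<le> n"
    then have "of_int k * pi \<le> of_int n * pi" by (intro mult_right_mono) auto
    then show "of_int k * pi < A" using n by linarith
  qed
  have eq: "{k::int. s < of_int k * pi \<and> of_int k * pi < A} = {m<..n}" using low high by auto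
  show "finite {k::int. s < of_int k * pi \<and> of_int k * pi < A}"
    "card {k::int. s < of_int k * pi \<and> of_int k * pi < A} = nat (n - m)" unfolding eq by auto
qed

lemma count_sine_zeros:
  fixes \<sigma> :: "real \<Rightarrow> real"
  assumes lr: "l < r" and mono: "strict_mono_on {l..r} \<sigma>" and c: "continuous_on {l..r} \<sigma>"
    and m: "of_int m * pi \<le> \<sigma> l" "\<sigma> l < (of_int m + 1) * pi" and n: "of_int n * pi < \<sigma> r" "\<sigma> r \<le> (of_int n + 1) * pi"
  shows "has_exactly {E \<in> {l<..<r}. sin (\<sigma> E) = 0} (nat (n - m))"
proof -
  define K where "K = {k::int. \<sigma> l < of_int k * pi \<and> of_int k * pi < \<sigma> r}"
  let ?S = "{E \<in> {l<..<r}. sin (\<sigma> E) = 0}"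
  have inj: "inj_on \<sigma> {l..r}" by (rule strict_mono_on_imp_inj_on[OF mono])
  have im: "\<sigma> ` ?S = (\<lambda>k. of_int k * pi) ` K"
  proof (intro equalityI subsetI)
    fix y assume "y \<in> \<sigma> ` ?S"
    then obtain E where E: "y = \<sigma> E" "l < E" "E < r" "sin (\<sigma> E) = 0" by auto
    then obtain k :: int where k: "\<sigma> E = of_int k * pi" using sin_zero_iff_int2 by blast
    have "\<sigma> l < \<sigma> E" "\<sigma> E < \<sigma> r" using strict_mono_onD[OF mono, of l E] strict_mono_onD[OF mono, of E r] E lr by auto
    then show "y \<in> (\<lambda>k. of_int k * pi) ` K" using k E by (auto simp: K_def)
  next
    fix y assume "y \<in> (\<lambda>k. of_int k * pi) ` K"
    then obtain k :: int where k: "y = of_int k * pi" "\<sigma> l < of_int k * pi" "of_int k * pi < \<sigma> r" by (auto simp: K_def)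
    obtain E where E: "l \<le> E" "E \<le> r" "\<sigma> E = of_int k * pi" using IVT'[of \<sigma> l "of_int k * pi" r] k lr c by auto
    have "E \<noteq> l" "E \<noteq> r" using E k by auto
    then have "E \<in> ?S" using E sin_zero_iff_int2 by auto
    then show "y \<in> \<sigma> ` ?S" using E k by force
  qed
  have injS: "inj_on \<sigma> ?S" by (rule inj_on_subset[OF inj]) auto
  have injK: "inj_on (\<lambda>k::int. of_int k * pi) K" by (auto simp: inj_on_def)
  have K: "finite K" "card K = nat (n - m)" unfolding K_def by (rule card_multiples_of_pi[OF m n])+
  have fin: "finite ?S" using im K(1) finite_imageD[OF _ injS] by simp
  have "card ?S = card (\<sigma> ` ?S)" by (rule card_image[OF injS, symmetric])
  also have "\<dots> = card K" unfolding im by (rule card_image[OF injK])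
  finally show ?thesis using fin K(2) by (simp add: has_exactly_def)
qed

text \<open>By the addition theorem the matching condition is a positive multiple of \<open>sin (\<alpha> t E
  + \<alpha> 0 E)\<close>.\<close>

lemma (in decaying_family) count_eigenvalues:
  assumes t: "t \<in> {0..d}"
    and R: "\<And>x E. x \<in> {0..d} \<Longrightarrow> E \<in> {l..r} \<Longrightarrow> R x E > (0::real)"
    and c: "\<And>x E. x \<in> {0..d} \<Longrightarrow> E \<in> {l..r} \<Longrightarrow> phi E x = R x E * cos (\<alpha> x E)"
    and s: "\<And>x E. x \<in> {0..d} \<Longrightarrow> E \<in> {l..r} \<Longrightarrow> phi' E x = R x E * sin (\<alpha> x E)"
    and cont: "\<And>x. x \<in> {0..d} \<Longrightarrow> continuous_on {l..r} (\<lambda>E. \<alpha> x E :: real)"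
    and m: "of_int m * pi \<le> \<alpha> t l + \<alpha> 0 l" "\<alpha> t l + \<alpha> 0 l < (of_int m + 1) * pi" 
    and n: "of_int n * pi < \<alpha> t r + \<alpha> 0 r" "\<alpha> t r + \<alpha> 0 r \<le> (of_int n + 1) * pi"
  shows "has_exactly (dislocation_eigenvalues V t \<inter> {l<..<r}) (nat (n - m))"
proof -
  have d0: "0 \<in> {0..d}" using d_pos by simp
  have mono: "strict_mono_on {l..r} (\<lambda>E. \<alpha> x E)" if "x \<in> {0..d}" for x
    by (rule angle_strict_mono[OF that R[OF that] c[OF that] s[OF that] cont[OF that]])
  have "strict_mono_on {l..r} (\<lambda>E. \<alpha> t E + \<alpha> 0 E)"
    by (intro strict_mono_onI add_strict_mono) (use strict_mono_onD[OF mono[OF t]] strict_mono_onD[OF mono[OF d0]] in auto)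
  from count_sine_zeros[OF lr this _ m n]
  have "has_exactly {E \<in> {l<..<r}. sin (\<alpha> t E + \<alpha> 0 E) = 0} (nat (n - m))"
    using continuous_on_add[OF cont[OF t] cont[OF d0]] by simp
  moreover have "dislocation_eigenvalues V t \<inter> {l<..<r} = {E \<in> {l<..<r}. sin (\<alpha> t E + \<alpha> 0 E) = 0}"
  proof -
    have "E \<in> dislocation_eigenvalues V t \<longleftrightarrow> sin (\<alpha> t E + \<alpha> 0 E) = 0" if E: "E \<in> {l<..<r}" for E
    proof -
      have E': "E \<in> {l..r}" using E by auto
      have "E \<in> dislocation_eigenvalues V t \<longleftrightarrow> phi E t * phi' E 0 + phi' E t * phi E 0 = 0"
        using dislocation_eigenvalue_iff[OF E, of t] t by simp
      also have "phi E t * phi' E 0 + phi' E t * phi E 0 = (R t E * R 0 E) * sin (\<alpha> t E + \<alpha> 0 E)"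
        unfolding c[OF t E'] c[OF d0 E'] s[OF t E'] s[OF d0 E'] sin_add by (simp add: algebra_simps)
      finally show ?thesis using R[OF t E'] R[OF d0 E'] by simp
    qed
    then show ?thesis by auto
  qed
  ultimately show ?thesis by simp
qed

text \<open>The multiplier in the gap, with \<open>k = - C S'\<close>.\<close>

lemma gap_multiplier_bound:
  fixes k :: real
  assumes "k > 0" shows "\<bar>- 1 - 2 * k + 2 * sqrt (k * (k + 1))\<bar> < 1"
proof -
  have "k < sqrt (k * (k + 1))" by (rule real_less_rsqrt) (use assms in \<open>auto simp: power2_eq_square algebra_simps\<close>)
  moreover have "sqrt (k * (k + 1)) < k + 1/2" by (rule real_less_lsqrt) (use assms in \<open>auto simp: power2_eq_square algebra_simps\<close>)
  ultimately show ?thesis by (simp add: abs_less_iff)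
qed

context even_periodic_potential begin

lemma cs'_nu_reflect: "x \<in> {0..d} \<Longrightarrow> cs' V nu x = cs' V nu (d - x)"
  using cs_nu_antiperiodic(2)[of x] by simp

lemma half_period_continuous:
  "continuous_on A (\<lambda>E. cs V E (d/2))" "continuous_on A (\<lambda>E. cs' V E (d/2))"
  "continuous_on A (\<lambda>E. sn V E (d/2))" "continuous_on A (\<lambda>E. sn' V E (d/2))"
  by (rule continuous_in_energy; use d_pos in simp)+

lemma cs'_half_neg:
  assumes "sn V E (d/2) > 0" "cs V E (d/2) * sn' V E (d/2) \<le> 0" shows "cs' V E (d/2) < 0"
proof -
  have "cs' V E (d/2) * sn V E (d/2) < 0" using half_wronskian[of E] assms(2) by linarith
  then show ?thesis using assms(1) by (simp add: mult_less_0_iff)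
qed

text \<open>With \<open>s(d) = 2 \<epsilon> p\<^sup>2\<close> and \<open>c'(d) = 2 \<epsilon>
  q\<^sup>2\<close> the vector \<open>(p, q)\<close> is an eigenvector of the period matrix for \<open>c(d) +
  2 \<epsilon> p q\<close>. The sign of \<open>p q\<close> is chosen as \<open>\<epsilon>\<close>, which
  selects the multiplier of smaller modulus. Here \<open>\<epsilon> = 1\<close> if \<open>nu < mu\<close> and
  \<open>\<epsilon> = - 1\<close> if \<open>mu < nu\<close>.\<close>

lemma gap_multiplier:
  assumes gap: "cs V E (d/2) * sn' V E (d/2) < 0"
    and p2: "p\<^sup>2 = \<bar>sn V E (d/2) * sn' V E (d/2)\<bar>" and q2: "q\<^sup>2 = \<bar>cs V E (d/2) * cs' V E (d/2)\<bar>" and pq: "\<bar>p * q\<bar> = \<epsilon> * (p * q)"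
    and \<epsilon>: "sn V E (d/2) * sn' V E (d/2) = \<epsilon> * p\<^sup>2" "cs V E (d/2) * cs' V E (d/2) = \<epsilon> * q\<^sup>2"
  defines "\<rho> \<equiv> cs V E d + 2 * \<epsilon> * (p * q)"
  shows "p * cs V E d + q * sn V E d = \<rho> * p" "p * cs' V E d + q * sn' V E d = \<rho> * q" "\<bar>\<rho>\<bar> < 1"
proof -
  define C C' S S' where "C = cs V E (d/2)" and "C' = cs' V E (d/2)" and "S = sn V E (d/2)" and "S' = sn' V E (d/2)"
  note defs = C_def[symmetric] C'_def[symmetric] S_def[symmetric] S'_def[symmetric]
  note per = period_from_half_period[of E, unfolded defs]
  have W: "C * S' - C' * S = 1" using half_wronskian[of E] by (simp add: defs)
  have e: "S * S' = \<epsilon> * p\<^sup>2" "C * C' = \<epsilon> * q\<^sup>2" using \<epsilon> by (simp_all add: defs)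
  show "p * cs V E d + q * sn V E d = \<rho> * p" "p * cs' V E d + q * sn' V E d = \<rho> * q"
    unfolding \<rho>_def per using e by algebra+
  define k where "k = - (C * S')"
  have k: "k > 0" using gap by (simp add: k_def defs)
  have "(p * q)\<^sup>2 = \<bar>S * S'\<bar> * \<bar>C * C'\<bar>" unfolding power_mult_distrib p2 q2 by (simp add: defs)
  also have "\<dots> = \<bar>(C * S') * (C' * S)\<bar>" by (simp add: abs_mult mult_ac)
  also have "(C * S') * (C' * S) = k * (k + 1)" using W unfolding k_def by algebra
  also have "\<bar>k * (k + 1)\<bar> = k * (k + 1)" using k by simp
  finally have "sqrt (k * (k + 1)) = \<bar>p * q\<bar>" by (metis real_sqrt_abs)
  then have "\<rho> = - 1 - 2 * k + 2 * sqrt (k * (k + 1))"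
    unfolding \<rho>_def per pq k_def by simp
  then show "\<bar>\<rho>\<bar> < 1" using gap_multiplier_bound[OF k] by simp
qed

text \<open>At \<open>nu\<close> the solution is a positive multiple of \<open>cs\<close>, which decreases on
  the cell, so its angle is in \<open>(- pi, 0)\<close>. At \<open>mu\<close> it is a positive multiple of
  \<open>sn\<close>, which is positive, so its angle is within \<open>pi / 2\<close> of zero. At \<open>x =
  0\<close> the angle moves through the first quadrant from \<open>0\<close> to \<open>pi / 2\<close>. So the
  sum of the angles passes exactly the multiple \<open>0\<close>.\<close>

lemma count_nu_mu:
  assumes less: "nu < mu" and neg: "\<And>x. x \<in> {0<..d/2} \<Longrightarrow> cs' V nu x < 0" and t: "t \<in> {0<..<d}"
  shows "has_exactly (dislocation_eigenvalues V t \<inter> {nu<..<mu}) 1"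
proof -
  define p q where "p E = sqrt \<bar>sn V E (d/2) * sn' V E (d/2)\<bar>" and "q E = sqrt \<bar>cs V E (d/2) * cs' V E (d/2)\<bar>" for E
  define \<rho> where "\<rho> E = cs V E d + 2 * 1 * (p E * q E)" for E
  have S: "sn V E (d/2) > 0" if "E \<le> mu" for E by (rule sn_half_pos_le_mu[OF that])
  have S': "sn' V E (d/2) > 0" if "E < mu" for E by (rule below_mu[OF that])
  have C: "cs V E (d/2) < 0" if "nu < E" "E \<le> mu" for E by (rule between_nu_mu[OF that])
  have C': "cs' V E (d/2) < 0" if "nu \<le> E" "E \<le> mu" for E
  proof (rule cs'_half_neg[OF S[OF that(2)]])
    show "cs V E (d/2) * sn' V E (d/2) \<le> 0"
      using S'[of E] C[of E] at_nu(1) at_mu(1) that by (cases "E = nu"; cases "E = mu") (auto simp: mult_nonpos_nonneg less_imp_le)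
  qed
  have ppos: "p E > 0" if "nu \<le> E" "E < mu" for E using S[of E] S'[of E] that by (simp add: p_def)
  have qpos: "q E > 0" if "nu < E" "E \<le> mu" for E using C[of E] C'[of E] that by (simp add: q_def)
  have p0: "p mu = 0" and q0: "q nu = 0" using at_mu(1) at_nu(1) by (simp_all add: p_def q_def)
  interpret decaying_family V d nu mu p q \<rho>
  proof
    show "nu < mu" by (rule less)
    show "continuous_on {nu..mu} p" "continuous_on {nu..mu} q"
      unfolding p_def q_def by (intro continuous_intros half_period_continuous)+
    show "p E \<noteq> 0 \<or> q E \<noteq> 0" if "E \<in> {nu..mu}" for E using ppos[of E] qpos[of E] that less by force
    fix E assume "E \<in> {nu<..<mu}"
    then have E: "nu < E" "E < mu" by auto
    have a: "sn V E (d/2) * sn' V E (d/2) > 0" "cs V E (d/2) * cs' V E (d/2) > 0"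
      using S[of E] S'[of E] C[of E] C'[of E] E by (auto intro: mult_neg_neg)
    have g: "cs V E (d/2) * sn' V E (d/2) < 0" using S'[of E] C[of E] E by (auto intro: mult_neg_pos)
    have sq: "(p E)\<^sup>2 = \<bar>sn V E (d/2) * sn' V E (d/2)\<bar>" "(q E)\<^sup>2 = \<bar>cs V E (d/2) * cs' V E (d/2)\<bar>"
      by (simp_all add: p_def q_def)
    have "\<bar>p E * q E\<bar> = 1 * (p E * q E)" using ppos[of E] qpos[of E] E by simp
    from gap_multiplier[OF g sq this]
    show "p E * cs V E d + q E * sn V E d = \<rho> E * p E" "p E * cs' V E d + q E * sn' V E d = \<rho> E * q E" "\<bar>\<rho> E\<bar> < 1"
      unfolding \<rho>_def using sq a by simp_all
  qed
  have nuI: "nu \<in> {nu..mu}" and muI: "mu \<in> {nu..mu}" and d0: "0 \<in> {0..d}" using less d_pos by auto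
  obtain R \<alpha> where R: "\<And>x E. x \<in> {0..d} \<Longrightarrow> E \<in> {nu..mu} \<Longrightarrow> R x E > (0::real)"
    and c: "\<And>x E. x \<in> {0..d} \<Longrightarrow> E \<in> {nu..mu} \<Longrightarrow> phi E x = R x E * cos (\<alpha> x E)"
    and s: "\<And>x E. x \<in> {0..d} \<Longrightarrow> E \<in> {nu..mu} \<Longrightarrow> phi' E x = R x E * sin (\<alpha> x E)"
    and init: "\<alpha> 0 nu = (0::real)"
    and cx: "\<And>E. E \<in> {nu..mu} \<Longrightarrow> continuous_on {0..d} (\<lambda>x. \<alpha> x E)"
    and cE: "\<And>x. x \<in> {0..d} \<Longrightarrow> continuous_on {nu..mu} (\<lambda>E. \<alpha> x E)"
    using angle_exists[OF nuI ppos[OF order_refl less], of 0] q0 by auto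
  have sinpos: "sin (\<alpha> x E) > 0 \<longleftrightarrow> phi' E x > 0" "sin (\<alpha> x E) < 0 \<longleftrightarrow> phi' E x < 0"
    and cospos: "cos (\<alpha> x E) > 0 \<longleftrightarrow> phi E x > 0" "cos (\<alpha> x E) = 0 \<longleftrightarrow> phi E x = 0"
    if "x \<in> {0..d}" "E \<in> {nu..mu}" for x E
    using R[OF that] unfolding c[OF that] s[OF that] by (auto simp: zero_less_mult_iff mult_less_0_iff)
  have a0: "0 < \<alpha> 0 mu" "\<alpha> 0 mu < 0 + pi"
    by (rule sector_above[OF less cE[OF d0] init]; use sinpos(1)[OF d0] qpos in auto)+
  have "cos (\<alpha> 0 mu) = 0" using cospos(2)[OF d0 muI] p0 by simp
  then have a0mu: "\<alpha> 0 mu = pi / 2"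
    using cos_zero_iff_int2 a0 cos_inj_pi[of "\<alpha> 0 mu" "pi/2"] by auto
  have sub: "{0..t} \<subseteq> {0..d}" and tI: "t \<in> {0..d}" and t0: "0 < t" using t by auto
  have negcell: "cs' V nu x < 0" if "x \<in> {0<..<d}" for x
    using neg[of x] neg[of "d - x"] cs'_nu_reflect[of x] that by (cases "x \<le> d/2") auto
  have sinnu: "sin (\<alpha> y nu - 0) < 0" if "y \<in> {0<..t}" for y
  proof -
    have "phi' nu y < 0" using negcell[of y] ppos[of nu] less that t by (simp add: phi'_def q0 mult_pos_neg)
    then show ?thesis using sinpos(2)[of y nu] nuI that t by auto
  qed
  have atnu: "0 - pi < \<alpha> t nu" "\<alpha> t nu < 0"
    by (rule sector_below[OF t0 continuous_on_subset[OF cx[OF nuI] sub] init sinnu]; assumption)+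
  have cosmu: "sin (\<alpha> y mu - pi/2) < 0" if "y \<in> {0<..t}" for y
  proof -
    have "phi mu y > 0" using sn_mu_pos_cell[of y] qpos[of mu] less that t by (simp add: phi_def p0)
    then have "cos (\<alpha> y mu) > 0" using cospos(1)[of y mu] muI that t by auto
    then show ?thesis by (simp add: sin_diff)
  qed
  have atmu: "pi/2 - pi < \<alpha> t mu" "\<alpha> t mu < pi/2"
    by (rule sector_below[OF t0 continuous_on_subset[OF cx[OF muI] sub] a0mu cosmu]; assumption)+
  have "has_exactly (dislocation_eigenvalues V t \<inter> {nu<..<mu}) (nat (0 - (-1)))"
    by (rule count_eigenvalues[OF tI R c s cE]) (use atnu atmu init a0mu in auto)
  then show ?thesis by simp
qed

text \<open>Now \<open>q < 0\<close>: at \<open>mu\<close> the solution is a negative multiple of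
  \<open>sn\<close>, and at \<open>x = 0\<close> the angle moves through the fourth quadrant from \<open>- pi
  / 2\<close> to \<open>0\<close>. The sum of the angles starts in \<open>(- 2 pi, - pi)\<close> and ends at
  the angle \<open>A t\<close> of the Neumann solution, so the multiples counted are those from \<open>-
  1\<close> to \<open>n\<close>.\<close>

lemma count_mu_nu:
  assumes less: "mu < nu"
  shows "\<exists>R A. (\<forall>x\<in>{0..d}. R x > (0::real) \<and> cs V nu x = R x * cos (A x) \<and> cs' V nu x = R x * sin (A x)) \<and>
    A 0 = 0 \<and> continuous_on {0..d} A \<and>
    (\<forall>t\<in>{0<..<d}. \<forall>n. of_int n * pi < A t \<longrightarrow> A t \<le> (of_int n + 1) * pi \<longrightarrow>
       has_exactly (dislocation_eigenvalues V t \<inter> {mu<..<nu}) (nat (n + 2)))"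
proof -
  define p q where "p E = sqrt \<bar>sn V E (d/2) * sn' V E (d/2)\<bar>" and "q E = - sqrt \<bar>cs V E (d/2) * cs' V E (d/2)\<bar>" for E
  define \<rho> where "\<rho> E = cs V E d + 2 * (-1) * (p E * q E)" for E
  have S: "sn V E (d/2) > 0" if "E \<le> nu" for E by (rule sn_pos_le_nu[OF that]) (use d_pos in auto)
  have S': "sn' V E (d/2) < 0" if "mu < E" "E \<le> nu" for E by (rule between_mu_nu[OF that])
  have C: "cs V E (d/2) > 0" if "E < nu" for E by (rule below_nu[OF that])
  have C': "cs' V E (d/2) < 0" if "mu \<le> E" "E \<le> nu" for E
  proof (rule cs'_half_neg[OF S[OF that(2)]])
    show "cs V E (d/2) * sn' V E (d/2) \<le> 0"
      using S'[of E] C[of E] at_nu(1) at_mu(1) that by (cases "E = nu"; cases "E = mu") (auto simp: mult_nonneg_nonpos less_imp_le)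
  qed
  have ppos: "p E > 0" if "mu < E" "E \<le> nu" for E using S[of E] S'[of E] that by (simp add: p_def)
  have qneg: "q E < 0" if "mu \<le> E" "E < nu" for E using C[of E] C'[of E] that by (simp add: q_def)
  have p0: "p mu = 0" and q0: "q nu = 0" using at_mu(1) at_nu(1) by (simp_all add: p_def q_def)
  interpret decaying_family V d mu nu p q \<rho>
  proof
    show "mu < nu" by (rule less)
    show "continuous_on {mu..nu} p" "continuous_on {mu..nu} q"
      unfolding p_def q_def by (intro continuous_intros half_period_continuous)+
    show "p E \<noteq> 0 \<or> q E \<noteq> 0" if "E \<in> {mu..nu}" for E using ppos[of E] qneg[of E] that less by force
    fix E assume "E \<in> {mu<..<nu}"
    then have E: "mu < E" "E < nu" by auto
    have a: "sn V E (d/2) * sn' V E (d/2) < 0" "cs V E (d/2) * cs' V E (d/2) < 0"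
      using S[of E] S'[of E] C[of E] C'[of E] E by (auto intro: mult_pos_neg)
    have g: "cs V E (d/2) * sn' V E (d/2) < 0" using S'[of E] C[of E] E by (auto intro: mult_pos_neg)
    have sq: "(p E)\<^sup>2 = \<bar>sn V E (d/2) * sn' V E (d/2)\<bar>" "(q E)\<^sup>2 = \<bar>cs V E (d/2) * cs' V E (d/2)\<bar>"
      by (simp_all add: p_def q_def)
    have "p E * q E < 0" using ppos[of E] qneg[of E] E by (auto intro: mult_pos_neg)
    then have "\<bar>p E * q E\<bar> = (-1) * (p E * q E)" by simp
    from gap_multiplier[OF g sq this]
    show "p E * cs V E d + q E * sn V E d = \<rho> E * p E" "p E * cs' V E d + q E * sn' V E d = \<rho> E * q E" "\<bar>\<rho> E\<bar> < 1"
      unfolding \<rho>_def using sq a by simp_all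
  qed
  have nuI: "nu \<in> {mu..nu}" and muI: "mu \<in> {mu..nu}" and d0: "0 \<in> {0..d}" using less d_pos by auto
  have mq: "- q mu > 0" using qneg[of mu] less by simp
  obtain R \<alpha> where R: "\<And>x E. x \<in> {0..d} \<Longrightarrow> E \<in> {mu..nu} \<Longrightarrow> R x E > (0::real)"
    and c: "\<And>x E. x \<in> {0..d} \<Longrightarrow> E \<in> {mu..nu} \<Longrightarrow> phi E x = R x E * cos (\<alpha> x E)"
    and s: "\<And>x E. x \<in> {0..d} \<Longrightarrow> E \<in> {mu..nu} \<Longrightarrow> phi' E x = R x E * sin (\<alpha> x E)"
    and init: "\<alpha> 0 mu = - (pi/2)"
    and cx: "\<And>E. E \<in> {mu..nu} \<Longrightarrow> continuous_on {0..d} (\<lambda>x. \<alpha> x E)"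
    and cE: "\<And>x. x \<in> {0..d} \<Longrightarrow> continuous_on {mu..nu} (\<lambda>E. \<alpha> x E)"
    using angle_exists[OF muI mq, of "- (pi/2)"] p0 by auto
  have sinpos: "sin (\<alpha> x E) = 0 \<longleftrightarrow> phi' E x = 0"
    and cospos: "cos (\<alpha> x E) > 0 \<longleftrightarrow> phi E x > 0" "cos (\<alpha> x E) < 0 \<longleftrightarrow> phi E x < 0"
    if "x \<in> {0..d}" "E \<in> {mu..nu}" for x E
    using R[OF that] unfolding c[OF that] s[OF that] by (auto simp: zero_less_mult_iff mult_less_0_iff)
  have sc: "sin (a - - (pi/2)) = cos a" for a :: real by (simp add: sin_add)
  have a0: "- (pi/2) < \<alpha> 0 nu" "\<alpha> 0 nu < - (pi/2) + pi"
    by (rule sector_above[OF less cE[OF d0] init]; use cospos(1)[OF d0] ppos in \<open>auto simp: sc simp del: diff_minus_eq_add\<close>)+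
  have "sin (\<alpha> 0 nu) = 0" using sinpos[OF d0 nuI] q0 by simp
  then have a0nu: "\<alpha> 0 nu = 0"
    using a0 sin_inj_pi[of "\<alpha> 0 nu" 0] by simp
  have pnu: "p nu > 0" using ppos less by simp
  show ?thesis
  proof (rule exI[of _ "\<lambda>x. R x nu / p nu"], rule exI[of _ "\<lambda>x. \<alpha> x nu"], intro conjI ballI allI impI)
    fix x assume x: "x \<in> {0..d}"
    show "R x nu / p nu > 0" using R[OF x nuI] pnu by simp
    show "cs V nu x = R x nu / p nu * cos (\<alpha> x nu)" "cs' V nu x = R x nu / p nu * sin (\<alpha> x nu)"
      using c[OF x nuI] s[OF x nuI] pnu by (simp_all add: phi_def phi'_def q0 field_simps)
  next
    show "\<alpha> 0 nu = 0" by (rule a0nu)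
  next
    show "continuous_on {0..d} (\<lambda>x. \<alpha> x nu)" by (rule cx[OF nuI])
    fix t n assume t: "t \<in> {0<..<d}" and n: "of_int n * pi < \<alpha> t nu" "\<alpha> t nu \<le> (of_int n + 1) * pi"
    have sub: "{0..t} \<subseteq> {0..d}" and tI: "t \<in> {0..d}" and t0: "0 < t" using t by auto
    have cosmu: "sin (\<alpha> y mu - - (pi/2)) < 0" if "y \<in> {0<..t}" for y
    proof -
      have "phi mu y < 0" using sn_mu_pos_cell[of y] mq that t by (simp add: phi_def p0 mult_neg_pos)
      then have "cos (\<alpha> y mu) < 0" using cospos(2)[of y mu] muI that t by auto
      then show ?thesis unfolding sc .
    qed
    have atmu: "- (pi/2) - pi < \<alpha> t mu" "\<alpha> t mu < - (pi/2)"
      by (rule sector_below[OF t0 continuous_on_subset[OF cx[OF muI] sub] init cosmu]; assumption)+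
    have "has_exactly (dislocation_eigenvalues V t \<inter> {mu<..<nu}) (nat (n - (-2)))"
      by (rule count_eigenvalues[OF tI R c s cE]) (use n atmu init a0nu in auto)
    then show "has_exactly (dislocation_eigenvalues V t \<inter> {mu<..<nu}) (nat (n + 2))" by simp
  qed
qed

lemma count_monotone:
  assumes less: "mu < nu" and neg: "\<And>x. x \<in> {0<..d/2} \<Longrightarrow> cs' V nu x < 0" and t: "t \<in> {0<..<d}"
  shows "has_exactly (dislocation_eigenvalues V t \<inter> {mu<..<nu}) 1"
proof -
  obtain R A where *: "(\<forall>x\<in>{0..d}. R x > (0::real) \<and> cs V nu x = R x * cos (A x) \<and> cs' V nu x = R x * sin (A x)) \<and>
      A 0 = 0 \<and> continuous_on {0..d} A \<and>
      (\<forall>t\<in>{0<..<d}. \<forall>n. of_int n * pi < A t \<longrightarrow> A t \<le> (of_int n + 1) * pi \<longrightarrow>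
         has_exactly (dislocation_eigenvalues V t \<inter> {mu<..<nu}) (nat (n + 2)))"
    using count_mu_nu[OF less] by (elim exE)
  then have R: "\<And>x. x \<in> {0..d} \<Longrightarrow> R x > (0::real)"
    and c: "\<And>x. x \<in> {0..d} \<Longrightarrow> cs V nu x = R x * cos (A x)" and s: "\<And>x. x \<in> {0..d} \<Longrightarrow> cs' V nu x = R x * sin (A x)"
    and A0: "A 0 = (0::real)" and cA: "continuous_on {0..d} A"
    and count: "\<And>t n. t \<in> {0<..<d} \<Longrightarrow> of_int n * pi < A t \<Longrightarrow> A t \<le> (of_int n + 1) * pi \<Longrightarrow>
       has_exactly (dislocation_eigenvalues V t \<inter> {mu<..<nu}) (nat (n + 2))"
    by blast+
  have sn: "sin (A y - 0) < 0" if y: "y \<in> {0<..t}" for y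
  proof -
    have "cs' V nu y < 0" using neg[of y] neg[of "d - y"] cs'_nu_reflect[of y] y t by (cases "y \<le> d/2") auto
    then show ?thesis using s[of y] R[of y] y t by (auto simp: mult_less_0_iff)
  qed
  have "0 - pi < A t" "A t < 0"
    by (rule sector_below[OF _ continuous_on_subset[OF cA] A0 sn]; use t in auto)+
  then show ?thesis using count[OF t, of "-1"] by simp
qed

text \<open>The angle \<open>A\<close> of the Neumann solution leaves \<open>0\<close> upwards, returns to
  \<open>0\<close> at \<open>d0\<close>, falls to \<open>- pi\<close> at \<open>d - d0\<close> by antisymmetry
  about \<open>d/2\<close>, and stays below \<open>- pi\<close> after that. At \<open>d0\<close> and at
  \<open>d - d0\<close> it equals a multiple of \<open>pi\<close>, which is then not counted.\<close>

lemma count_one_extremum: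
  assumes less: "mu < nu" and d0: "0 < d0" "d0 < d/2"
    and pos: "\<And>x. x \<in> {0<..<d0} \<Longrightarrow> cs' V nu x > 0" and zero: "cs' V nu d0 = 0"
    and neg: "\<And>x. x \<in> {d0<..d/2} \<Longrightarrow> cs' V nu x < 0" and t: "t \<in> {0<..<d}"
  shows "t < d0 \<Longrightarrow> has_exactly (dislocation_eigenvalues V t \<inter> {mu<..<nu}) 2"
    "d0 \<le> t \<Longrightarrow> t < d - d0 \<Longrightarrow> has_exactly (dislocation_eigenvalues V t \<inter> {mu<..<nu}) 1"
    "d - d0 \<le> t \<Longrightarrow> has_exactly (dislocation_eigenvalues V t \<inter> {mu<..<nu}) 0"
proof -
  obtain R A where *: "(\<forall>x\<in>{0..d}. R x > (0::real) \<and> cs V nu x = R x * cos (A x) \<and> cs' V nu x = R x * sin (A x)) \<and>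
      A 0 = 0 \<and> continuous_on {0..d} A \<and>
      (\<forall>t\<in>{0<..<d}. \<forall>n. of_int n * pi < A t \<longrightarrow> A t \<le> (of_int n + 1) * pi \<longrightarrow>
         has_exactly (dislocation_eigenvalues V t \<inter> {mu<..<nu}) (nat (n + 2)))"
    using count_mu_nu[OF less] by (elim exE)
  then have R: "\<And>x. x \<in> {0..d} \<Longrightarrow> R x > (0::real)"
    and c: "\<And>x. x \<in> {0..d} \<Longrightarrow> cs V nu x = R x * cos (A x)" and s: "\<And>x. x \<in> {0..d} \<Longrightarrow> cs' V nu x = R x * sin (A x)"
    and A0: "A 0 = (0::real)" and cA: "continuous_on {0..d} A"
    and count: "\<And>t n. t \<in> {0<..<d} \<Longrightarrow> of_int n * pi < A t \<Longrightarrow> A t \<le> (of_int n + 1) * pi \<Longrightarrow>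
       has_exactly (dislocation_eigenvalues V t \<inter> {mu<..<nu}) (nat (n + 2))"
    by blast+
  have sg: "sin (A y) > 0 \<longleftrightarrow> cs' V nu y > 0" "sin (A y) < 0 \<longleftrightarrow> cs' V nu y < 0" "sin (A y) = 0 \<longleftrightarrow> cs' V nu y = 0"
    "cos (A y) > 0 \<longleftrightarrow> cs V nu y > 0" "cos (A y) < 0 \<longleftrightarrow> cs V nu y < 0" if "y \<in> {0..d}" for y
    using R[OF that] unfolding c[OF that] s[OF that] by (auto simp: zero_less_mult_iff mult_less_0_iff)
  have rising: "cs' V nu y > 0" if "y \<in> {d - d0<..<d}" for y
    using pos[of "d - y"] cs'_nu_reflect[of y] that d0 by auto
  have falling: "cs' V nu y < 0" if "y \<in> {d0<..<d - d0}" for y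
    using neg[of y] neg[of "d - y"] cs'_nu_reflect[of y] that d0 by (cases "y \<le> d/2") auto
  {
    assume td: "t < d0"
    have sp: "sin (A y - 0) > 0" if "y \<in> {0<..t}" for y using sg(1)[of y] pos[of y] that td t by auto
    have "0 < A t" "A t < 0 + pi"
      by (rule sector_above[OF _ continuous_on_subset[OF cA] A0 sp]; use t in auto)+
    then show "has_exactly (dislocation_eigenvalues V t \<inter> {mu<..<nu}) 2" using count[OF t, of 0] by simp
  }
  have Ad0: "A d0 = 0"
  proof -
    have sn: "sin (- A y - 0) < 0" if "y \<in> {0<..<d0}" for y using sg(1)[of y] pos[of y] that d0 by auto
    have "0 - pi \<le> - A d0" "- A d0 \<le> 0"
      by (rule sector_closed[OF d0(1) _ _ sn]; use A0 d0 in \<open>auto intro!: continuous_intros continuous_on_subset[OF cA]\<close>)+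
    moreover have "cos (A d0) > 0" using sg(4)[of d0] at_nu(2)[of d0] d0 by auto
    then have "A d0 \<noteq> pi" by auto
    moreover have "sin (A d0) = 0" using sg(3)[of d0] zero d0 by auto
    ultimately show ?thesis using sin_gt_zero[of "A d0"] by (cases "A d0 = 0") auto
  qed
  have mid: "A y > - pi \<and> A y < 0" if y: "y \<in> {d0<..<d - d0}" for y
  proof -
    have sn: "sin (A z - 0) < 0" if "z \<in> {d0<..y}" for z using sg(2)[of z] falling[of z] that y d0 by auto
    have "0 - pi < A y" "A y < 0"
      by (rule sector_below[OF _ continuous_on_subset[OF cA] Ad0 sn]; use y d0 in auto)+
    then show ?thesis by simp
  qed
  show "has_exactly (dislocation_eigenvalues V t \<inter> {mu<..<nu}) 1" if "d0 \<le> t" "t < d - d0"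
    using count[OF t, of "-1"] mid[of t] Ad0 that by (cases "t = d0") auto
  \<comment> \<open>The Neumann solution is negative at \<open>d - d0\<close>, which excludes the angle
    \<open>0\<close>.\<close>
  have Ad1: "A (d - d0) = - pi"
  proof -
    have sn: "sin (A y - 0) < 0" if "y \<in> {d0<..<d - d0}" for y using sg(2)[of y] falling[of y] that d0 by auto
    have "0 - pi \<le> A (d - d0)" "A (d - d0) \<le> 0"
      by (rule sector_closed[OF _ continuous_on_subset[OF cA] Ad0 sn]; use d0 in auto)+
    moreover have "cos (A (d - d0)) < 0" using sg(5)[of "d - d0"] cs_nu_antiperiodic(1)[of d0] at_nu(2)[of d0] d0 by auto
    then have "A (d - d0) \<noteq> 0" by auto
    moreover have "sin (A (d - d0)) = 0" using sg(3)[of "d - d0"] cs'_nu_reflect[of "d - d0"] zero d0 by auto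
    ultimately show ?thesis using sin_gt_zero[of "- A (d - d0)"] by (cases "A (d - d0) = - pi") auto
  qed
  show "has_exactly (dislocation_eigenvalues V t \<inter> {mu<..<nu}) 0" if td: "d - d0 \<le> t"
  proof (cases "t = d - d0")
    case True
    then show ?thesis using count[OF t, of "-2"] Ad1 by simp
  next
    case False
    have sn: "sin (A y - - pi) < 0" if "y \<in> {d - d0<..t}" for y
      using sg(1)[of y] rising[of y] that t d0 by (auto simp: sin_add)
    have "- pi - pi < A t" "A t < - pi"
      by (rule sector_below[OF _ continuous_on_subset[OF cA] Ad1 sn]; use False td t d0 in auto)+
    then show ?thesis using count[OF t, of "-2"] by simp
  qed
qed

lemma cs_nu_strict_mono:
  assumes "0 \<le> a" "\<And>x. x \<in> {a<..<b} \<Longrightarrow> cs' V nu x > 0"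
  shows "strict_mono_on {a..b} (cs V nu)"
proof (rule strict_mono_onI)
  fix x y assume xy: "x \<in> {a..b}" "y \<in> {a..b}" "x < y"
  show "cs V nu x < cs V nu y"
    by (rule strict_mono_from_deriv[where f = "cs V nu" and f' = "cs' V nu" and a = x and b = y])
       (use assms xy in \<open>auto intro: DERIV_subset[OF solves_onD(1)[OF cs_solves]]\<close>)
qed

lemma cs_nu_strict_antimono:
  assumes "0 \<le> a" "\<And>x. x \<in> {a<..<b} \<Longrightarrow> cs' V nu x < 0"
  shows "strict_antimono_on {a..b} (cs V nu)"
proof (rule monotone_onI)
  fix x y assume xy: "x \<in> {a..b}" "y \<in> {a..b}" "x < y"
  have "- cs V nu x < - cs V nu y"
    by (rule strict_mono_from_deriv[where f = "\<lambda>x. - cs V nu x" and f' = "\<lambda>x. - cs' V nu x" and a = x and b = y])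
       (use assms xy in \<open>auto intro!: DERIV_minus intro: DERIV_subset[OF solves_onD(1)[OF cs_solves]]\<close>)
  then show "cs V nu x > cs V nu y" by simp
qed

end

lemma not_strictly_monotone_over_peak:
  fixes s u :: "real \<Rightarrow> real"
  assumes u: "\<And>x. x \<in> {a..b} \<Longrightarrow> u x = k * s x" and m: "a < m" "m < b" and s: "s a < s m" "s b < s m"
  shows "\<not> strictly_monotone_on {a..b} u"
proof
  assume "strictly_monotone_on {a..b} u"
  then have "(u a < u m \<and> u m < u b) \<or> (u a > u m \<and> u m > u b)"
    unfolding strictly_monotone_on_def using m by (auto simp: monotone_on_def)
  then have "(k * (s m - s a) > 0 \<and> k * (s b - s m) > 0) \<or> (k * (s m - s a) < 0 \<and> k * (s b - s m) < 0)"
    using u[of a] u[of m] u[of b] m by (auto simp: algebra_simps)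
  then show False using s by (auto simp: zero_less_mult_iff mult_less_0_iff)
qed

section \<open>The shape of the second Neumann eigenfunction and the theorem\<close>

context even_periodic_potential begin

lemma neumann_eigenfunction_shape:
  assumes dec: "strict_antimono_on {0..d/2} V" and less: "mu < nu" and u: "neumann_eigenfunction V d 2 u"
  shows "strictly_monotone_on {0..d/2} u \<or> (\<exists>d0. changes_monotonicity_once_at 0 (d/2) u d0)"
    "strictly_monotone_on {0..d/2} u \<Longrightarrow> t \<in> {0<..<d} \<Longrightarrow>
       has_exactly (dislocation_eigenvalues V t \<inter> {mu<..<nu}) 1"
    "changes_monotonicity_once_at 0 (d/2) u d0 \<Longrightarrow>
       0 < d0 \<and> d0 < d/2 \<and> (\<forall>x\<in>{0<..<d0}. cs' V nu x > 0) \<and> cs' V nu d0 = 0 \<and> (\<forall>x\<in>{d0<..d/2}. cs' V nu x < 0)"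
proof -
  obtain k where k: "k \<noteq> 0" and uk: "\<And>x. x \<in> {0..d} \<Longrightarrow> u x = k * cs V nu x"
    using neumann_eigenfunctionE[OF u] by metis
  have uk': "u x = k * cs V nu x" if "x \<in> {0..d/2}" for x using uk[of x] that d_pos by auto
  have mono_u: "(strict_mono_on {a..b} (cs V nu) \<longrightarrow> (if k > 0 then strict_mono_on {a..b} u else strict_antimono_on {a..b} u)) \<and>
      (strict_antimono_on {a..b} (cs V nu) \<longrightarrow> (if k > 0 then strict_antimono_on {a..b} u else strict_mono_on {a..b} u))"
    if "0 \<le> a" "b \<le> d/2" for a b
    using that k uk' by (auto simp: monotone_on_def mult_less_cancel_left)
  note dich = cs'_nu_decreasing[OF dec]
  have b1_mono: "strict_antimono_on {0..d/2} (cs V nu)" if "\<forall>x\<in>{0<..d/2}. cs' V nu x < 0"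
    by (rule cs_nu_strict_antimono) (use that in auto)
  have b2_mono: "strict_mono_on {0..e} (cs V nu)" "strict_antimono_on {e..d/2} (cs V nu)"
    if "0 < e" "\<forall>x\<in>{0<..<e}. cs' V nu x > 0" "\<forall>x\<in>{e<..d/2}. cs' V nu x < 0" for e
    by (rule cs_nu_strict_mono, use that in auto)[1] (rule cs_nu_strict_antimono, use that in auto)
  have peak: "\<not> strictly_monotone_on {a..b} u"
    if e: "0 < e" "\<forall>x\<in>{0<..<e}. cs' V nu x > 0" "\<forall>x\<in>{e<..d/2}. cs' V nu x < 0" 
      and ab: "0 \<le> a" "a < e" "e < b" "b \<le> d/2" for a b e
  proof (rule not_strictly_monotone_over_peak[of a b u k "cs V nu" e])
    show "cs V nu a < cs V nu e" using strict_mono_onD[OF b2_mono(1)[OF e], of a e] ab by auto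
    show "cs V nu b < cs V nu e" using monotone_onD[OF b2_mono(2)[OF e], of e b] ab by auto
  qed (use uk' ab in auto)
  show "strictly_monotone_on {0..d/2} u \<or> (\<exists>d0. changes_monotonicity_once_at 0 (d/2) u d0)"
    using dich
  proof (elim disjE exE conjE)
    assume "\<forall>x\<in>{0<..d/2}. cs' V nu x < 0"
    from b1_mono[OF this] have "strictly_monotone_on {0..d/2} u"
      using mono_u[of 0 "d/2"] d_pos by (auto simp: strictly_monotone_on_def split: if_splits)
    then show ?thesis ..
  next
    fix e assume e: "0 < e" "e < d/2" "\<forall>x\<in>{0<..<e}. cs' V nu x > 0" "\<forall>x\<in>{e<..d/2}. cs' V nu x < 0"
    have "changes_monotonicity_once_at 0 (d/2) u e"
      unfolding changes_monotonicity_once_at_def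
      using mono_u[of 0 e] mono_u[of e "d/2"] b2_mono[OF e(1,3,4)] e(1,2) by (auto split: if_splits)
    then show ?thesis by blast
  qed
  show "has_exactly (dislocation_eigenvalues V t \<inter> {mu<..<nu}) 1"
    if m: "strictly_monotone_on {0..d/2} u" and t: "t \<in> {0<..<d}"
    using dich
  proof (elim disjE exE conjE)
    assume "\<forall>x\<in>{0<..d/2}. cs' V nu x < 0"
    then show ?thesis using count_monotone[OF less _ t] by blast
  next
    fix e assume "0 < e" "e < d/2" "\<forall>x\<in>{0<..<e}. cs' V nu x > 0" "\<forall>x\<in>{e<..d/2}. cs' V nu x < 0"
    then show ?thesis using peak[of e 0 "d/2"] m by auto
  qed
  show "0 < d0 \<and> d0 < d/2 \<and> (\<forall>x\<in>{0<..<d0}. cs' V nu x > 0) \<and> cs' V nu d0 = 0 \<and> (\<forall>x\<in>{d0<..d/2}. cs' V nu x < 0)"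
    if ch: "changes_monotonicity_once_at 0 (d/2) u d0"
  proof -
    have d0: "0 < d0" "d0 < d/2" using ch by (auto simp: changes_monotonicity_once_at_def)
    have sm: "strictly_monotone_on {0..d0} u" "strictly_monotone_on {d0..d/2} u"
      using ch by (auto simp: changes_monotonicity_once_at_def strictly_monotone_on_def)
    from dich show ?thesis
    proof (elim disjE exE conjE)
      assume "\<forall>x\<in>{0<..d/2}. cs' V nu x < 0"
      note anti = b1_mono[OF this]
      have "cs V nu d0 < cs V nu 0" "cs V nu (d/2) < cs V nu d0"
        using monotone_onD[OF anti, of 0 d0] monotone_onD[OF anti, of d0 "d/2"] d0 by auto
      moreover have "(u 0 < u d0 \<and> u (d/2) < u d0) \<or> (u d0 < u 0 \<and> u d0 < u (d/2))"
        using ch d0 unfolding changes_monotonicity_once_at_def by (auto simp: monotone_on_def)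
      ultimately show ?thesis
        using uk'[of 0] uk'[of d0] uk'[of "d/2"] d0 by (auto simp: mult_less_cancel_left)
    next
      fix e assume e: "0 < e" "e < d/2" "\<forall>x\<in>{0<..<e}. cs' V nu x > 0" "cs' V nu e = 0" "\<forall>x\<in>{e<..d/2}. cs' V nu x < 0"
      have "d0 = e"
      proof (rule linorder_cases[of d0 e])
        assume "d0 < e"
        then show ?thesis using peak[OF e(1,3,5), of d0 "d/2"] sm(2) d0 e by auto
      next
        assume "e < d0"
        then show ?thesis using peak[OF e(1,3,5), of 0 d0] sm(1) d0 e by auto
      qed
      then show ?thesis using e by simp
    qed
  qed
qed

end

theorem theorem3p16:
  fixes d :: real and V\<^sub>0 :: "real \<Rightarrow> real"
  assumes "d > 0"
    and "\<And>x. V\<^sub>0 (- x) = V\<^sub>0 x"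
    and "\<And>x. V\<^sub>0 (x + d) = V\<^sub>0 x"
    and "V\<^sub>0 C1_differentiable_on UNIV"
  shows
    "(strict_mono_on {0..d/2} V\<^sub>0 \<longrightarrow>
        gap V\<^sub>0 d 1 = {neumann_ev V\<^sub>0 d 2 <..< dirichlet_ev V\<^sub>0 d 1} \<and>
        (\<forall>t\<in>{0<..<d}. has_exactly (dislocation_eigenvalues V\<^sub>0 t \<inter> gap V\<^sub>0 d 1) 1)) \<and>
     (strict_antimono_on {0..d/2} V\<^sub>0 \<longrightarrow>
        gap V\<^sub>0 d 1 = {dirichlet_ev V\<^sub>0 d 1 <..< neumann_ev V\<^sub>0 d 2} \<and>
        (\<forall>u. neumann_eigenfunction V\<^sub>0 d 2 u \<longrightarrow>
           (strictly_monotone_on {0..d/2} u \<or>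
              (\<exists>d\<^sub>0. changes_monotonicity_once_at 0 (d/2) u d\<^sub>0)) \<and>
           (strictly_monotone_on {0..d/2} u \<longrightarrow>
              (\<forall>t\<in>{0<..<d}. has_exactly (dislocation_eigenvalues V\<^sub>0 t \<inter> gap V\<^sub>0 d 1) 1)) \<and>
           (\<forall>d\<^sub>0. changes_monotonicity_once_at 0 (d/2) u d\<^sub>0 \<longrightarrow>
              (\<forall>t\<in>{0<..<d\<^sub>0}. has_exactly (dislocation_eigenvalues V\<^sub>0 t \<inter> gap V\<^sub>0 d 1) 2) \<and>
              (\<forall>t\<in>{d\<^sub>0..<d - d\<^sub>0}. has_exactly (dislocation_eigenvalues V\<^sub>0 t \<inter> gap V\<^sub>0 d 1) 1) \<and>
              (\<forall>t\<in>{d - d\<^sub>0..<d}. has_exactly (dislocation_eigenvalues V\<^sub>0 t \<inter> gap V\<^sub>0 d 1) 0))))"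
proof -
  obtain V' where V': "\<And>x. (V\<^sub>0 has_real_derivative V' x) (at x)"
    using assms(4) unfolding C1_differentiable_on_def
    by (auto simp: has_real_derivative_iff_has_vector_derivative)
  interpret even_periodic_potential V\<^sub>0 d
  proof
    show "continuous_on UNIV V\<^sub>0" using V' DERIV_continuous_on by blast
  qed (use assms in auto)
  show ?thesis
    unfolding neumann_ev_2 dirichlet_ev_1
  proof (intro conjI impI allI)
    assume inc: "strict_mono_on {0..d/2} V\<^sub>0"
    have less: "nu < mu" by (rule nu_less_mu[OF inc V'])
    show gap: "gap V\<^sub>0 d 1 = {nu<..<mu}" using gap_1 less by simp
    show "\<forall>t\<in>{0<..<d}. has_exactly (dislocation_eigenvalues V\<^sub>0 t \<inter> gap V\<^sub>0 d 1) 1"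
      unfolding gap using count_nu_mu[OF less cs'_nu_neg_increasing[OF inc]] by blast
  next
    assume dec: "strict_antimono_on {0..d/2} V\<^sub>0"
    have less: "mu < nu" by (rule mu_less_nu[OF dec V'])
    show gap: "gap V\<^sub>0 d 1 = {mu<..<nu}" using gap_1 less by simp
    fix u assume u: "neumann_eigenfunction V\<^sub>0 d 2 u"
    note shape = neumann_eigenfunction_shape[OF dec less u]
    show "strictly_monotone_on {0..d/2} u \<or> (\<exists>d\<^sub>0. changes_monotonicity_once_at 0 (d/2) u d\<^sub>0)"
      by (rule shape(1))
    show "\<forall>t\<in>{0<..<d}. has_exactly (dislocation_eigenvalues V\<^sub>0 t \<inter> gap V\<^sub>0 d 1) 1"
      if "strictly_monotone_on {0..d/2} u"
      unfolding gap using shape(2)[OF that] by blast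
    fix d\<^sub>0 assume ch: "changes_monotonicity_once_at 0 (d/2) u d\<^sub>0"
    have d0: "0 < d\<^sub>0" "d\<^sub>0 < d/2" and pos: "\<And>x. x \<in> {0<..<d\<^sub>0} \<Longrightarrow> cs' V\<^sub>0 nu x > 0"
      and zero: "cs' V\<^sub>0 nu d\<^sub>0 = 0" and neg: "\<And>x. x \<in> {d\<^sub>0<..d/2} \<Longrightarrow> cs' V\<^sub>0 nu x < 0"
      using shape(3)[OF ch] by blast+
    note count = count_one_extremum[OF less d0 pos zero neg]
    show "\<forall>t\<in>{0<..<d\<^sub>0}. has_exactly (dislocation_eigenvalues V\<^sub>0 t \<inter> gap V\<^sub>0 d 1) 2"
      "\<forall>t\<in>{d\<^sub>0..<d - d\<^sub>0}. has_exactly (dislocation_eigenvalues V\<^sub>0 t \<inter> gap V\<^sub>0 d 1) 1"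
      "\<forall>t\<in>{d - d\<^sub>0..<d}. has_exactly (dislocation_eigenvalues V\<^sub>0 t \<inter> gap V\<^sub>0 d 1) 0"
      unfolding gap using count d0 by auto
  qed
qed

end
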